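(* Let $\mathbb{F}$ be a field of characteristic $0$, let $n\ge 1$ and $s\ge 2^n$ be integers, and let $m$ be a nonnegative integer. If $I\subset \mathbb{F}[x_0,\dots,x_n]$ is the radical ideal of $s$ general points in $\mathbb{P}^n$, then $$I^{(nm)}\subset M^{(n-1)m}I^m,$$ where $M=(x_0,\dots,x_n)$. As a corollary, the Chudnovsky Conjecture holds for a very general set of at least $2^n$ points in $\mathbb{P}^n$; that is, if $I$ is the radical ideal of $s\ge 2^n$ very general points in $\mathbb{P}^n$, then $$\frac{\alpha(I^{(m)})}{m}\ \ge\ \frac{\alpha(I)+n-1}{n}\qquad\text{for all integers } m\ge 1,$$ and in particular $\widehat{\alpha}(I)\ge \frac{\alpha(I)+n-1}{n}$.
   Context: $\mathbb{P}^n$ is projective $n$-space over $\mathbb{F}$, with homogeneous coordinate ring $\mathbb{F}[\mathbb{P}^n]=\mathbb{F}[x_0,\dots,x_n]$, and $M=(x_0,\dots,x_n)$ is the irrelevant maximal ideal. For distinct points $P_1,\dots,P_s\in\mathbb{P}^n$, their radical ideal is $I=\bigcap_{i=1}^s I(P_i)$, where $I(P_i)$ is the homogeneous ideal generated by all forms vanishing at $P_i$. Its $m$-th symbolic power is $I^{(m)}=\bigcap_{i=1}^s I(P_i)^m$ (the ideal generated by the forms vanishing at each $P_i$ to order at least $m$), with $I^{(0)}=I^0=\mathbb{F}[x_0,\dots,x_n]$. For a nonzero homogeneous ideal $J$, $\alpha(J)$ is the minimal degree of a nonzero element of $J$. The Waldschmidt constant is $\widehat{\alpha}(I)=\lim_{m\to\infty}\alpha(I^{(m)})/m=\inf_{m\ge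 1}\alpha(I^{(m)})/m$ (the limit exists). A statement holds for $s$ general points in $\mathbb{P}^n$ if it holds for all $(P_1,\dots,P_s)$ in some nonempty Zariski-open subset of $(\mathbb{P}^n)^s$; in the containment, $m$ is fixed and this open subset may depend on $n$, $s$ and $m$. A statement holds for $s$ very general points (or a very general set of $s$ points) if it holds for all $(P_1,\dots,P_s)$ in the complement of a countable union of proper Zariski-closed subsets of $(\mathbb{P}^n)^s$. *)

theory Defs
  imports Complex_Main "HOL-Library.Poly_Mapping" "HOL-Library.FuncSet" "HOL-Library.Countable_Set"
    "HOL-Algebra.Ideal_Product"
begin

text \<open>
  A polynomial with variables indexed by \<open>'i\<close> is a finitely supported map from exponent vectors
  to coefficients; the multiplication of \<^theory>\<open>HOL-Library.Poly_Mapping\<close> is the convolution product.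
\<close>

type_synonym ('i, 'k) mpoly = "('i \<Rightarrow>\<^sub>0 nat) \<Rightarrow>\<^sub>0 'k"

definition mvar :: "'i \<Rightarrow> ('i, 'k::comm_ring_1) mpoly" where
  "mvar i = Poly_Mapping.single (Poly_Mapping.single i 1) 1"

definition monom_degree :: "('i \<Rightarrow>\<^sub>0 nat) \<Rightarrow> nat" where
  "monom_degree e = (\<Sum>i\<in>Poly_Mapping.keys e. Poly_Mapping.lookup e i)"

definition total_degree :: "('i, 'k::zero) mpoly \<Rightarrow> nat" where
  "total_degree f = Max (insert 0 (monom_degree ` Poly_Mapping.keys f))"

definition mpoly_eval :: "('i, 'k::comm_ring_1) mpoly \<Rightarrow> ('i \<Rightarrow> 'k) \<Rightarrow> 'k" where
  "mpoly_eval f v = (\<Sum>e\<in>Poly_Mapping.keys f.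
     Poly_Mapping.lookup f e * (\<Prod>i\<in>Poly_Mapping.keys e. v i ^ Poly_Mapping.lookup e i))"

text \<open>The type \<open>(nat, 'k) mpoly\<close> has infinitely many variables; the carrier keeps
  exactly the polynomials in the variables with index \<open>0, \<dots>, n\<close>.\<close>

definition poly_ring :: "nat \<Rightarrow> (nat, 'k::comm_ring_1) mpoly ring" where
  "poly_ring n =
    \<lparr> carrier = {f. \<forall>e\<in>Poly_Mapping.keys f. Poly_Mapping.keys e \<subseteq> {..n}},
      mult = (*), one = 1, zero = 0, add = (+) \<rparr>"

lemma poly_ring_cring: "cring (poly_ring n :: (nat, 'k::comm_ring_1) mpoly ring)"
proof -
  let ?R = "poly_ring n :: (nat, 'k) mpoly ring"
  have carrier_iff: "f \<in> carrier ?R \<longleftrightarrow> (\<forall>e\<in>Poly_Mapping.keys f. Poly_Mapping.keys e \<subseteq> {..n})" for f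
    by (simp add: poly_ring_def)
  have add: "f + g \<in> carrier ?R" if "f \<in> carrier ?R" "g \<in> carrier ?R" for f g
    unfolding carrier_iff
  proof
    fix e assume "e \<in> Poly_Mapping.keys (f + g)"
    then have "e \<in> Poly_Mapping.keys f \<or> e \<in> Poly_Mapping.keys g"
      using subsetD[OF Poly_Mapping.keys_add] by fast
    then show "Poly_Mapping.keys e \<subseteq> {..n}"
      using that unfolding carrier_iff by fast
  qed
  have mult: "f * g \<in> carrier ?R" if "f \<in> carrier ?R" "g \<in> carrier ?R" for f g
    unfolding carrier_iff
  proof
    fix e assume "e \<in> Poly_Mapping.keys (f * g)"
    then have "e \<in> {a + b |a b. a \<in> Poly_Mapping.keys f \<and> b \<in> Poly_Mapping.keys g}"
      by (rule subsetD[OF Poly_Mapping.keys_mult])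
    then obtain a b where ab: "a \<in> Poly_Mapping.keys f" "b \<in> Poly_Mapping.keys g" "e = a + b"
      by fast
    have "Poly_Mapping.keys a \<subseteq> {..n}" "Poly_Mapping.keys b \<subseteq> {..n}"
      using ab that unfolding carrier_iff by fast+
    then show "Poly_Mapping.keys e \<subseteq> {..n}"
      using subset_trans[OF Poly_Mapping.keys_add Un_least] ab(3) by fast
  qed
  have uminus: "- f \<in> carrier ?R" if "f \<in> carrier ?R" for f
    using that by (simp add: carrier_iff in_keys_iff)
  have one: "1 \<in> carrier ?R" and zero: "0 \<in> carrier ?R"
    by (simp_all add: carrier_iff)
  have ops: "x \<oplus>\<^bsub>?R\<^esub> y = x + y" "x \<otimes>\<^bsub>?R\<^esub> y = x * y" "\<zero>\<^bsub>?R\<^esub> = 0" "\<one>\<^bsub>?R\<^esub> = 1" for x y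
    by (simp_all add: poly_ring_def)
  show ?thesis
  proof (rule cringI)
    show "abelian_group ?R"
    proof (rule abelian_groupI)
      fix x assume "x \<in> carrier ?R"
      then show "\<exists>y\<in>carrier ?R. y \<oplus>\<^bsub>?R\<^esub> x = \<zero>\<^bsub>?R\<^esub>"
        using uminus[of x] by (intro bexI[of _ "- x"]) (simp_all only: ops left_minus)
    qed (simp_all add: ops add zero add.assoc add.commute)
    show "Group.comm_monoid ?R"
      by (rule comm_monoidI) (simp_all add: ops mult one mult.assoc mult.commute)
  qed (simp add: ops distrib_right)
qed

definition irrelevant_ideal :: "nat \<Rightarrow> (nat, 'k::comm_ring_1) mpoly set" where
  "irrelevant_ideal n = Idl\<^bsub>poly_ring n\<^esub> (mvar ` {..n})"

definition is_form :: "nat \<Rightarrow> (nat, 'k::comm_ring_1) mpoly \<Rightarrow> bool" where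
  "is_form n f \<longleftrightarrow> f \<in> carrier (poly_ring n) \<and>
     (\<exists>d. \<forall>e\<in>Poly_Mapping.keys f. monom_degree e = d)"

text \<open>Vectors of \<open>'k\<^sup>n\<^sup>+\<^sup>1\<close> are functions on \<^typ>\<open>nat\<close> that vanish beyond index \<open>n\<close>;
  a point of projective space is a class of nonzero vectors up to scaling.\<close>

definition nonzero_vectors :: "nat \<Rightarrow> (nat \<Rightarrow> 'k::field) set" where
  "nonzero_vectors n = {v. (\<forall>j>n. v j = 0) \<and> (\<exists>j\<le>n. v j \<noteq> 0)}"

definition scaling_rel :: "nat \<Rightarrow> ((nat \<Rightarrow> 'k::field) \<times> (nat \<Rightarrow> 'k)) set" where
  "scaling_rel n = {(v, w). v \<in> nonzero_vectors n \<and> w \<in> nonzero_vectors n \<and>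
     (\<exists>c. c \<noteq> 0 \<and> w = (\<lambda>j. c * v j))}"

definition proj_space :: "nat \<Rightarrow> (nat \<Rightarrow> 'k::field) set set" where
  "proj_space n = nonzero_vectors n // scaling_rel n"

definition proj_tuples :: "nat \<Rightarrow> nat \<Rightarrow> (nat \<Rightarrow> (nat \<Rightarrow> 'k::field) set) set" where
  "proj_tuples n s = {..<s} \<rightarrow>\<^sub>E proj_space n"

definition point_ideal :: "nat \<Rightarrow> (nat \<Rightarrow> 'k::field) set \<Rightarrow> (nat, 'k) mpoly set" where
  "point_ideal n p = Idl\<^bsub>poly_ring n\<^esub> {f. is_form n f \<and> (\<forall>v\<in>p. mpoly_eval f v = 0)}"

definition radical_ideal ::
    "nat \<Rightarrow> nat \<Rightarrow> (nat \<Rightarrow> (nat \<Rightarrow> 'k::field) set) \<Rightarrow> (nat, 'k) mpoly set" where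
  "radical_ideal n s P = {f \<in> carrier (poly_ring n). \<forall>i<s. f \<in> point_ideal n (P i)}"

definition symbolic_power ::
    "nat \<Rightarrow> nat \<Rightarrow> (nat \<Rightarrow> (nat \<Rightarrow> 'k::field) set) \<Rightarrow> nat \<Rightarrow> (nat, 'k) mpoly set" where
  "symbolic_power n s P m = {f \<in> carrier (poly_ring n).
     \<forall>i<s. f \<in> point_ideal n (P i) [^]\<^bsub>ideals_set (poly_ring n)\<^esub> m}"

definition initial_degree :: "('i, 'k::zero) mpoly set \<Rightarrow> nat" where
  "initial_degree J = (LEAST d. \<exists>f\<in>J. f \<noteq> 0 \<and> total_degree f = d)"

definition waldschmidt_constant ::
    "nat \<Rightarrow> nat \<Rightarrow> (nat \<Rightarrow> (nat \<Rightarrow> 'k::field) set) \<Rightarrow> real" where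
  "waldschmidt_constant n s P =
     lim (\<lambda>m. real (initial_degree (symbolic_power n s P m)) / real m)"

text \<open>The variable with index \<open>(i, j)\<close> is the \<open>j\<close>-th homogeneous coordinate of the \<open>i\<close>-th factor of
  \<open>(\<bbbP>\<^sup>n)\<^sup>s\<close>; \<open>d i\<close> is the degree in the coordinates of the \<open>i\<close>-th factor.\<close>

definition is_multiform :: "nat \<Rightarrow> nat \<Rightarrow> (nat \<times> nat, 'k::comm_ring_1) mpoly \<Rightarrow> bool" where
  "is_multiform n s f \<longleftrightarrow>
     (\<forall>e\<in>Poly_Mapping.keys f. Poly_Mapping.keys e \<subseteq> {..<s} \<times> {..n}) \<and>
     (\<exists>d. \<forall>e\<in>Poly_Mapping.keys f. \<forall>i<s. (\<Sum>j\<le>n. Poly_Mapping.lookup e (i, j)) = d i)"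

definition multiform_vanishes ::
    "nat \<Rightarrow> (nat \<times> nat, 'k::field) mpoly \<Rightarrow> (nat \<Rightarrow> (nat \<Rightarrow> 'k) set) \<Rightarrow> bool" where
  "multiform_vanishes s f P \<longleftrightarrow>
     (\<forall>v. (\<forall>i<s. v i \<in> P i) \<longrightarrow> mpoly_eval f (\<lambda>(i, j). v i j) = 0)"

definition zariski_closed :: "nat \<Rightarrow> nat \<Rightarrow> (nat \<Rightarrow> (nat \<Rightarrow> 'k::field) set) set \<Rightarrow> bool" where
  "zariski_closed n s Z \<longleftrightarrow> (\<exists>S. (\<forall>f\<in>S. is_multiform n s f) \<and>
     Z = {P \<in> proj_tuples n s. \<forall>f\<in>S. multiform_vanishes s f P})"

definition zariski_open :: "nat \<Rightarrow> nat \<Rightarrow> (nat \<Rightarrow> (nat \<Rightarrow> 'k::field) set) set \<Rightarrow> bool" where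
  "zariski_open n s U \<longleftrightarrow> U \<subseteq> proj_tuples n s \<and> zariski_closed n s (proj_tuples n s - U)"

definition holds_general ::
    "nat \<Rightarrow> nat \<Rightarrow> ((nat \<Rightarrow> (nat \<Rightarrow> 'k::field) set) \<Rightarrow> bool) \<Rightarrow> bool" where
  "holds_general n s Q \<longleftrightarrow> (\<exists>U. zariski_open n s U \<and> U \<noteq> {} \<and> (\<forall>P\<in>U. Q P))"

definition holds_very_general ::
    "nat \<Rightarrow> nat \<Rightarrow> ((nat \<Rightarrow> (nat \<Rightarrow> 'k::field) set) \<Rightarrow> bool) \<Rightarrow> bool" where
  "holds_very_general n s Q \<longleftrightarrow>
     (\<exists>\<Z>. countable \<Z> \<and> (\<forall>Z\<in>\<Z>. zariski_closed n s Z \<and> Z \<noteq> proj_tuples n s) \<and>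
       (\<forall>P \<in> proj_tuples n s - \<Union>\<Z>. Q P))"

end

theory Submission
  imports Defs "HOL-Computational_Algebra.Polynomial"
begin

text \<open>
  Fix \<open>r\<close> such that \<open>s\<close> general points impose independent conditions on forms of degree \<open>r - 1\<close>, and
  choose coordinates with \<open>x\<^sub>0\<close> nonzero at all points. Modulo \<open>x\<^sub>0\<close> the forms of degree \<open>r\<close> in \<open>I\<close> fill up
  all forms of degree \<open>r\<close> in \<open>x\<^sub>1, \<dots>, x\<^sub>n\<close>. Since the relations between products of monomials of degree
  \<open>r\<close> are generated by exchanges of two variables as soon as there is one surplus variable, \<open>x\<^sub>0\<close> can be
  cancelled: if \<open>x\<^sub>0 f\<close> lies in the span of products of \<open>m\<close> elements of \<open>I\<^sub>r\<close> and of degree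
  \<open>> m r\<close>, then \<open>f\<close> lies in that span. A power of \<open>x\<^sub>0\<close> multiplies \<open>I\<^sup>(\<^sup>m\<^sup>)\<close> into it, so \<open>I\<^sup>(\<^sup>m\<^sup>)\<close> and
  \<open>M\<^sup>t\<^sup>-\<^sup>m\<^sup>r I\<^sub>r\<^sup>m\<close> agree in degrees \<open>t \<ge> m r\<close>. Hence the containment follows from
  \<open>\<alpha>(I\<^sup>(\<^sup>n\<^sup>m\<^sup>)) \<ge> m (r + n - 1)\<close>, and so does the Chudnovsky bound, as \<open>\<alpha>(I) \<le> r\<close>.

  The bound on \<open>\<alpha>\<close> is semicontinuous, so one special position suffices. If \<open>k\<^sup>n \<le> s < (k + 1)\<^sup>n\<close>, a grid of
  \<open>k\<^sup>n\<close> points works with \<open>r = n (k - 1) + 1\<close>, except for \<open>k = 2\<close>, \<open>n \<in> {2, 3, 4}\<close> and \<open>s\<close> larger than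
  \<open>(2n choose n)\<close>. There \<open>r = n + 2\<close> and \<open>7 \<sqdot> 3\<^sup>n\<^sup>-\<^sup>2\<close> points over seven special points of the plane do.
\<close>

text \<open>The surplus variable is what makes the cancellation of x_0 possible. Dividing an element
  of I_r by x_0 gives an element of I of degree r - 1, which no longer counts as one of the m
  factors; a variable borrowed from the surplus brings it back to degree r.

  Two numbers have to match: r, which must satisfy s \<le> (n + r - 1 choose n) for the conditions
  to be independent, and a lower bound c for degree over multiplicity at some set of at most s
  special points. Everything closes as soon as r + n - 1 \<le> n c. A grid with k points in each
  direction has c = k, so r = n (k - 1) + 1 is the largest r it allows. In the exceptional cases k =
  2 this r is n + 1, whose binomial (2n choose n) is too small; the next value r = n + 2 needs c
  \<ge> (2n + 1)/n, which exceeds 2. Seven points of the plane give c = 5/2, and 2n + 1 \<le> 5n/2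
  for n \<ge> 2.

  Semicontinuity is applied for each m separately, in the single degree m (r + n - 1) - 1. One m
  gives one closed set, enough for the containment; the Chudnovsky bound needs all m at once, hence
  a countable union.\<close>

abbreviation lookup where "lookup \<equiv> Poly_Mapping.lookup"
abbreviation keys where "keys \<equiv> Poly_Mapping.keys"
abbreviation single where "single \<equiv> Poly_Mapping.single"

lemma lookup_sum_single:
  assumes "finite A"
  shows "lookup (\<Sum>e\<in>A. single e (w e)) x = (if x \<in> A then w x else 0)"
proof -
  have "lookup (\<Sum>e\<in>A. single e (w e)) x = (\<Sum>e\<in>A. if e = x then w x else 0)"
    unfolding lookup_sum by (intro sum.cong) (auto simp: lookup_single when_def)
  then show ?thesis using assms by simp
qed

lemma poly_mapping_expand:
  fixes f :: "'a \<Rightarrow>\<^sub>0 'b::comm_monoid_add"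
  shows "f = (\<Sum>e\<in>keys f. single e (lookup f e))"
  by (rule poly_mapping_eqI) (simp add: lookup_sum_single in_keys_iff)

lemma poly_mapping_induct [case_names single add]:
  fixes f :: "'a \<Rightarrow>\<^sub>0 'b::comm_monoid_add"
  assumes s: "\<And>e c. P (single e c)" and a: "\<And>f g. P f \<Longrightarrow> P g \<Longrightarrow> P (f + g)"
  shows "P f"
proof -
  have "P (\<Sum>e\<in>A. single e (lookup f e))" if "finite A" for A
    using that
  proof induction
    case empty
    show ?case using s[of undefined 0] by simp
  qed (simp add: s a)
  then show ?thesis using poly_mapping_expand[of f] by (metis finite_keys)
qed

lemma poly_mapping_remove:
  "i \<in> keys e \<Longrightarrow> single i 1 + (e - single i 1) = (e :: 'a \<Rightarrow>\<^sub>0 nat)"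
  by (intro poly_mapping_eqI) (auto simp: lookup_add lookup_minus lookup_single when_def in_keys_iff)

lemma ex_key: "f \<noteq> 0 \<Longrightarrow> \<exists>e. e \<in> keys f"
  by (metis in_keys_iff lookup_zero poly_mapping_eqI)

lemma lookup_single_mult:
  fixes f :: "('i \<Rightarrow>\<^sub>0 nat) \<Rightarrow>\<^sub>0 'k::comm_ring_1"
  shows "lookup (single a c * f) (a + e) = c * lookup f e"
proof (induction f rule: poly_mapping_induct)
  case (single e' c')
  then show ?case by (simp add: mult_single lookup_single when_def)
next
  case (add f g)
  then show ?case by (simp add: algebra_simps lookup_add)
qed

lemma lookup_const_mult:
  fixes f :: "('i \<Rightarrow>\<^sub>0 nat) \<Rightarrow>\<^sub>0 'k::comm_ring_1"
  shows "lookup (single 0 c * f) e = c * lookup f e"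
  using lookup_single_mult[of 0 c f e] by simp

subsection \<open>Substitution\<close>

definition is_hom :: "('a::comm_ring_1 \<Rightarrow> 'b::comm_ring_1) \<Rightarrow> bool" where
  "is_hom h \<longleftrightarrow> h 1 = 1 \<and> (\<forall>a b. h (a + b) = h a + h b) \<and> (\<forall>a b. h (a * b) = h a * h b)"

lemma is_homD:
  assumes "is_hom h"
  shows "h 0 = 0" "h 1 = 1" "h (a + b) = h a + h b" "h (a * b) = h a * h b"
    "h (- a) = - h a" "h (a - b) = h a - h b" "h (a ^ m) = h a ^ m"
    "h (sum f A) = (\<Sum>i\<in>A. h (f i))" "h (prod f A) = (\<Prod>i\<in>A. h (f i))"
proof -
  have add: "h (a + b) = h a + h b" and mult: "h (a * b) = h a * h b" and one: "h 1 = 1" for a b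
    using assms by (auto simp: is_hom_def)
  show "h 1 = 1" "h (a + b) = h a + h b" "h (a * b) = h a * h b" by fact+
  show z: "h 0 = 0" using add[of 0 0] by simp
  show m: "h (- a) = - h a" for a using add[of a "- a"] z by (simp add: eq_neg_iff_add_eq_0 add.commute)
  show "h (a - b) = h a - h b" using add[of a "- b"] m by simp
  show "h (a ^ m) = h a ^ m" by (induction m) (simp_all add: one mult)
  show "h (sum f A) = (\<Sum>i\<in>A. h (f i))" by (induction A rule: infinite_finite_induct) (simp_all add: z add)
  show "h (prod f A) = (\<Prod>i\<in>A. h (f i))" by (induction A rule: infinite_finite_induct) (simp_all add: one mult)
qed

lemma is_hom_id: "is_hom (\<lambda>x. x)"
  by (simp add: is_hom_def)

lemma is_hom_const: "is_hom (\<lambda>c. single (0 :: 'a::comm_monoid_add) (c :: 'k::comm_ring_1))"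
  by (simp add: is_hom_def single_add mult_single)

lemma is_hom_pCons: "is_hom (\<lambda>c::'k::comm_ring_1. [:c:])"
  by (simp add: is_hom_def one_pCons)

definition mon_val :: "('i \<Rightarrow> 'a::comm_monoid_mult) \<Rightarrow> ('i \<Rightarrow>\<^sub>0 nat) \<Rightarrow> 'a" where
  "mon_val g e = (\<Prod>i\<in>keys e. g i ^ lookup e i)"

lemma mon_val_superset:
  assumes "finite A" "keys e \<subseteq> A"
  shows "mon_val g e = (\<Prod>i\<in>A. g i ^ lookup e i)"
  unfolding mon_val_def using assms
  by (intro prod.mono_neutral_left) (auto simp: in_keys_iff)

lemma mon_val_add: "mon_val g (e + e') = mon_val g e * mon_val g e'"
proof -
  let ?A = "keys e \<union> keys e'"
  have "mon_val g (e + e') = (\<Prod>i\<in>?A. g i ^ lookup (e + e') i)"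
    by (rule mon_val_superset) (use keys_add[of e e'] in auto)
  also have "\<dots> = (\<Prod>i\<in>?A. g i ^ lookup e i) * (\<Prod>i\<in>?A. g i ^ lookup e' i)"
    by (simp add: lookup_add power_add prod.distrib)
  finally show ?thesis
    by (subst (asm) (1 2) mon_val_superset[symmetric]) auto
qed

lemma mon_val_0 [simp]: "mon_val g 0 = 1"
  by (simp add: mon_val_def)

lemma mon_val_single [simp]: "mon_val g (single i a) = g i ^ a"
  by (cases "a = 0") (simp_all add: mon_val_def)

lemma mon_val_cong: "(\<And>i. i \<in> keys e \<Longrightarrow> g i = g' i) \<Longrightarrow> mon_val g e = mon_val g' e"
  by (simp add: mon_val_def)

text \<open>The maps on coefficients and on variables are independent, so that one construction
  covers evaluation (\<open>h\<close> the identity), substitution (\<open>h\<close> the constant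
  polynomials) and restriction to a line (\<open>h\<close> into univariate polynomials).\<close>

definition ins :: "('k::comm_ring_1 \<Rightarrow> 'a::comm_ring_1) \<Rightarrow> ('i \<Rightarrow> 'a) \<Rightarrow> ('i, 'k) mpoly \<Rightarrow> 'a" where
  "ins h g f = (\<Sum>e\<in>keys f. h (lookup f e) * mon_val g e)"

lemma ins_superset:
  assumes "is_hom h" "finite B" "keys f \<subseteq> B"
  shows "ins h g f = (\<Sum>e\<in>B. h (lookup f e) * mon_val g e)"
  unfolding ins_def using assms
  by (intro sum.mono_neutral_left) (auto simp: in_keys_iff is_homD(1))

lemma ins_single [simp]:
  assumes "is_hom h"
  shows "ins h g (single e c) = h c * mon_val g e"
  by (subst ins_superset[of h "{e}"]) (auto simp: assms lookup_single)

lemma ins_add: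
  assumes "is_hom h"
  shows "ins h g (f + f') = ins h g f + ins h g f'"
proof -
  let ?B = "keys f \<union> keys f'"
  have "ins h g (f + f') = (\<Sum>e\<in>?B. h (lookup (f + f') e) * mon_val g e)"
    by (rule ins_superset) (use assms keys_add[of f f'] in auto)
  also have "\<dots> = (\<Sum>e\<in>?B. h (lookup f e) * mon_val g e) + (\<Sum>e\<in>?B. h (lookup f' e) * mon_val g e)"
    by (simp add: lookup_add is_homD[OF assms] algebra_simps sum.distrib)
  finally show ?thesis
    using ins_superset[OF assms, of ?B f g] ins_superset[OF assms, of ?B f' g] by auto
qed

lemma is_hom_ins:
  assumes h: "is_hom h"
  shows "is_hom (ins h g)"
proof -
  have 1: "ins h g 1 = 1"
    using ins_single[OF h, of g 0 1] by (simp add: is_homD[OF h])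
  have 2: "ins h g (single e c * f) = h c * mon_val g e * ins h g f" for e c f
  proof (induction f rule: poly_mapping_induct)
    case (single e' c')
    then show ?case by (simp add: mult_single h mon_val_add is_homD[OF h])
  next
    case (add f f')
    then show ?case by (simp add: algebra_simps ins_add[OF h])
  qed
  have 3: "ins h g (f' * f) = ins h g f' * ins h g f" for f' f
  proof (induction f' rule: poly_mapping_induct)
    case (single e c)
    then show ?case by (simp add: 2 h)
  next
    case (add f' f'')
    then show ?case by (simp add: algebra_simps ins_add[OF h])
  qed
  show ?thesis by (simp add: is_hom_def 1 3 ins_add[OF h])
qed

lemma ins_mvar [simp]: "is_hom h \<Longrightarrow> ins h g (mvar i) = g i"
  by (simp add: mvar_def is_homD(2))

lemma mvar_nonzero: "mvar i \<noteq> (0 :: ('i, 'k::comm_ring_1) mpoly)"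
  by (metis mvar_def lookup_single_eq lookup_zero zero_neq_one)

lemma mvar_power: "mvar i ^ a = single (single i a) 1"
  by (induction a) (simp_all add: mvar_def mult_single single_add[symmetric])

lemma single_exponent_prod: "single e (1::'k::comm_ring_1) = mon_val mvar e"
proof (induction e rule: poly_mapping_induct)
  case (single i a)
  then show ?case by (simp add: mvar_power)
next
  case (add e e')
  then show ?case by (simp add: mon_val_add mult_single flip: add)
qed

lemma single_eq_const_mult: "single e c = single 0 c * mon_val mvar e"
  by (simp add: mult_single flip: single_exponent_prod)

lemma hom_eq_ins:
  fixes \<phi> :: "('i, 'k::comm_ring_1) mpoly \<Rightarrow> 'a::comm_ring_1"
  assumes "is_hom \<phi>"
  shows "\<phi> f = ins (\<lambda>c. \<phi> (single 0 c)) (\<lambda>i. \<phi> (mvar i)) f"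
proof -
  have h: "is_hom (\<lambda>c. \<phi> (single 0 c))"
    using assms is_hom_const unfolding is_hom_def by metis
  have m: "\<phi> (mon_val mvar e) = mon_val (\<lambda>i. \<phi> (mvar i)) e" for e
    by (simp add: mon_val_def is_homD[OF assms])
  show ?thesis
  proof (induction f rule: poly_mapping_induct)
    case (single e c)
    then show ?case
      by (subst single_eq_const_mult) (simp add: is_homD[OF assms] m h)
  next
    case (add f g)
    then show ?case by (simp add: is_homD[OF assms] ins_add[OF h])
  qed
qed

text \<open>The source of the composition laws below: identities between substitutions and
  evaluations are checked on constants and variables only.\<close>

lemma hom_eqI:
  fixes \<phi> \<psi> :: "('i, 'k::comm_ring_1) mpoly \<Rightarrow> 'a::comm_ring_1"
  assumes "is_hom \<phi>" "is_hom \<psi>" "\<And>c. \<phi> (single 0 c) = \<psi> (single 0 c)"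
    "\<And>i. \<phi> (mvar i) = \<psi> (mvar i)"
  shows "\<phi> f = \<psi> f"
  using hom_eq_ins[OF assms(1), of f] hom_eq_ins[OF assms(2), of f] assms(3,4) by simp

lemma is_hom_compose: "is_hom \<phi> \<Longrightarrow> is_hom \<psi> \<Longrightarrow> is_hom (\<lambda>x. \<phi> (\<psi> x))"
  by (simp add: is_hom_def)

lemma mpoly_eval_eq_ins: "mpoly_eval f v = ins (\<lambda>x. x) v f"
  by (simp add: mpoly_eval_def ins_def mon_val_def)

lemma is_hom_eval: "is_hom (\<lambda>f. mpoly_eval f v)"
  unfolding mpoly_eval_eq_ins by (rule is_hom_ins[OF is_hom_id])

lemmas eval_simps = is_homD[OF is_hom_eval]

lemma eval_mvar [simp]: "mpoly_eval (mvar i) v = v i"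
  by (simp add: mpoly_eval_eq_ins is_hom_id)

lemma eval_single [simp]: "mpoly_eval (single e c) v = c * mon_val v e"
  by (simp add: mpoly_eval_eq_ins is_hom_id)

definition subst :: "('i \<Rightarrow> ('j, 'k::comm_ring_1) mpoly) \<Rightarrow> ('i, 'k) mpoly \<Rightarrow> ('j, 'k) mpoly" where
  "subst = ins (single 0)"

lemma is_hom_subst: "is_hom (subst g)"
  unfolding subst_def by (rule is_hom_ins[OF is_hom_const])

lemmas subst_simps = is_homD[OF is_hom_subst]

lemma subst_mvar [simp]: "subst g (mvar i) = g i"
  by (simp add: subst_def is_hom_const)

lemma subst_single: "subst g (single e c) = single 0 c * mon_val g e"
  by (simp add: subst_def is_hom_const)

lemma subst_const [simp]: "subst g (single 0 c) = single 0 c"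
  by (simp add: subst_single)

lemma subst_subst: "subst g (subst g' f) = subst (\<lambda>i. subst g (g' i)) f"
  by (rule hom_eqI[of "\<lambda>f. subst g (subst g' f)"])
     (auto intro: is_hom_subst is_hom_compose)

lemma eval_subst: "mpoly_eval (subst g f) v = mpoly_eval f (\<lambda>i. mpoly_eval (g i) v)"
  by (rule hom_eqI[of "\<lambda>f. mpoly_eval (subst g f) v"])
     (auto intro!: is_hom_subst is_hom_eval is_hom_compose[OF is_hom_eval])

lemma subst_id: "subst mvar f = f"
  by (rule hom_eqI[of _ "\<lambda>f. f"]) (auto intro: is_hom_subst is_hom_id)

subsection \<open>Degrees\<close>

lemma monom_degree_superset: "finite A \<Longrightarrow> keys e \<subseteq> A \<Longrightarrow> monom_degree e = (\<Sum>i\<in>A. lookup e i)"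
  unfolding monom_degree_def by (intro sum.mono_neutral_left) (auto simp: in_keys_iff)

lemma monom_degree_add: "monom_degree (e + e') = monom_degree e + monom_degree e'"
proof -
  let ?A = "keys e \<union> keys e'"
  have "monom_degree (e + e') = (\<Sum>i\<in>?A. lookup (e + e') i)"
    by (rule monom_degree_superset) (use keys_add[of e e'] in auto)
  also have "\<dots> = (\<Sum>i\<in>?A. lookup e i) + (\<Sum>i\<in>?A. lookup e' i)"
    by (simp add: lookup_add sum.distrib)
  finally show ?thesis
    by (subst (asm) (1 2) monom_degree_superset[symmetric]) auto
qed

lemma monom_degree_0 [simp]: "monom_degree 0 = 0"
  by (simp add: monom_degree_def)

lemma monom_degree_single [simp]: "monom_degree (single i a) = a"
  by (cases "a = 0") (simp_all add: monom_degree_def)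

lemma monom_degree_eq_0_iff: "monom_degree e = 0 \<longleftrightarrow> e = 0"
proof
  assume "monom_degree e = 0"
  then have "\<forall>i\<in>keys e. lookup e i = 0" by (simp add: monom_degree_def)
  then show "e = 0" using ex_key by blast
qed simp

lemma keys_exponent_add: "keys (e + e') = keys e \<union> keys (e' :: 'i \<Rightarrow>\<^sub>0 nat)"
  by (auto simp: in_keys_iff lookup_add)

definition expts :: "nat \<Rightarrow> nat \<Rightarrow> (nat \<Rightarrow>\<^sub>0 nat) set" where
  "expts n d = {e. keys e \<subseteq> {..n} \<and> monom_degree e = d}"

lemma expts_add: "e \<in> expts n a \<Longrightarrow> e' \<in> expts n b \<Longrightarrow> e + e' \<in> expts n (a + b)"
  by (auto simp: expts_def keys_exponent_add monom_degree_add)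

lemma lookup_le_degree: "lookup e i \<le> monom_degree e"
proof (cases "i \<in> keys e")
  case True
  then show ?thesis unfolding monom_degree_def by (intro member_le_sum) auto
qed (simp add: in_keys_iff)

lemma finite_expts [simp]: "finite (expts n d)"
proof -
  have "inj_on (\<lambda>e. restrict (lookup e) {..n}) (expts n d)"
  proof (rule inj_onI)
    fix e e' assume e: "e \<in> expts n d" "e' \<in> expts n d"
      and eq: "restrict (lookup e) {..n} = restrict (lookup e') {..n}"
    show "e = e'"
    proof (rule poly_mapping_eqI)
      fix i
      show "lookup e i = lookup e' i"
      proof (cases "i \<le> n")
        case True
        then show ?thesis using eq by (metis atMost_iff restrict_apply')
      next
        case False
        then have "i \<notin> keys e" "i \<notin> keys e'" using e by (auto simp: expts_def)
        then show ?thesis by (simp add: in_keys_iff)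
      qed
    qed
  qed
  moreover have "(\<lambda>e. restrict (lookup e) {..n}) ` expts n d \<subseteq> {..n} \<rightarrow>\<^sub>E {..d}"
    by (auto simp: PiE_def extensional_def expts_def lookup_le_degree)
  ultimately show ?thesis
    by (meson finite_PiE finite_atMost inj_on_finite)
qed

section \<open>Forms and homogeneous components\<close>

abbreviation polys :: "nat \<Rightarrow> (nat, 'k::comm_ring_1) mpoly set" where
  "polys n \<equiv> carrier (poly_ring n)"

lemma polys_iff: "f \<in> polys n \<longleftrightarrow> (\<forall>e\<in>keys f. keys e \<subseteq> {..n})"
  by (simp add: poly_ring_def)

lemma poly_ring_ops [simp]:
  "monoid.mult (poly_ring n) = (*)" "ring.add (poly_ring n) = (+)" "ring.zero (poly_ring n) = 0"
  "monoid.one (poly_ring n) = 1"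
  by (simp_all add: poly_ring_def)

interpretation PR: cring "poly_ring n :: (nat, 'k::comm_ring_1) mpoly ring" for n
  by (rule poly_ring_cring)

lemma polys_add: "f \<in> polys n \<Longrightarrow> g \<in> polys n \<Longrightarrow> f + g \<in> polys n"
  using PR.add.m_closed[of f n g] by simp

lemma polys_mult: "f \<in> polys n \<Longrightarrow> g \<in> polys n \<Longrightarrow> f * g \<in> polys n"
  using PR.m_closed[of f n g] by simp

lemma polys_uminus: "f \<in> polys n \<Longrightarrow> - f \<in> polys n"
  by (simp add: polys_iff)

lemma polys_0 [simp]: "0 \<in> polys n"
  using PR.zero_closed[of n] by simp

lemma polys_1 [simp]: "1 \<in> polys n"
  using PR.one_closed[of n] by simp

lemma polys_power: "f \<in> polys n \<Longrightarrow> f ^ k \<in> polys n"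
  by (induction k) (simp_all add: polys_mult)

lemma polys_sum: "(\<And>i. i \<in> A \<Longrightarrow> f i \<in> polys n) \<Longrightarrow> sum f A \<in> polys n"
  by (induction A rule: infinite_finite_induct) (auto simp: polys_add)

definition forms :: "nat \<Rightarrow> nat \<Rightarrow> (nat, 'k::comm_ring_1) mpoly set" where
  "forms n d = {f. keys f \<subseteq> expts n d}"

lemma formsD: "f \<in> forms n d \<Longrightarrow> e \<in> keys f \<Longrightarrow> monom_degree e = d"
  "f \<in> forms n d \<Longrightarrow> e \<in> keys f \<Longrightarrow> keys e \<subseteq> {..n}"
  by (auto simp: forms_def expts_def)

lemma forms_polys: "f \<in> forms n d \<Longrightarrow> f \<in> polys n"
  by (auto simp: forms_def expts_def polys_iff)

lemma forms_0 [simp]: "0 \<in> forms n d"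
  by (simp add: forms_def)

lemma forms_add: "f \<in> forms n d \<Longrightarrow> g \<in> forms n d \<Longrightarrow> f + g \<in> forms n d"
  unfolding forms_def using keys_add[of f g] by auto

lemma forms_uminus: "f \<in> forms n d \<Longrightarrow> - f \<in> forms n d"
  by (simp add: forms_def)

lemma forms_diff: "f \<in> forms n d \<Longrightarrow> g \<in> forms n d \<Longrightarrow> f - g \<in> forms n d"
  using forms_add[of f n d "- g"] forms_uminus[of g n d] by simp

lemma forms_mult: "f \<in> forms n a \<Longrightarrow> g \<in> forms n b \<Longrightarrow> f * g \<in> forms n (a + b)"
  unfolding forms_def using keys_mult[of f g] expts_add by blast

lemma forms_single: "e \<in> expts n d \<Longrightarrow> single e c \<in> forms n d"
  by (auto simp: forms_def in_keys_iff lookup_single when_def split: if_splits)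

lemma forms_const [simp]: "single 0 c \<in> forms n 0"
  by (rule forms_single) (simp add: expts_def)

lemma forms_0_eq_const:
  assumes "f \<in> forms n 0"
  shows "f = single 0 (lookup f 0)"
proof (rule poly_mapping_eqI)
  fix e
  have "e \<in> keys f \<Longrightarrow> e = 0"
    using assms by (auto simp: forms_def expts_def monom_degree_eq_0_iff)
  then show "lookup f e = lookup (single 0 (lookup f 0)) e"
    by (auto simp: lookup_single when_def in_keys_iff)
qed

lemma forms_1 [simp]: "1 \<in> forms n 0"
  using forms_const[of 1 n] by simp

lemma forms_const_mult: "f \<in> forms n d \<Longrightarrow> single 0 c * f \<in> forms n d"
  using forms_mult[OF forms_const, of f n d c] by simp

lemma forms_mvar: "i \<le> n \<Longrightarrow> mvar i \<in> forms n 1"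
  unfolding mvar_def by (rule forms_single) (simp add: expts_def)

lemma forms_power: "f \<in> forms n d \<Longrightarrow> f ^ k \<in> forms n (k * d)"
  by (induction k) (simp_all add: forms_mult)

lemma forms_sum: "(\<And>i. i \<in> A \<Longrightarrow> f i \<in> forms n d) \<Longrightarrow> sum f A \<in> forms n d"
  by (induction A rule: infinite_finite_induct) (auto simp: forms_add)

lemma forms_prod: "(\<And>i. i \<in> A \<Longrightarrow> f i \<in> forms n (d i)) \<Longrightarrow> finite A \<Longrightarrow> prod f A \<in> forms n (sum d A)"
  by (induction A rule: infinite_finite_induct) (auto simp: forms_mult)

lemma forms_mono: "n \<le> n' \<Longrightarrow> f \<in> forms n d \<Longrightarrow> f \<in> forms n' d"
  by (force simp: forms_def expts_def)

lemma is_form_iff: "is_form n f \<longleftrightarrow> (\<exists>d. f \<in> forms n d)"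
  by (auto simp: is_form_def polys_iff forms_def expts_def subset_iff)

lemma eval_forms_scale:
  assumes "f \<in> forms n d"
  shows "mpoly_eval f (\<lambda>i. c * v i) = c ^ d * mpoly_eval f v"
proof -
  have "mon_val (\<lambda>i. c * v i) e = c ^ monom_degree e * mon_val v e" for e
    by (simp add: mon_val_def monom_degree_def power_mult_distrib prod.distrib power_sum)
  then show ?thesis
    using assms
    by (simp add: mpoly_eval_eq_ins ins_def sum_distrib_left mult.left_commute formsD
        cong: sum.cong)
qed

text \<open>The homogeneous component of degree \<open>d\<close>. Elements of ideal powers need not
  be homogeneous, so arguments about degree and vanishing are made component by component.\<close>

definition hcomp :: "nat \<Rightarrow> ('i, 'k::comm_ring_1) mpoly \<Rightarrow> ('i, 'k) mpoly" where
  "hcomp d f = (\<Sum>e | e \<in> keys f \<and> monom_degree e = d. single e (lookup f e))"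

lemma lookup_hcomp: "lookup (hcomp d f) e = (if monom_degree e = d then lookup f e else 0)"
  by (auto simp: hcomp_def lookup_sum_single in_keys_iff)

lemma keys_hcomp: "keys (hcomp d f) = {e \<in> keys f. monom_degree e = d}"
  by (auto simp: in_keys_iff lookup_hcomp split: if_splits)

lemma hcomp_add: "hcomp d (f + g) = hcomp d f + hcomp d g"
  by (rule poly_mapping_eqI) (simp add: lookup_hcomp lookup_add)

lemma hcomp_0 [simp]: "hcomp d 0 = 0"
  by (rule poly_mapping_eqI) (simp add: lookup_hcomp)

lemma hcomp_in_forms: "f \<in> polys n \<Longrightarrow> hcomp d f \<in> forms n d"
  by (auto simp: forms_def keys_hcomp polys_iff expts_def)

lemma hcomp_forms: "f \<in> forms n d \<Longrightarrow> hcomp d' f = (if d' = d then f else 0)"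
  by (rule poly_mapping_eqI)
     (auto simp: lookup_hcomp forms_def expts_def subset_iff in_keys_iff)

lemma sum_hcomp:
  assumes "\<And>e. e \<in> keys f \<Longrightarrow> monom_degree e \<le> N"
  shows "f = (\<Sum>d\<le>N. hcomp d f)"
  by (rule poly_mapping_eqI) (use assms in \<open>auto simp: lookup_sum lookup_hcomp in_keys_iff\<close>)

lemma ex_degree_bound: "\<exists>N. \<forall>e\<in>keys f. monom_degree e \<le> N"
  by (rule exI[of _ "Max (monom_degree ` keys f)"]) auto

lemma hcomp_single: "hcomp d (single e c) = (if monom_degree e = d then single e c else 0)"
  by (rule poly_mapping_eqI) (auto simp: lookup_hcomp lookup_single when_def)

lemma hcomp_single_mult:
  fixes f :: "('i, 'k::comm_ring_1) mpoly"
  shows "hcomp (monom_degree e + d) (single e c * f) = single e c * hcomp d f"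
proof (induction f rule: poly_mapping_induct)
  case (single e' c')
  then show ?case
    by (simp add: mult_single hcomp_single monom_degree_add)
next
  case (add f g)
  then show ?case by (simp add: distrib_left hcomp_add)
qed

subsection \<open>Additive spans\<close>

text \<open>Sums alone give linear spans here, because every generating set used below is stable
  under scalars.\<close>

inductive_set aspan :: "'a::comm_monoid_add set \<Rightarrow> 'a set" for X where
  zero: "0 \<in> aspan X"
| step: "x \<in> X \<Longrightarrow> y \<in> aspan X \<Longrightarrow> x + y \<in> aspan X"

lemma aspan_base: "x \<in> X \<Longrightarrow> x \<in> aspan X"
  using aspan.step[OF _ aspan.zero, of x X] by simp

lemma aspan_add: "x \<in> aspan X \<Longrightarrow> y \<in> aspan X \<Longrightarrow> x + y \<in> aspan X"
  by (induction rule: aspan.induct) (auto simp: add.assoc intro: aspan.step)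

lemma aspan_sum: "(\<And>i. i \<in> A \<Longrightarrow> f i \<in> aspan X) \<Longrightarrow> sum f A \<in> aspan X"
  by (induction A rule: infinite_finite_induct) (auto intro: aspan_add aspan.zero)

lemma aspan_map:
  assumes "x \<in> aspan X" "\<phi> 0 = 0" "\<And>x y. \<phi> (x + y) = \<phi> x + \<phi> y" "\<And>x. x \<in> X \<Longrightarrow> \<phi> x \<in> aspan Y"
  shows "\<phi> x \<in> aspan Y"
  using assms(1) by induction (auto simp: assms(2,3) intro: aspan.zero aspan_add assms(4))

lemma aspan_closed:
  assumes "x \<in> aspan X" "0 \<in> S" "\<And>x y. x \<in> S \<Longrightarrow> y \<in> S \<Longrightarrow> x + y \<in> S" "X \<subseteq> S"
  shows "x \<in> S"
  using assms(1) by induction (use assms(2-) in auto)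

lemma polys_aspan: "f \<in> polys n \<Longrightarrow> f \<in> aspan (\<Union>d. forms n d)"
proof -
  assume f: "f \<in> polys n"
  obtain N where "\<forall>e\<in>keys f. monom_degree e \<le> N" using ex_degree_bound[of f] by blast
  then have "f = (\<Sum>d\<le>N. hcomp d f)" by (intro sum_hcomp) auto
  moreover have "(\<Sum>d\<le>N. hcomp d f) \<in> aspan (\<Union>d. forms n d)"
    by (intro aspan_sum aspan_base) (use hcomp_in_forms[OF f] in blast)
  ultimately show ?thesis by simp
qed

section \<open>Ideals of the polynomial ring and their powers\<close>

lemma poly_idealI:
  assumes "S \<subseteq> polys n" "0 \<in> S" "\<And>x y. x \<in> S \<Longrightarrow> y \<in> S \<Longrightarrow> x + y \<in> S"
    and m: "\<And>g x. g \<in> polys n \<Longrightarrow> x \<in> S \<Longrightarrow> g * x \<in> S"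
  shows "ideal S (poly_ring n :: (nat, 'k::comm_ring_1) mpoly ring)"
proof (rule idealI)
  show "ring (poly_ring n :: (nat, 'k) mpoly ring)" by (rule PR.ring_axioms)
  have u: "- x \<in> S" if "x \<in> S" for x
    using m[of "- 1" x] that polys_uminus[of 1 n] by simp
  show "subgroup S (add_monoid (poly_ring n :: (nat, 'k) mpoly ring))"
  proof (rule PR.add.subgroupI)
    show "S \<noteq> {}" using assms by auto
    fix a assume a: "a \<in> S"
    have "a \<in> polys n" using a assms(1) by auto
    then have "\<ominus>\<^bsub>poly_ring n\<^esub> a = - a"
      by (intro PR.minus_equality) (auto intro: polys_uminus)
    then show "\<ominus>\<^bsub>poly_ring n\<^esub> a \<in> S" using u[OF a] by simp
  qed (use assms in auto)
next
  fix a x :: "(nat, 'k) mpoly" assume a: "a \<in> S" and x: "x \<in> polys n"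
  show "x \<otimes>\<^bsub>poly_ring n\<^esub> a \<in> S" using m[OF x a] by simp
  show "a \<otimes>\<^bsub>poly_ring n\<^esub> x \<in> S" using m[OF x a] by (simp add: mult.commute[of x])
qed

lemma poly_idealD:
  assumes "ideal S (poly_ring n)"
  shows "S \<subseteq> polys n" "0 \<in> S" "\<And>x y. x \<in> S \<Longrightarrow> y \<in> S \<Longrightarrow> x + y \<in> S"
    "\<And>g x. g \<in> polys n \<Longrightarrow> x \<in> S \<Longrightarrow> g * x \<in> S"
proof -
  interpret I: ideal S "poly_ring n" by fact
  show "S \<subseteq> polys n" "0 \<in> S" "\<And>x y. x \<in> S \<Longrightarrow> y \<in> S \<Longrightarrow> x + y \<in> S"
    "\<And>g x. g \<in> polys n \<Longrightarrow> x \<in> S \<Longrightarrow> g * x \<in> S"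
    using I.Icarr I.zero_closed I.a_closed I.I_l_closed by auto
qed

abbreviation ipow :: "nat \<Rightarrow> (nat, 'k::comm_ring_1) mpoly set \<Rightarrow> nat \<Rightarrow> (nat, 'k) mpoly set" where
  "ipow n A m \<equiv> A [^]\<^bsub>ideals_set (poly_ring n)\<^esub> m"

lemma ideals_set_ops [simp]:
  "monoid.mult (ideals_set R) = ideal_prod R" "monoid.one (ideals_set R) = carrier R"
  by (simp_all add: ideals_set_def)

lemma ipow_0 [simp]: "ipow n A 0 = polys n"
  and ipow_Suc [simp]: "ipow n A (Suc m) = ideal_prod (poly_ring n) (ipow n A m) A"
  by (simp_all add: nat_pow_def ideals_set_def)

lemma ideal_ipow: "ideal A (poly_ring n) \<Longrightarrow> ideal (ipow n A m) (poly_ring n)"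
  by (induction m) (auto simp: ideals_set_def intro: PR.oneideal PR.ideal_prod_is_ideal)

lemma ideal_prod_closed:
  assumes "x \<in> ideal_prod (poly_ring n) A B" "\<And>x y. x \<in> S \<Longrightarrow> y \<in> S \<Longrightarrow> x + y \<in> S"
    "\<And>a b. a \<in> A \<Longrightarrow> b \<in> B \<Longrightarrow> a * b \<in> S"
  shows "x \<in> S"
  using assms(1) by (induction rule: ideal_prod.induct) (use assms(2,3) in auto)

subsection \<open>Powers of the ideal of separated points\<close>

text \<open>Divisibility by x_0, read off the exponents; \<open>x0div (f - g)\<close> is congruence
  modulo x_0.\<close>

definition x0div :: "(nat, 'k::comm_ring_1) mpoly \<Rightarrow> bool" where
  "x0div f \<longleftrightarrow> (\<forall>e\<in>keys f. lookup e 0 \<noteq> 0)"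

lemma x0div_iff: "x0div f \<longleftrightarrow> (\<forall>e. lookup e 0 = 0 \<longrightarrow> lookup f e = 0)"
  unfolding x0div_def by (metis in_keys_iff)

lemma x0div_0 [simp]: "x0div 0"
  by (simp add: x0div_def)

lemma x0div_add: "x0div f \<Longrightarrow> x0div g \<Longrightarrow> x0div (f + g)"
  and x0div_diff: "x0div f \<Longrightarrow> x0div g \<Longrightarrow> x0div (f - g)"
  by (simp_all add: x0div_iff lookup_add lookup_minus)

lemma x0div_sum: "(\<And>i. i \<in> A \<Longrightarrow> x0div (f i)) \<Longrightarrow> x0div (sum f A)"
  by (induction A rule: infinite_finite_induct) (auto simp: x0div_add)

lemma x0div_mult1: "x0div f \<Longrightarrow> x0div (f * g)"
proof -
  assume f: "x0div f"
  show ?thesis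
    unfolding x0div_def
  proof
    fix e assume "e \<in> keys (f * g)"
    then obtain a b where "a \<in> keys f" "e = a + b" using keys_mult[of f g] by blast
    then show "lookup e 0 \<noteq> 0" using f by (simp add: x0div_def lookup_add)
  qed
qed

lemma x0div_mult2: "x0div f \<Longrightarrow> x0div (g * f)"
  using x0div_mult1[of f g] by (simp add: mult.commute)

lemma x0div_mvar: "x0div (mvar 0 * f)"
  by (rule x0div_mult1) (simp add: x0div_def mvar_def)

lemma forms_div_x0:
  assumes "f \<in> forms n (Suc d)" "x0div f"
  obtains h where "h \<in> forms n d" "f = mvar 0 * h"
proof
  let ?h = "\<Sum>e\<in>keys f. single (e - single 0 1) (lookup f e)"
  have e: "single 0 1 + (e - single 0 1) = e" if "e \<in> keys f" for e
    using assms(2) that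
    by (intro poly_mapping_eqI) (auto simp: lookup_add lookup_minus x0div_def lookup_single when_def)
  have "monom_degree (e - single 0 1) = d" "keys (e - single 0 1) \<subseteq> {..n}" if "e \<in> keys f" for e
  proof -
    have "monom_degree (single 0 1 + (e - single 0 1)) = Suc d"
      "keys (single 0 1 + (e - single 0 1)) \<subseteq> {..n}"
      using that assms(1) unfolding e[OF that] by (auto dest: formsD)
    then show "monom_degree (e - single 0 1) = d" "keys (e - single 0 1) \<subseteq> {..n}"
      by (auto simp: monom_degree_add keys_exponent_add)
  qed
  then show "?h \<in> forms n d"
    by (intro forms_sum forms_single) (auto simp: expts_def)
  have "mvar 0 * ?h = (\<Sum>e\<in>keys f. single e (lookup f e))"
    unfolding mvar_def sum_distrib_left mult_single
    by (intro sum.cong) (use e in auto)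
  then show "f = mvar 0 * ?h" using poly_mapping_expand[of f] by simp
qed

lemma expts_1: "e \<in> expts n 1 \<Longrightarrow> \<exists>i\<le>n. e = single i 1"
proof -
  assume e: "e \<in> expts n 1"
  then have "monom_degree e \<noteq> 0" by (simp add: expts_def)
  then obtain i where i: "i \<in> keys e" by (auto simp: monom_degree_def)
  have "monom_degree (single i 1 + (e - single i 1)) = 1"
    unfolding poly_mapping_remove[OF i] using e by (simp add: expts_def)
  then have "e - single i 1 = 0" by (simp add: monom_degree_add monom_degree_eq_0_iff)
  then have "e = single i 1" using poly_mapping_remove[OF i] by simp
  then show ?thesis using i e by (auto simp: expts_def)
qed

lemma expts_split:
  "e \<in> expts n (a + b) \<Longrightarrow> \<exists>e1\<in>expts n a. \<exists>e2\<in>expts n b. e = e1 + e2"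
proof (induction a arbitrary: e)
  case 0
  then show ?case by (intro bexI[of _ 0] bexI[of _ e]) (auto simp: expts_def)
next
  case (Suc a)
  then have "monom_degree e \<noteq> 0" by (auto simp: expts_def)
  then obtain i where i: "i \<in> keys e" by (auto simp: monom_degree_def)
  let ?e = "e - single i 1"
  have e: "e = single i 1 + ?e" by (rule poly_mapping_remove[OF i, symmetric])
  have "monom_degree (single i 1 + ?e) = Suc (a + b)" "keys (single i 1 + ?e) \<subseteq> {..n}"
    using Suc.prems e by (auto simp: expts_def)
  then have i1: "single i 1 \<in> expts n 1" and "?e \<in> expts n (a + b)"
    by (auto simp: monom_degree_add keys_exponent_add expts_def)
  from Suc.IH[OF this(2)] obtain e1 e2 where "e1 \<in> expts n a" "e2 \<in> expts n b" "?e = e1 + e2"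
    by auto
  then show ?case
    using expts_add[OF i1] e by (intro bexI[of _ "single i 1 + e1"] bexI[of _ e2]) (auto simp: add.assoc)
qed

text \<open>The monomials free of x_0, a basis of the forms of degree \<open>d\<close> modulo
  x_0.\<close>

definition pexpts :: "nat \<Rightarrow> nat \<Rightarrow> (nat \<Rightarrow>\<^sub>0 nat) set" where
  "pexpts n d = {e \<in> expts n d. lookup e 0 = 0}"

lemma pexpts_add: "e \<in> pexpts n a \<Longrightarrow> e' \<in> pexpts n b \<Longrightarrow> e + e' \<in> pexpts n (a + b)"
  by (auto simp: pexpts_def expts_add lookup_add)

lemma finite_pexpts [simp]: "finite (pexpts n d)"
  by (simp add: pexpts_def)

lemma pexpts_split:
  assumes "e \<in> pexpts n (a + b)"
  shows "\<exists>e1\<in>pexpts n a. \<exists>e2\<in>pexpts n b. e = e1 + e2"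
proof -
  obtain e1 e2 where e: "e1 \<in> expts n a" "e2 \<in> expts n b" "e = e1 + e2"
    using assms expts_split[of e n a b] by (auto simp: pexpts_def)
  moreover have "lookup e 0 = 0" using assms by (simp add: pexpts_def)
  ultimately show ?thesis by (intro bexI[of _ e1] bexI[of _ e2]) (auto simp: pexpts_def lookup_add)
qed

lemma sum_single_mult_single:
  fixes a :: "('i \<Rightarrow>\<^sub>0 nat) \<Rightarrow> 'k::comm_ring_1"
  assumes "finite S"
  shows "lookup (\<Sum>\<mu>\<in>S. single 0 (a \<mu>) * single \<mu> 1) e = (if e \<in> S then a e else 0)"
  using assms by (simp add: mult_single lookup_sum_single)

text \<open>Subtracting from an element of \<open>V\<close> the lifts of its terms free of x_0
  leaves an element of \<open>V\<close> divisible by x_0. An additive property therefore needs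
  checking only on scalar multiples of lifts and on elements divisible by x_0.\<close>

lemma lift_induct:
  fixes V :: "(nat, 'k::comm_ring_1) mpoly set"
  assumes V: "V \<subseteq> forms n d" "\<And>f g. f \<in> V \<Longrightarrow> g \<in> V \<Longrightarrow> f + g \<in> V" "0 \<in> V"
      "\<And>c f. f \<in> V \<Longrightarrow> single 0 c * f \<in> V"
    and Q: "\<And>\<mu>. \<mu> \<in> pexpts n d \<Longrightarrow> Q \<mu> \<in> V \<and> x0div (Q \<mu> - single \<mu> 1)"
    and P: "\<And>f g. P f \<Longrightarrow> P g \<Longrightarrow> P (f + g)" "\<And>g. g \<in> V \<Longrightarrow> x0div g \<Longrightarrow> P g"
      "\<And>c \<mu>. \<mu> \<in> pexpts n d \<Longrightarrow> P (single 0 c * Q \<mu>)"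
    and g: "g \<in> V"
  shows "P g"
proof -
  let ?s = "\<Sum>\<mu>\<in>pexpts n d. single 0 (lookup g \<mu>) * Q \<mu>"
  let ?s1 = "\<Sum>\<mu>\<in>pexpts n d. single 0 (lookup g \<mu>) * single \<mu> 1"
  have P0: "P 0" by (rule P(2)) (use V in auto)
  have Vsum: "sum f A \<in> V" if "\<And>i. i \<in> A \<Longrightarrow> f i \<in> V" for f :: "(nat \<Rightarrow>\<^sub>0 nat) \<Rightarrow> (nat, 'k) mpoly" and A
    using that by (induction A rule: infinite_finite_induct) (auto intro: V)
  have Psum: "P (sum f A)" if "\<And>i. i \<in> A \<Longrightarrow> P (f i)" for f :: "(nat \<Rightarrow>\<^sub>0 nat) \<Rightarrow> (nat, 'k) mpoly" and A
    using that by (induction A rule: infinite_finite_induct) (auto intro: P P0)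
  have s: "?s \<in> V" by (rule Vsum) (use Q V in auto)
  have neg: "- x \<in> V" if "x \<in> V" for x
    using V(4)[OF that, of "- 1"] by (simp add: single_uminus)
  have "x0div (g - ?s1)"
    unfolding x0div_iff
  proof (intro allI impI)
    fix e :: "nat \<Rightarrow>\<^sub>0 nat" assume e: "lookup e 0 = 0"
    have "e \<in> pexpts n d" if "lookup g e \<noteq> 0"
      using that subsetD[OF V(1) g] e by (auto simp: forms_def pexpts_def in_keys_iff)
    then show "lookup (g - ?s1) e = 0"
      by (auto simp: lookup_minus sum_single_mult_single)
  qed
  moreover have "x0div (?s - ?s1)"
    unfolding sum_subtractf[symmetric] right_diff_distrib[symmetric]
    by (intro x0div_sum x0div_mult2) (use Q in auto)
  ultimately have "x0div ((g - ?s1) - (?s - ?s1))" by (rule x0div_diff)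
  then have "x0div (g - ?s)" by simp
  then have "P (g - ?s)" using V(2)[OF g neg[OF s]] by (intro P(2)) auto
  moreover have "P ?s" by (rule Psum) (use P(3) in auto)
  ultimately have "P ((g - ?s) + ?s)" by (rule P(1))
  then show ?thesis by simp
qed

text \<open>The \<open>sep i\<close> are Lagrange interpolators; their existence is the independence
  of the conditions in degree \<open>r - 1\<close>. Nonzero x_0-coordinates make x_0 cancellable in
  the ideal of the points.\<close>

locale separated_points =
  fixes n s r :: nat and v :: "nat \<Rightarrow> nat \<Rightarrow> 'k::field" and sep :: "nat \<Rightarrow> (nat, 'k) mpoly"
  assumes v0: "i < s \<Longrightarrow> v i 0 \<noteq> 0"
    and r_pos: "r \<ge> 1"
    and sep_forms: "i < s \<Longrightarrow> sep i \<in> forms n (r - 1)"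
    and sep_eval: "i < s \<Longrightarrow> j < s \<Longrightarrow> mpoly_eval (sep i) (v j) = (if i = j then 1 else 0)"
begin

text \<open>The degree-\<open>d\<close> part of I, tested on one representative of each point;
  homogeneity carries the vanishing over to the whole class.\<close>

definition van :: "nat \<Rightarrow> (nat, 'k) mpoly set" where
  "van d = {f \<in> forms n d. \<forall>i<s. mpoly_eval f (v i) = 0}"

lemma van_forms: "f \<in> van d \<Longrightarrow> f \<in> forms n d"
  by (simp add: van_def)

lemma van_0 [simp]: "0 \<in> van d"
  by (simp add: van_def eval_simps)

lemma van_add: "f \<in> van d \<Longrightarrow> g \<in> van d \<Longrightarrow> f + g \<in> van d"
  by (simp add: van_def eval_simps forms_add)

lemma van_diff: "f \<in> van d \<Longrightarrow> g \<in> van d \<Longrightarrow> f - g \<in> van d"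
  by (simp add: van_def eval_simps forms_diff)

lemma van_mult: "f \<in> van d \<Longrightarrow> g \<in> forms n d' \<Longrightarrow> g * f \<in> van (d + d')"
  using forms_mult[of f n d g d'] by (simp add: van_def eval_simps mult.commute)

lemma van_const: "f \<in> van d \<Longrightarrow> single 0 c * f \<in> van d"
  using van_mult[OF _ forms_const, of f d c] by simp

lemma van_div_x0:
  assumes "f \<in> van (Suc d)" "x0div f"
  obtains h where "h \<in> van d" "f = mvar 0 * h"
proof -
  obtain h where h: "h \<in> forms n d" "f = mvar 0 * h"
    using forms_div_x0[of f n d] assms by (auto simp: van_def)
  then have "h \<in> van d" using assms(1) v0 by (auto simp: van_def eval_simps)
  with h that show thesis by auto
qed

text \<open>Interpolation: the values of the monomial at the points are removed by subtracting
  multiples of \<open>mvar 0 * sep i\<close>, which have degree \<open>r\<close> and are 0 modulo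
  x_0.\<close>

lemma van_lift:
  assumes "\<mu> \<in> pexpts n r"
  shows "\<exists>q\<in>van r. x0div (q - single \<mu> 1)"
proof -
  let ?t = "\<Sum>i<s. single 0 (mon_val (v i) \<mu> / v i 0) * (mvar 0 * sep i)"
  let ?q = "single \<mu> 1 - ?t"
  have "mvar 0 * sep i \<in> forms n r" if "i < s" for i
    using forms_mult[OF forms_mvar sep_forms[OF that], of 0] r_pos by simp
  then have "?t \<in> forms n r" by (intro forms_sum forms_const_mult) auto
  moreover have "single \<mu> 1 \<in> forms n r" using assms by (intro forms_single) (simp add: pexpts_def)
  ultimately have "?q \<in> forms n r" by (intro forms_diff)
  moreover have "mpoly_eval ?q (v j) = 0" if "j < s" for j
  proof -
    have "mpoly_eval ?t (v j) = (\<Sum>i<s. if i = j then mon_val (v j) \<mu> else 0)"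
      unfolding eval_simps by (intro sum.cong) (use that v0 in \<open>auto simp: sep_eval\<close>)
    then show ?thesis using that by (simp add: eval_simps)
  qed
  ultimately have "?q \<in> van r" by (simp add: van_def)
  moreover have "x0div (?q - single \<mu> 1)"
  proof -
    have "x0div (0 - ?t)"
      by (intro x0div_diff x0div_0 x0div_sum x0div_mult2 x0div_mvar)
    then show ?thesis by simp
  qed
  ultimately show ?thesis by blast
qed

text \<open>\<open>W m b\<close> is the part of M^b I_r^m in degree m r + b; \<open>b\<close> is the
  surplus.\<close>

primrec W :: "nat \<Rightarrow> nat \<Rightarrow> (nat, 'k) mpoly set" where
  "W 0 b = forms n b"
| "W (Suc m) b = aspan {q * w | q w. q \<in> van r \<and> w \<in> W m b}"

lemma W_0 [simp]: "0 \<in> W m b"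
  by (cases m) (auto intro: aspan.zero)

lemma W_add: "f \<in> W m b \<Longrightarrow> g \<in> W m b \<Longrightarrow> f + g \<in> W m b"
  by (cases m) (auto intro: forms_add aspan_add)

lemma W_mult_van: "q \<in> van r \<Longrightarrow> w \<in> W m b \<Longrightarrow> q * w \<in> W (Suc m) b"
  by (auto intro: aspan_base)

lemma W_Suc_induct [consumes 1, case_names zero add mult]:
  assumes "x \<in> W (Suc m) b" "P 0" "\<And>x y. P x \<Longrightarrow> P y \<Longrightarrow> P (x + y)"
    "\<And>q w. q \<in> van r \<Longrightarrow> w \<in> W m b \<Longrightarrow> P (q * w)"
  shows "P x"
proof -
  have "x \<in> Collect P"
    by (rule aspan_closed[OF assms(1)[unfolded W.simps]]) (use assms(2-) in auto)
  then show ?thesis by simp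
qed

declare W.simps(2) [simp del]

lemma W_forms: "w \<in> W m b \<Longrightarrow> w \<in> forms n (m * r + b)"
proof (induction m arbitrary: w)
  case (Suc m)
  from Suc.prems show ?case
  proof (induction rule: W_Suc_induct)
    case (mult q w)
    then show ?case
      using forms_mult[OF van_forms[OF mult(1)] Suc.IH[OF mult(2)]] by (simp add: add.assoc)
  qed (auto intro: forms_add)
qed simp

lemma W_mult: "w \<in> W m b \<Longrightarrow> g \<in> forms n d \<Longrightarrow> g * w \<in> W m (b + d)"
proof (induction m arbitrary: w)
  case 0
  then show ?case using forms_mult[of w n b g d] by (simp add: mult.commute)
next
  case (Suc m)
  from Suc.prems(1) show ?case
  proof (induction rule: W_Suc_induct)
    case (mult q w)
    then show ?case
      using W_mult_van[OF mult(1) Suc.IH[OF mult(2) Suc.prems(2)]] by (simp add: algebra_simps)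
  next
    case (add x y)
    then show ?case by (simp add: distrib_left W_add)
  qed simp
qed

lemma W_const: "w \<in> W m b \<Longrightarrow> single 0 c * w \<in> W m b"
  using W_mult[OF _ forms_const, of w m b c] by simp

lemma W_excess: "w \<in> W m (Suc b) \<Longrightarrow> w \<in> aspan {mvar i * w' | i w'. i \<le> n \<and> w' \<in> W m b}"
proof (induction m arbitrary: w)
  case 0
  then have w: "w \<in> forms n (Suc b)" by simp
  have "single e (lookup w e) \<in> aspan {mvar i * w' | i w'. i \<le> n \<and> w' \<in> W 0 b}" if e: "e \<in> keys w" for e
  proof -
    have "e \<in> expts n (1 + b)" using e w by (auto simp: forms_def)
    then obtain e1 e2 where e12: "e1 \<in> expts n 1" "e2 \<in> expts n b" "e = e1 + e2"
      using expts_split by blast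
    obtain i where i: "i \<le> n" "e1 = single i 1" using expts_1[OF e12(1)] by blast
    then have "single e (lookup w e) = mvar i * single e2 (lookup w e)"
      using e12 i by (simp add: mvar_def mult_single)
    then show ?thesis using i(1) e12(2) by (auto intro!: aspan_base forms_single)
  qed
  then have "(\<Sum>e\<in>keys w. single e (lookup w e)) \<in> aspan {mvar i * w' | i w'. i \<le> n \<and> w' \<in> W 0 b}"
    by (rule aspan_sum)
  then show ?case using poly_mapping_expand[of w] by simp
next
  case (Suc m)
  from Suc.prems show ?case
  proof (induction rule: W_Suc_induct)
    case (mult q w)
    show ?case
    proof (rule aspan_map[OF Suc.IH[OF mult(2)], of "(*) q"])
      fix x assume "x \<in> {mvar i * w' | i w'. i \<le> n \<and> w' \<in> W m b}"
      then obtain i w' where x: "i \<le> n" "w' \<in> W m b" "q * x = mvar i * (q * w')"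
        by (auto simp: algebra_simps)
      then show "q * x \<in> aspan {mvar i * w' | i w'. i \<le> n \<and> w' \<in> W (Suc m) b}"
        using W_mult_van[OF mult(1) x(2)] by (intro aspan_base) blast
    qed (auto simp: distrib_left)
  qed (auto intro: aspan.zero aspan_add)
qed

lemma W_lift:
  assumes "c \<in> pexpts n (m * r + b)"
  shows "\<exists>w\<in>W m b. x0div (w - single c 1)"
  using assms
proof (induction m arbitrary: c)
  case 0
  then show ?case by (intro bexI[of _ "single c 1"]) (auto intro: forms_single simp: pexpts_def)
next
  case (Suc m)
  then have "c \<in> pexpts n (r + (m * r + b))" by (simp add: algebra_simps)
  then obtain \<mu> c' where c: "\<mu> \<in> pexpts n r" "c' \<in> pexpts n (m * r + b)" "c = \<mu> + c'"
    using pexpts_split by blast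
  obtain q w where q: "q \<in> van r" "x0div (q - single \<mu> 1)" and w: "w \<in> W m b" "x0div (w - single c' 1)"
    using van_lift[OF c(1)] Suc.IH[OF c(2)] by blast
  have "q * w - single c 1 = (q - single \<mu> 1) * w + single \<mu> 1 * (w - single c' 1)"
    by (simp add: c algebra_simps mult_single)
  then have "x0div (q * w - single c 1)"
    using q w by (auto intro: x0div_add x0div_mult1 x0div_mult2)
  then show ?case using W_mult_van[OF q(1) w(1)] by blast
qed

end

context separated_points
begin

text \<open>From degree \<open>r\<close> on, I is generated by I_r. Modulo x_0 the lifts in
  \<open>W 1 (Suc k)\<close> account for everything, and the remainder is x_0 times an element of I
  one degree lower.\<close>

lemma van_W1: "f \<in> van (r + k) \<Longrightarrow> f \<in> W 1 k"
proof (induction k arbitrary: f)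
  case 0
  have "f * 1 \<in> W (Suc 0) 0" by (rule W_mult_van) (use 0 in auto)
  then show ?case by simp
next
  case (Suc k)
  have "\<exists>w\<in>W 1 (Suc k). x0div (w - single c 1)" if "c \<in> pexpts n (r + Suc k)" for c
    using W_lift[of c 1 "Suc k"] that by simp
  then obtain Q where Q: "\<And>c. c \<in> pexpts n (r + Suc k) \<Longrightarrow> Q c \<in> W 1 (Suc k) \<and> x0div (Q c - single c 1)"
    by metis
  have van: "w \<in> van (r + b)" if "w \<in> W (Suc 0) b" for w b
    using that
  proof (induction rule: W_Suc_induct)
    case (mult q w)
    then show ?case using van_mult[of q r w b] by (simp add: mult.commute)
  qed (auto intro: van_add)
  show ?case
  proof (rule lift_induct[where V = "van (r + Suc k)" and P = "\<lambda>f. f \<in> W 1 (Suc k)" and Q = Q])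
    show "van (r + Suc k) \<subseteq> forms n (r + Suc k)" by (auto dest: van_forms)
    show "Q \<mu> \<in> van (r + Suc k) \<and> x0div (Q \<mu> - single \<mu> 1)" if "\<mu> \<in> pexpts n (r + Suc k)" for \<mu>
      using Q[OF that] van[of "Q \<mu>" "Suc k"] by simp
    show "g \<in> W 1 (Suc k)" if g: "g \<in> van (r + Suc k)" "x0div g" for g
    proof -
      obtain h where "h \<in> van (r + k)" "g = mvar 0 * h"
        by (rule van_div_x0[of g "r + k"]) (use g in auto)
      then show ?thesis using W_mult[OF Suc.IH forms_mvar, of h 0] by simp
    qed
  qed (use Suc.prems Q van_add van_const W_add W_const in auto)
qed

lemma van_mult_x0div:
  assumes IH: "\<And>b z. z \<in> W m (Suc b) \<Longrightarrow> x0div z \<Longrightarrow> \<exists>h\<in>W m b. z = mvar 0 * h"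
    and q: "q \<in> van r" and w: "w \<in> W m (Suc b)" "x0div w"
  shows "\<exists>h\<in>W (Suc m) b. q * w = mvar 0 * h"
proof -
  obtain h where "h \<in> W m b" "w = mvar 0 * h" using IH w by blast
  then show ?thesis using W_mult_van[OF q]
    by (intro bexI[of _ "q * h"]) (auto simp: algebra_simps)
qed

text \<open>Dividing \<open>g\<close> by x_0 gives \<open>h\<close> in I of degree only
  \<open>r - 1\<close>. A variable split off the surplus of \<open>w\<close> and moved to
  \<open>h\<close> restores degree \<open>r\<close>; this is why the surplus is
  \<open>Suc b\<close>.\<close>

lemma x0div_mult_W:
  assumes g: "g \<in> van r" "x0div g" and w: "w \<in> W m (Suc b)"
  shows "\<exists>h\<in>W (Suc m) b. g * w = mvar 0 * h"
proof -
  have "g \<in> van (Suc (r - 1))" using g r_pos by simp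
  then obtain h where h: "h \<in> van (r - 1)" "g = mvar 0 * h"
    by (rule van_div_x0) (use g(2) in auto)
  have "h * w \<in> W (Suc m) b"
    unfolding W.simps
  proof (rule aspan_map[OF W_excess[OF w], of "(*) h"])
    fix x assume "x \<in> {mvar i * w' | i w'. i \<le> n \<and> w' \<in> W m b}"
    then obtain i w' where x: "i \<le> n" "w' \<in> W m b" "h * x = (mvar i * h) * w'"
      by (auto simp: algebra_simps)
    moreover have "mvar i * h \<in> van r"
      using van_mult[OF h(1) forms_mvar[OF x(1)]] r_pos by simp
    ultimately show "h * x \<in> aspan {q * w | q w. q \<in> van r \<and> w \<in> W m b}"
      unfolding x(3) by (intro aspan_base) blast
  qed (auto simp: distrib_left)
  then show ?thesis unfolding h(2) by (metis mult.assoc)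
qed

text \<open>\<open>q L \<equiv> q' L'\<close> modulo \<open>x\<^sub>0 W\<close> whenever the leading monomials agree: move the exponent of \<open>q\<close>
  towards that of \<open>q'\<close> by exchanging one variable at a time with the surplus factor of \<open>L\<close>.\<close>

lemma W_exchange:
  assumes IH: "\<And>b z. z \<in> W m (Suc b) \<Longrightarrow> x0div z \<Longrightarrow> \<exists>h\<in>W m b. z = mvar 0 * h"
    and q: "q \<in> van r" "x0div (q - single \<mu> 1)" "\<mu> \<in> pexpts n r"
    and L: "L \<in> W m (Suc b)" "x0div (L - single c 1)" "c \<in> pexpts n (m * r + Suc b)"
    and q': "q' \<in> van r" "x0div (q' - single \<mu>' 1)" "\<mu>' \<in> pexpts n r"
    and L': "L' \<in> W m (Suc b)" "x0div (L' - single c' 1)"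
    and eq: "\<mu> + c = \<mu>' + c'"
  shows "\<exists>h\<in>W (Suc m) b. q * L - q' * L' = mvar 0 * h"
proof -
  \<comment> \<open>\<open>D z\<close> says that \<open>z\<close> lies in x_0 W; the claim is a
    congruence modulo this set.\<close>
  define D where "D z \<longleftrightarrow> (\<exists>h\<in>W (Suc m) b. z = mvar 0 * h)" for z
  have Dadd: "D (x + y)" if "D x" "D y" for x y
    using that unfolding D_def by (metis W_add distrib_left)
  have "D (q * L - q' * L')"
    using q L eq
  proof (induction "monom_degree (\<mu> - \<mu>')" arbitrary: q L \<mu> c rule: less_induct)
    case less
    note q = less.prems(1-3) and L = less.prems(4-6)
    show ?case
    proof (cases "\<mu> - \<mu>' = 0")
      case True
      \<comment> \<open>Subtraction of exponents is truncated, so its vanishing only gives \<mu>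
        \<le> \<mu>' entrywise; the equal degrees \<open>r\<close> turn this into equality.\<close>
      have "\<mu>' = \<mu> + (\<mu>' - \<mu>)"
      proof (rule poly_mapping_eqI)
        fix i
        have "lookup (\<mu> - \<mu>') i = 0" using True by simp
        then show "lookup \<mu>' i = lookup (\<mu> + (\<mu>' - \<mu>)) i" by (simp add: lookup_add lookup_minus)
      qed
      moreover from this have "monom_degree (\<mu>' - \<mu>) = 0"
        using q(3) q'(3) monom_degree_add[of \<mu> "\<mu>' - \<mu>"] by (simp add: pexpts_def expts_def)
      ultimately have \<mu>: "\<mu> = \<mu>'" by (simp add: monom_degree_eq_0_iff)
      then have c: "c = c'" using less.prems(7) by simp
      have "q * L - q' * L' = (q - q') * L + q' * (L - L')" by (simp add: algebra_simps)
      moreover have "x0div (q - q')" using x0div_diff[OF q(2) q'(2)] \<mu> by simp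
      moreover have "x0div (L - L')" using x0div_diff[OF L(2) L'(2)] c by simp
      moreover have "L - L' \<in> W m (Suc b)"
        using W_add[OF L(1) W_const[OF L'(1), of "- 1"]] by (simp add: single_uminus)
      ultimately show ?thesis
        using van_mult_x0div[OF IH q'(1)] x0div_mult_W[OF van_diff[OF q(1) q'(1)] _ L(1)] Dadd unfolding D_def by metis
    next
      case False
      then obtain i where i: "lookup (\<mu> - \<mu>') i \<noteq> 0" by (metis lookup_zero poly_mapping_eqI)
      then have i': "lookup \<mu>' i < lookup \<mu> i" by (simp add: lookup_minus)
      have "\<exists>j. lookup \<mu> j < lookup \<mu>' j"
      proof (rule ccontr)
        assume "\<not> ?thesis"
        then have "\<mu> = \<mu>' + (\<mu> - \<mu>')"
          by (intro poly_mapping_eqI) (simp add: lookup_add lookup_minus not_less)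
        then have "monom_degree (\<mu> - \<mu>') = 0"
          using q(3) q'(3) monom_degree_add[of \<mu>' "\<mu> - \<mu>'"] by (simp add: pexpts_def expts_def)
        then show False using False by (simp add: monom_degree_eq_0_iff)
      qed
      then obtain j where j: "lookup \<mu> j < lookup \<mu>' j" by blast
      have "lookup \<mu> j + lookup c j = lookup \<mu>' j + lookup c' j"
        using less.prems(7) by (metis lookup_add)
      then have jc: "j \<in> keys c" using j by (simp add: in_keys_iff)
      have ji: "j \<noteq> i" using i' j by auto
      define \<mu>1 where "\<mu>1 = \<mu> - single i 1"
      define h where "h = c - single j 1"
      have \<mu>1: "\<mu> = single i 1 + \<mu>1" unfolding \<mu>1_def using i' by (intro poly_mapping_remove[symmetric]) (simp add: in_keys_iff)
      have h: "c = single j 1 + h" unfolding h_def using jc by (intro poly_mapping_remove[symmetric])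
      have si: "single i 1 \<in> pexpts n 1"
        using q(3) unfolding \<mu>1 by (auto simp: pexpts_def expts_def lookup_add keys_exponent_add)
      have sj: "single j 1 \<in> pexpts n 1"
        using L(3) unfolding h by (auto simp: pexpts_def expts_def lookup_add keys_exponent_add)
      have ij: "i \<le> n" "j \<le> n" using si sj by (auto simp: pexpts_def expts_def)
      have "\<mu>1 \<in> pexpts n (r - 1)"
        using q(3) unfolding \<mu>1 by (auto simp: pexpts_def expts_def lookup_add keys_exponent_add monom_degree_add)
      then have \<nu>: "single j 1 + \<mu>1 \<in> pexpts n r" using pexpts_add[OF sj] r_pos by fastforce
      have hS: "h \<in> pexpts n (m * r + b)"
        using L(3) unfolding h by (auto simp: pexpts_def expts_def lookup_add keys_exponent_add monom_degree_add)
      have d: "single i 1 + h \<in> pexpts n (m * r + Suc b)" using pexpts_add[OF si hS] by simp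
      \<comment> \<open>\<open>Q\<close> lifts \<mu> with x_i replaced by x_j, and \<open>H\<close>
        lifts \<open>c\<close> without x_j. The passage is q L, q x_j H, x_i Q H, q' L'. Each
        difference of neighbours lies in x_0 W: the second because x_j q - x_i Q is x_0 times an
        element of I_r, the third by induction.\<close>
      obtain Q where Q: "Q \<in> van r" "x0div (Q - single (single j 1 + \<mu>1) 1)"
        using van_lift[OF \<nu>] by blast
      obtain H where H: "H \<in> W m b" "x0div (H - single h 1)" using W_lift[OF hS] by blast
      have xH: "mvar k * H \<in> W m (Suc b)" if "k \<le> n" for k using W_mult[OF H(1) forms_mvar[OF that]] by simp
      have lift: "x0div (mvar k * H - single (single k 1 + h) 1)" for k
        using x0div_mult2[OF H(2), of "mvar k"] by (simp add: right_diff_distrib mvar_def mult_single)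
      have "D (q * (L - mvar j * H))"
        unfolding D_def
      proof (rule van_mult_x0div[OF IH q(1)])
        show "L - mvar j * H \<in> W m (Suc b)"
          using W_add[OF L(1) W_const[OF xH[OF ij(2)], of "- 1"]] by (simp add: single_uminus)
        show "x0div (L - mvar j * H)"
          using x0div_diff[OF L(2) lift[of j]] h by simp
      qed
      moreover have "D ((mvar j * q - mvar i * Q) * H)"
      proof -
        have "mvar j * q - mvar i * Q \<in> van (Suc r)"
          using van_diff[OF van_mult[OF q(1) forms_mvar[OF ij(2)]] van_mult[OF Q(1) forms_mvar[OF ij(1)]]] by simp
        moreover have "x0div (mvar j * q - mvar i * Q)"
        proof -
          have "x0div (mvar j * (q - single \<mu> 1) - mvar i * (Q - single (single j 1 + \<mu>1) 1))"
            by (intro x0div_diff x0div_mult2 q(2) Q(2))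
          then show ?thesis
            by (simp add: right_diff_distrib mvar_def mult_single \<mu>1 add.left_commute)
        qed
        ultimately obtain g where "g \<in> van r" "mvar j * q - mvar i * Q = mvar 0 * g"
          by (rule van_div_x0)
        then show ?thesis unfolding D_def
          using W_mult_van[OF _ H(1)] by (intro bexI[of _ "g * H"]) (auto simp: mult.assoc)
      qed
      moreover have "D (Q * (mvar i * H) - q' * L')"
      proof (rule less.hyps[OF _ Q \<nu> xH[OF ij(1)] lift d])
        \<comment> \<open>As \<mu> is below \<mu>' at \<open>j\<close>, adding x_j creates no new
          excess, so one exchange lowers the excess by exactly one.\<close>
        have "\<mu> - \<mu>' = single i 1 + ((single j 1 + \<mu>1) - \<mu>')"
          unfolding \<mu>1_def using i' j ji
          by (intro poly_mapping_eqI) (auto simp: lookup_add lookup_minus lookup_single when_def)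
        then show "monom_degree ((single j 1 + \<mu>1) - \<mu>') < monom_degree (\<mu> - \<mu>')"
          by (simp add: monom_degree_add)
        show "single j 1 + \<mu>1 + (single i 1 + h) = \<mu>' + c'"
          using less.prems(7) unfolding \<mu>1 h by (simp add: ac_simps)
      qed
      ultimately have "D (q * (L - mvar j * H) + ((mvar j * q - mvar i * Q) * H) + (Q * (mvar i * H) - q' * L'))"
        by (intro Dadd)
      then show ?thesis by (simp add: algebra_simps)
    qed
  qed
  then show ?thesis by (simp add: D_def)
qed

text \<open>Fix a standard product \<open>K M\<close> of two lifts over each monomial
  \<open>M\<close> free of x_0. By exchange every product of lifts is congruent to the standard one
  modulo x_0 W, so z is congruent to \<Lambda> z for all z in W. If x_0 divides z, then \<Lambda> z
  = 0, because z has no term free of x_0.\<close>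

lemma W_div_x0: "z \<in> W m (Suc b) \<Longrightarrow> x0div z \<Longrightarrow> \<exists>h\<in>W m b. z = mvar 0 * h"
proof (induction m arbitrary: b z)
  case 0
  then show ?case using forms_div_x0[of z n b] by (metis W.simps(1))
next
  case (Suc m)
  define N where "N = Suc m * r + Suc b"
  define D where "D z \<longleftrightarrow> (\<exists>h\<in>W (Suc m) b. z = mvar 0 * h)" for z
  have D0: "D 0" unfolding D_def by (intro bexI[of _ 0]) auto
  have Dadd: "D (x + y)" if "D x" "D y" for x y
    using that unfolding D_def by (metis W_add distrib_left)
  have Dconst: "D (single 0 c * x)" if "D x" for x c
    using that W_const unfolding D_def by (metis mult.left_commute)
  have "\<exists>q. q \<in> van r \<and> x0div (q - single \<mu> 1)" if "\<mu> \<in> pexpts n r" for \<mu>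
    using van_lift[OF that] by blast
  then obtain Q where Q: "\<And>\<mu>. \<mu> \<in> pexpts n r \<Longrightarrow> Q \<mu> \<in> van r \<and> x0div (Q \<mu> - single \<mu> 1)"
    by metis
  have "\<exists>w. w \<in> W m (Suc b) \<and> x0div (w - single c 1)" if "c \<in> pexpts n (m * r + Suc b)" for c
    using W_lift[OF that] by blast
  then obtain L where L: "\<And>c. c \<in> pexpts n (m * r + Suc b) \<Longrightarrow> L c \<in> W m (Suc b) \<and> x0div (L c - single c 1)"
    by metis
  have "\<exists>\<mu> c. \<mu> \<in> pexpts n r \<and> c \<in> pexpts n (m * r + Suc b) \<and> M = \<mu> + c" if "M \<in> pexpts n N" for M
    using pexpts_split[of M n r "m * r + Suc b"] that by (auto simp: N_def add.assoc)
  then obtain \<mu>0 c0 where split: "\<And>M. M \<in> pexpts n N \<Longrightarrow>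
      \<mu>0 M \<in> pexpts n r \<and> c0 M \<in> pexpts n (m * r + Suc b) \<and> M = \<mu>0 M + c0 M"
    by metis
  define K where "K M = Q (\<mu>0 M) * L (c0 M)" for M
  define \<Lambda> where "\<Lambda> z = (\<Sum>M\<in>pexpts n N. single 0 (lookup z M) * K M)" for z
  have \<Lambda>0: "\<Lambda> z = 0" if "x0div z" for z
    using that unfolding \<Lambda>_def x0div_iff by (auto simp: pexpts_def intro!: sum.neutral)
  have \<Lambda>add: "\<Lambda> (x + y) = \<Lambda> x + \<Lambda> y" for x y
    by (simp add: \<Lambda>_def lookup_add single_add algebra_simps sum.distrib)
  define P where "P z \<longleftrightarrow> D (z - \<Lambda> z)" for z
  have Padd: "P (x + y)" if "P x" "P y" for x y
    using Dadd[OF that[unfolded P_def]] by (simp add: P_def \<Lambda>add algebra_simps)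
  have PD: "P z" if "D z" for z
  proof -
    have "x0div z" using that x0div_mvar by (auto simp: D_def)
    then show ?thesis using that by (simp add: P_def \<Lambda>0)
  qed
  have gen: "P (single 0 a * Q \<mu> * (single 0 a' * L c))"
    if \<mu>: "\<mu> \<in> pexpts n r" and c: "c \<in> pexpts n (m * r + Suc b)" for a a' \<mu> c
  proof -
    let ?M = "\<mu> + c" and ?z = "single 0 a * Q \<mu> * (single 0 a' * L c)"
    have z: "?z = single 0 (a * a') * (Q \<mu> * L c)"
    proof -
      have "single 0 (a * a') = single 0 a * single (0 :: nat \<Rightarrow>\<^sub>0 nat) a'" by (simp add: mult_single)
      then show ?thesis by (simp only: ac_simps)
    qed
    have M: "?M \<in> pexpts n N" using pexpts_add[OF \<mu> c] by (simp add: N_def add.assoc)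
    have "Q \<mu> * L c - single ?M 1 = (Q \<mu> - single \<mu> 1) * L c + single \<mu> 1 * (L c - single c 1)"
      by (simp add: algebra_simps mult_single)
    then have "x0div (Q \<mu> * L c - single ?M 1)"
      using Q[OF \<mu>] L[OF c] by (auto intro: x0div_add x0div_mult1 x0div_mult2)
    then have "lookup (Q \<mu> * L c) M = (if M = ?M then 1 else 0)" if "M \<in> pexpts n N" for M
      using that unfolding x0div_iff by (auto simp: lookup_minus lookup_single pexpts_def when_def)
    then have "\<Lambda> ?z = (\<Sum>M\<in>pexpts n N. if M = ?M then single 0 (a * a') * K ?M else 0)"
      unfolding \<Lambda>_def z by (intro sum.cong) (auto simp: lookup_const_mult)
    also have "\<dots> = single 0 (a * a') * K ?M" using M by simp
    finally have "?z - \<Lambda> ?z = single 0 (a * a') * (Q \<mu> * L c - K ?M)"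
      unfolding z by (simp add: algebra_simps)
    moreover have "D (Q \<mu> * L c - K ?M)"
      unfolding D_def K_def
      by (rule W_exchange[of m "Q \<mu>" \<mu> "L c" b c "Q (\<mu>0 ?M)" "\<mu>0 ?M" "L (c0 ?M)" "c0 ?M"])
         (use Suc.IH Q L \<mu> c split[OF M] in auto)
    ultimately show ?thesis using Dconst by (simp add: P_def)
  qed
  \<comment> \<open>Two nested reductions, one for each factor, leave only products of lifts, which
    are covered by \<open>gen\<close>.\<close>
  have P: "P (q * w)" if q: "q \<in> van r" and w: "w \<in> W m (Suc b)" for q w
  proof (rule lift_induct[where V = "van r" and P = "\<lambda>q. P (q * w)" and Q = Q and d = r and n = n])
    fix a \<mu> assume \<mu>: "\<mu> \<in> pexpts n r"
    then have aQ: "single 0 a * Q \<mu> \<in> van r" using Q van_const by blast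
    show "P (single 0 a * Q \<mu> * w)"
    proof (rule lift_induct[where V = "W m (Suc b)" and P = "\<lambda>w. P (single 0 a * Q \<mu> * w)" and Q = L
          and d = "m * r + Suc b" and n = n])
      show "P (single 0 a * Q \<mu> * (single 0 c * L \<mu>'))" if "\<mu>' \<in> pexpts n (m * r + Suc b)" for c \<mu>'
        using gen[OF \<mu> that] .
      show "P (single 0 a * Q \<mu> * g)" if "g \<in> W m (Suc b)" "x0div g" for g
        using PD van_mult_x0div[OF Suc.IH aQ that] by (simp add: D_def)
      show "W m (Suc b) \<subseteq> forms n (m * r + Suc b)" using W_forms by blast
    qed (use w L W_add W_const Padd in \<open>auto simp: distrib_left\<close>)
  next
    show "P (g * w)" if "g \<in> van r" "x0div g" for g
      using PD x0div_mult_W[OF that w] by (simp add: D_def)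
  qed (use q Q van_add van_const van_forms Padd in \<open>auto simp: distrib_right\<close>)
  have "P z"
    using Suc.prems(1)
  proof (induction rule: W_Suc_induct)
    case zero
    then show ?case using PD[OF D0] .
  qed (auto intro: P Padd)
  then show ?case using \<Lambda>0[OF Suc.prems(2)] by (simp add: P_def D_def)
qed

lemma W_descend: "mvar 0 ^ N * f \<in> W m (b + N) \<Longrightarrow> f \<in> W m b"
proof (induction N)
  case (Suc N)
  then obtain h where h: "h \<in> W m (b + N)" "mvar 0 * (mvar 0 ^ N * f) = mvar 0 * h"
    using W_div_x0[of "mvar 0 * (mvar 0 ^ N * f)" m "b + N"] x0div_mvar by (auto simp: mult.assoc)
  then show ?case using Suc.IH mult_left_cancel[OF mvar_nonzero] by metis
qed simp

end

section \<open>Comparison with symbolic powers, and the containment\<close>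

lemma poly_ideal_sum:
  assumes "ideal I (poly_ring n)" "\<And>i. i \<in> A \<Longrightarrow> f i \<in> I"
  shows "sum f A \<in> I"
  using assms(2)
  by (induction A rule: infinite_finite_induct) (auto intro: poly_idealD[OF assms(1)])

lemma ipow_antimono:
  assumes "ideal A (poly_ring n)" "a \<le> b"
  shows "ipow n A b \<subseteq> ipow n A a"
  using assms(2)
proof (induction rule: dec_induct)
  case (step k)
  then show ?case using PR.ideal_prod_inter[OF ideal_ipow[OF assms(1)] assms(1), of k] by auto
qed simp

lemma ipow_mult:
  assumes A: "ideal A (poly_ring n)" and x: "x \<in> ipow n A a" and y: "y \<in> ipow n A b"
  shows "x * y \<in> ipow n A (a + b)"
proof -
  have "ipow n A (a + b) = ideal_prod (poly_ring n) (ipow n A a) (ipow n A b)"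
  proof (induction b)
    case 0
    then show ?case using PR.ideal_prod_one[OF ideal_ipow[OF A]] by simp
  next
    case (Suc b)
    then show ?case using PR.ideal_prod_assoc[OF ideal_ipow[OF A, of a] ideal_ipow[OF A, of b] A] by simp
  qed
  then show ?thesis using ideal_prod.prod[OF x y, of "poly_ring n"] by simp
qed

lemma ideal_point_ideal: "ideal (point_ideal n p) (poly_ring n)"
  unfolding point_ideal_def by (rule PR.genideal_ideal) (auto simp: is_form_def)

lemma ideal_radical_ideal: "ideal (radical_ideal n s P) (poly_ring n)"
proof (rule poly_idealI)
  note * = poly_idealD[OF ideal_point_ideal[of n]]
  show "radical_ideal n s P \<subseteq> polys n" by (auto simp: radical_ideal_def)
qed (auto simp: radical_ideal_def polys_add polys_mult poly_idealD[OF ideal_point_ideal])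

lemma symbolic_power_antimono: "a \<le> b \<Longrightarrow> symbolic_power n s P b \<subseteq> symbolic_power n s P a"
  using ipow_antimono[OF ideal_point_ideal] unfolding symbolic_power_def by blast

lemma symbolic_power_mult:
  "f \<in> symbolic_power n s P a \<Longrightarrow> g \<in> symbolic_power n s P b \<Longrightarrow> f * g \<in> symbolic_power n s P (a + b)"
  by (auto simp: symbolic_power_def polys_mult ipow_mult[OF ideal_point_ideal])

lemma ideal_irrelevant_ideal: "ideal (irrelevant_ideal n) (poly_ring n)"
  unfolding irrelevant_ideal_def
  by (rule PR.genideal_ideal) (auto intro: forms_polys[OF forms_mvar])

lemma mvar_irrelevant_ideal: "i \<le> n \<Longrightarrow> mvar i \<in> irrelevant_ideal n"
  unfolding irrelevant_ideal_def
  by (rule subsetD[OF PR.genideal_self]) (auto intro: forms_polys[OF forms_mvar])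

lemma radical_add:
  assumes I: "ideal I (poly_ring n)" and ab: "a \<in> polys n" "b \<in> polys n" "a ^ k \<in> I" "b ^ l \<in> I"
  shows "(a + b) ^ (k + l) \<in> I"
proof -
  note I = poly_idealD[OF I]
  have nat: "of_nat c \<in> polys n" for c
    by (induction c) (auto intro: polys_add)
  show ?thesis
    unfolding binomial_ring
  proof (rule poly_ideal_sum[OF assms(1)])
    fix j assume j: "j \<in> {..k + l}"
    show "of_nat (k + l choose j) * a ^ j * b ^ (k + l - j) \<in> I"
    proof (cases "j \<ge> k")
      case True
      then have aj: "a ^ j = a ^ (j - k) * a ^ k" by (simp flip: power_add)
      have "of_nat (k + l choose j) * a ^ j * b ^ (k + l - j) =
          (of_nat (k + l choose j) * a ^ (j - k) * b ^ (k + l - j)) * a ^ k"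
        by (subst aj) (simp only: ac_simps)
      then show ?thesis using ab by (auto intro!: I polys_mult nat polys_power)
    next
      case False
      then have bj: "b ^ (k + l - j) = b ^ (k - j) * b ^ l" by (simp flip: power_add)
      have "of_nat (k + l choose j) * a ^ j * b ^ (k + l - j) =
          (of_nat (k + l choose j) * a ^ j * b ^ (k - j)) * b ^ l"
        by (subst bj) (simp only: ac_simps)
      then show ?thesis using ab by (auto intro!: I polys_mult nat polys_power)
    qed
  qed
qed

lemma radical_sum:
  assumes I: "ideal I (poly_ring n)" and "finite A"
    and "\<And>i. i \<in> A \<Longrightarrow> f i \<in> polys n" "\<And>i. i \<in> A \<Longrightarrow> \<exists>k. f i ^ k \<in> I"
  shows "\<exists>k. sum f A ^ k \<in> I"
  using assms(2-)
proof (induction A)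
  case empty
  then show ?case by (intro exI[of _ 1]) (simp add: poly_idealD(2)[OF I])
next
  case (insert a A)
  obtain l where "sum f A ^ l \<in> I" using insert.IH insert.prems by auto
  moreover obtain k where "f a ^ k \<in> I" using insert.prems(2)[of a] by auto
  ultimately have "(f a + sum f A) ^ (k + l) \<in> I"
    using insert.prems by (intro radical_add[OF I] polys_sum) auto
  then show ?case using insert.hyps by auto
qed

locale separated_classes = separated_points n s r v sep
  for n s r :: nat and v :: "nat \<Rightarrow> nat \<Rightarrow> 'k::field" and sep +
  fixes P :: "nat \<Rightarrow> (nat \<Rightarrow> 'k) set"
  assumes rep: "i < s \<Longrightarrow> v i \<in> P i"
    and rep_scale: "i < s \<Longrightarrow> w \<in> P i \<Longrightarrow> \<exists>c. w = (\<lambda>j. c * v i j)"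
begin

text \<open>The ideal generated by I_r^m, as the sum of its graded pieces.\<close>

definition WS :: "nat \<Rightarrow> (nat, 'k) mpoly set" where
  "WS m = aspan (\<Union>b. W m b)"

lemma W_prod: "x \<in> W a b \<Longrightarrow> y \<in> W a' b' \<Longrightarrow> x * y \<in> W (a + a') (b + b')"
proof (induction a arbitrary: x)
  case 0
  then show ?case using W_mult[of y a' b' x b] by (simp add: add.commute)
next
  case (Suc a)
  from Suc.prems(1) show ?case
  proof (induction rule: W_Suc_induct)
    case (mult q w)
    then show ?case using W_mult_van[OF mult(1) Suc.IH[OF mult(2) Suc.prems(2)]] by (simp add: mult.assoc)
  qed (auto simp: distrib_right W_add)
qed

lemma WS_prod:
  assumes x: "x \<in> WS a" and y: "y \<in> WS b"
  shows "x * y \<in> WS (a + b)"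
  unfolding WS_def
proof (rule aspan_map[OF x[unfolded WS_def], of "\<lambda>x. x * y"])
  fix x assume "x \<in> (\<Union>b. W a b)"
  then obtain k where x: "x \<in> W a k" by blast
  show "x * y \<in> aspan (\<Union>k. W (a + b) k)"
  proof (rule aspan_map[OF y[unfolded WS_def], of "(*) x"])
    fix y assume "y \<in> (\<Union>k. W b k)"
    then show "x * y \<in> aspan (\<Union>k. W (a + b) k)"
      using W_prod[OF x] by (blast intro: aspan_base)
  qed (auto simp: distrib_left)
qed (auto simp: distrib_right)

lemma polys_WS: "f \<in> polys n \<Longrightarrow> f \<in> WS 0"
  using polys_aspan by (simp add: WS_def)

lemma WS_polys: "f \<in> WS m \<Longrightarrow> f \<in> polys n"
  unfolding WS_def by (erule aspan_closed) (auto intro: polys_add forms_polys[OF W_forms])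

lemma WS_add: "f \<in> WS m \<Longrightarrow> g \<in> WS m \<Longrightarrow> f + g \<in> WS m"
  by (simp add: WS_def aspan_add)

lemma WS_mult: "g \<in> polys n \<Longrightarrow> f \<in> WS m \<Longrightarrow> g * f \<in> WS m"
  using WS_prod[OF polys_WS, of g f m] by simp

lemma WS_0 [simp]: "0 \<in> WS m"
  by (simp add: WS_def aspan.zero)

lemma W_WS: "w \<in> W m b \<Longrightarrow> w \<in> WS m"
  unfolding WS_def by (rule aspan_base) blast

lemma hcomp_WS: "f \<in> WS m \<Longrightarrow> hcomp (m * r + b) f \<in> W m b"
proof -
  assume "f \<in> WS m"
  then have "f \<in> {f. hcomp (m * r + b) f \<in> W m b}"
    unfolding WS_def
  proof (rule aspan_closed)
    show "(\<Union>k. W m k) \<subseteq> {f. hcomp (m * r + b) f \<in> W m b}"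
      using hcomp_forms[OF W_forms] by (auto split: if_splits)
  qed (auto simp: hcomp_add W_add)
  then show ?thesis by simp
qed

text \<open>The colon ideal (\<open>WS m\<close> : f). The radical lemmas are applied to it in order
  to find a power of x_0 that multiplies f into \<open>WS m\<close>.\<close>

lemma ideal_colon: "ideal {g \<in> polys n. g * f \<in> WS m} (poly_ring n)"
  by (rule poly_idealI)
     (auto simp: distrib_right WS_add polys_add polys_mult mult.assoc intro: WS_mult)

text \<open>A form of positive degree vanishing at P_i, times \<open>sep i\<close>, vanishes at all
  points and has degree at least \<open>r\<close>, so \<open>van_W1\<close> applies. A constant
  vanishing at a point is 0.\<close>

lemma sep_point_ideal:
  assumes i: "i < s" and b: "b \<in> point_ideal n (P i)"
  shows "sep i * b \<in> WS 1"
proof -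
  have "point_ideal n (P i) \<subseteq> {g \<in> polys n. g * sep i \<in> WS 1}"
    unfolding point_ideal_def
  proof (rule PR.genideal_minimal[OF ideal_colon], rule subsetI)
    fix f :: "(nat, 'k) mpoly" assume "f \<in> {f. is_form n f \<and> (\<forall>v\<in>P i. mpoly_eval f v = 0)}"
    then obtain d where f: "f \<in> forms n d" "mpoly_eval f (v i) = 0"
      using rep[OF i] by (auto simp: is_form_iff)
    have "f * sep i \<in> WS 1"
    proof (cases d)
      case 0
      then have "f = single 0 (lookup f 0)" using f(1) forms_0_eq_const by blast
      moreover from this have "lookup f 0 = 0" using f(2) eval_single[of 0 "lookup f 0" "v i"] by simp
      ultimately show ?thesis by simp
    next
      case (Suc k)
      have "f * sep i \<in> forms n (r + k)"
        using forms_mult[OF f(1) sep_forms[OF i]] r_pos by (simp add: Suc add.commute)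
      then have "f * sep i \<in> van (r + k)"
        using i f(2) by (auto simp: van_def eval_simps sep_eval)
      then show ?thesis using W_WS[OF van_W1] by blast
    qed
    then show "f \<in> {g \<in> polys n. g * sep i \<in> WS 1}" using forms_polys[OF f(1)] by simp
  qed
  then show ?thesis using b by (auto simp: mult.commute)
qed

lemma sep_power_ipow:
  assumes i: "i < s"
  shows "x \<in> ipow n (point_ideal n (P i)) m \<Longrightarrow> sep i ^ m * x \<in> WS m"
proof (induction m arbitrary: x)
  case 0
  then show ?case by (simp add: polys_WS)
next
  case (Suc m)
  from Suc.prems[unfolded ipow_Suc] show ?case
  proof (rule ideal_prod_closed[where S = "{x. sep i ^ Suc m * x \<in> WS (Suc m)}", simplified mem_Collect_eq])
    fix a b assume "a \<in> ipow n (point_ideal n (P i)) m" "b \<in> point_ideal n (P i)"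
    then have "(sep i ^ m * a) * (sep i * b) \<in> WS (m + 1)"
      by (intro WS_prod Suc.IH sep_point_ideal[OF i])
    then show "sep i ^ Suc m * (a * b) \<in> WS (Suc m)" by (simp add: ac_simps)
  qed (auto simp: distrib_left WS_add)
qed

text \<open>The colon ideal of f contains \<open>?q ^ m\<close>, as \<open>?q\<close> is in I_r, and
  every \<open>?e i ^ m\<close>, as sep_i^m I(P_i)^m lies in \<open>WS m\<close>. Since
  \<open>?q\<close> and the \<open>?e i\<close> add up to x_0^r, it contains a power of x_0, which
  \<open>W_descend\<close> then cancels.\<close>

lemma hcomp_symbolic_power:
  assumes f: "f \<in> symbolic_power n s P m"
  shows "hcomp (m * r + b) f \<in> W m b"
proof -
  let ?I = "{g \<in> polys n. g * f \<in> WS m}"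
  let ?x = "mvar 0 :: (nat, 'k) mpoly"
  \<comment> \<open>The scalar makes \<open>?e i\<close> agree with x_0^r at \<open>v i\<close>,
    while it is 0 at the other points. Hence \<open>?q\<close> vanishes at all of them.\<close>
  let ?e = "\<lambda>i. single 0 (v i 0 ^ (r - 1)) * (?x * sep i)"
  let ?q = "?x ^ r - (\<Sum>i<s. ?e i)"
  have fp: "f \<in> polys n" using f by (simp add: symbolic_power_def)
  have x: "?x \<in> forms n 1" by (rule forms_mvar) simp
  have xs: "?x * sep i \<in> forms n r" if "i < s" for i
    using forms_mult[OF x sep_forms[OF that]] r_pos by simp
  have e_polys: "?e i \<in> polys n" if "i < s" for i
    using forms_polys[OF forms_const_mult[OF xs[OF that]]] .
  have "?q \<in> van r"
  proof -
    have "?q \<in> forms n r"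
      using forms_power[OF x, of r] by (intro forms_diff forms_sum forms_const_mult xs) auto
    moreover have "mpoly_eval ?q (v j) = 0" if j: "j < s" for j
    proof -
      have "mpoly_eval (\<Sum>i<s. ?e i) (v j) = (\<Sum>i<s. if i = j then v j 0 ^ (r - 1) * v j 0 else 0)"
        unfolding eval_simps by (intro sum.cong) (use j in \<open>auto simp: sep_eval\<close>)
      also have "\<dots> = v j 0 ^ r" using j r_pos by (simp flip: power_Suc2)
      finally show ?thesis by (simp add: eval_simps)
    qed
    ultimately show ?thesis by (simp add: van_def)
  qed
  have qW: "?q ^ k \<in> W k 0" for k
  proof (induction k)
    case (Suc k)
    then show ?case using W_mult_van[OF \<open>?q \<in> van r\<close>] by simp
  qed simp
  then have qI: "?q ^ m \<in> ?I"
  proof -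
    have W: "?q ^ m \<in> WS m" using W_WS[OF qW] .
    then show ?thesis using WS_polys[OF W] WS_mult[OF fp W] by (simp only: mem_Collect_eq mult.commute[of f])
  qed
  have eI: "?e i ^ m \<in> ?I" if i: "i < s" for i
  proof -
    have "sep i ^ m * f \<in> WS m" using f i by (intro sep_power_ipow) (auto simp: symbolic_power_def)
    moreover have "(single 0 (v i 0 ^ (r - 1)) * ?x) ^ m \<in> polys n"
      using forms_polys[OF forms_power[OF forms_const_mult[OF x]]] .
    ultimately have "(single 0 (v i 0 ^ (r - 1)) * ?x) ^ m * (sep i ^ m * f) \<in> WS m"
      by (rule WS_mult[rotated])
    then show ?thesis
      using polys_power[OF e_polys[OF i]] by (simp add: power_mult_distrib ac_simps)
  qed
  have "\<exists>k. (\<Sum>i<s. ?e i) ^ k \<in> ?I"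
    by (rule radical_sum[OF ideal_colon]) (use eI e_polys in auto)
  then obtain k where k: "(\<Sum>i<s. ?e i) ^ k \<in> ?I" ..
  have "(?q + (\<Sum>i<s. ?e i)) ^ (m + k) \<in> ?I"
    by (rule radical_add[OF ideal_colon _ _ qI k])
       (use forms_polys[OF van_forms[OF \<open>?q \<in> van r\<close>]] e_polys in \<open>auto intro: polys_sum\<close>)
  then have WS: "?x ^ (r * (m + k)) * f \<in> WS m" by (simp add: power_mult)
  let ?N = "r * (m + k)"
  have "hcomp (m * r + (b + ?N)) (?x ^ ?N * f) \<in> W m (b + ?N)" by (rule hcomp_WS[OF WS])
  moreover have "hcomp (m * r + (b + ?N)) (?x ^ ?N * f) = ?x ^ ?N * hcomp (m * r + b) f"
  proof -
    have "m * r + (b + ?N) = monom_degree (single 0 ?N :: nat \<Rightarrow>\<^sub>0 nat) + (m * r + b)" by simp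
    then show ?thesis unfolding mvar_power by (simp only: hcomp_single_mult)
  qed
  ultimately show ?thesis using W_descend by metis
qed

lemma forms_irrelevant_power:
  fixes f :: "(nat, 'k) mpoly"
  shows "a \<le> b \<Longrightarrow> f \<in> forms n b \<Longrightarrow> f \<in> ipow n (irrelevant_ideal n) a"
proof (induction a arbitrary: b f)
  case 0
  then show ?case by (simp add: forms_polys)
next
  case (Suc a)
  then obtain b' where b: "b = Suc b'" by (cases b) auto
  have "ideal (ipow n (irrelevant_ideal n :: (nat, 'k) mpoly set) (Suc a)) (poly_ring n)"
    by (intro ideal_ipow ideal_irrelevant_ideal)
  note M = poly_idealD[OF this]
  have "f \<in> aspan {mvar i * w' | i w'. i \<le> n \<and> w' \<in> W 0 b'}"
    using W_excess[of f 0 b'] Suc.prems b by simp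
  then show ?case
  proof (rule aspan_closed)
    show "{mvar i * w' | i w'. i \<le> n \<and> w' \<in> W 0 b'} \<subseteq> ipow n (irrelevant_ideal n) (Suc a)"
    proof safe
      fix i w' assume i: "i \<le> n" and w: "w' \<in> W 0 b'"
      have "w' \<otimes>\<^bsub>poly_ring n\<^esub> mvar i \<in> ipow n (irrelevant_ideal n) (Suc a)"
        unfolding ipow_Suc
        by (rule ideal_prod.prod) (use Suc.IH[of b' w'] Suc.prems b w mvar_irrelevant_ideal[OF i] in auto)
      then show "mvar i * w' \<in> ipow n (irrelevant_ideal n) (Suc a)" by (simp add: mult.commute)
    qed
  qed (use M in auto)
qed

lemma van_radical_ideal: "q \<in> van d \<Longrightarrow> q \<in> radical_ideal n s P"
proof -
  assume q: "q \<in> van d"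
  have "q \<in> point_ideal n (P i)" if i: "i < s" for i
    unfolding point_ideal_def
  proof (rule subsetD[OF PR.genideal_self])
    have "mpoly_eval q w = 0" if w: "w \<in> P i" for w
      using rep_scale[OF i w] eval_forms_scale[OF van_forms[OF q], of _ "v i"] q i
      by (auto simp: van_def)
    then show "q \<in> {f. is_form n f \<and> (\<forall>v\<in>P i. mpoly_eval f v = 0)}"
      using van_forms[OF q] by (auto simp: is_form_iff)
  qed (auto simp: is_form_def)
  then show ?thesis using forms_polys[OF van_forms[OF q]] by (simp add: radical_ideal_def)
qed

lemma W_containment:
  assumes "a \<le> b" "w \<in> W m b"
  shows "w \<in> ideal_prod (poly_ring n) (ipow n (irrelevant_ideal n) a) (ipow n (radical_ideal n s P) m)"
    (is "_ \<in> ?S m")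
  using assms(2)
proof (induction m arbitrary: w)
  case 0
  have "w \<otimes>\<^bsub>poly_ring n\<^esub> 1 \<in> ?S 0"
    by (rule ideal_prod.prod) (use forms_irrelevant_power[OF assms(1)] 0 in auto)
  then show ?case by simp
next
  case (Suc m)
  have ideal: "ideal (?S k) (poly_ring n)" for k
    by (intro PR.ideal_prod_is_ideal ideal_ipow ideal_irrelevant_ideal ideal_radical_ideal)
  note S = poly_idealD[OF ideal]
  from Suc.prems show ?case
  proof (induction rule: W_Suc_induct)
    case (mult q w)
    have "w \<in> {w. q * w \<in> ?S (Suc m)}"
    proof (rule ideal_prod_closed[OF Suc.IH[OF mult(2)]])
      fix x y :: "(nat, 'k) mpoly"
      assume x: "x \<in> ipow n (irrelevant_ideal n) a" and y: "y \<in> ipow n (radical_ideal n s P) m"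
      have "y \<otimes>\<^bsub>poly_ring n\<^esub> q \<in> ipow n (radical_ideal n s P) (Suc m)"
        unfolding ipow_Suc by (rule ideal_prod.prod[OF y van_radical_ideal[OF mult(1)]])
      from ideal_prod.prod[OF x this, of "poly_ring n"]
      show "x * y \<in> {w. q * w \<in> ?S (Suc m)}" by (simp add: ac_simps)
    next
      fix x y assume "x \<in> {w. q * w \<in> ?S (Suc m)}" "y \<in> {w. q * w \<in> ?S (Suc m)}"
      then show "x + y \<in> {w. q * w \<in> ?S (Suc m)}"
        using S(3)[of "q * x" "Suc m" "q * y"] by (simp only: mem_Collect_eq distrib_left)
    qed
    then show ?case by simp
  next
    case zero
    show ?case by (rule S(2))
  next
    case (add x y)
    then show ?case by (rule S(3))
  qed
qed

text \<open>I^(nm) lies in I^(m), whose component of degree t \<ge> m r is in M^(t - m r) I_r^m. The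
  assumed bound is m r + (n - 1) m, which leaves the (n - 1) m surplus factors that the power of M
  asks for.\<close>

lemma containment:
  assumes n: "n \<ge> 1"
    and deg: "\<And>f t. f \<in> symbolic_power n s P (n * m) \<Longrightarrow> hcomp t f \<noteq> 0 \<Longrightarrow> m * (r + n - 1) \<le> t"
  shows "symbolic_power n s P (n * m) \<subseteq>
    ideal_prod (poly_ring n) (ipow n (irrelevant_ideal n) ((n - 1) * m)) (ipow n (radical_ideal n s P) m)"
    (is "_ \<subseteq> ?S")
proof
  fix f assume f: "f \<in> symbolic_power n s P (n * m)"
  have ideal: "ideal ?S (poly_ring n)"
    by (intro PR.ideal_prod_is_ideal ideal_ipow ideal_irrelevant_ideal ideal_radical_ideal)
  note S = poly_idealD[OF this]
  have f': "f \<in> symbolic_power n s P m"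
    using f symbolic_power_antimono[of m "n * m"] n by auto
  have "hcomp t f \<in> ?S" for t
  proof (cases "hcomp t f = 0")
    case False
    then have t: "m * (r + n - 1) \<le> t" using deg f by blast
    moreover have eq: "m * (r + n - 1) = m * r + (n - 1) * m"
      using n by (cases n) (auto simp: algebra_simps)
    ultimately have "hcomp (m * r + (t - m * r)) f \<in> W m (t - m * r)"
      by (intro hcomp_symbolic_power[OF f'])
    then have "hcomp t f \<in> W m (t - m * r)" using t eq by simp
    then show ?thesis by (rule W_containment[rotated]) (use t eq in simp)
  qed (use S in simp)
  obtain N where "\<forall>e\<in>keys f. monom_degree e \<le> N" using ex_degree_bound[of f] by blast
  then have "f = (\<Sum>t\<le>N. hcomp t f)" by (intro sum_hcomp) auto
  moreover have "(\<Sum>t\<le>N. hcomp t f) \<in> ?S"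
    by (rule poly_ideal_sum[OF ideal]) (rule \<open>\<And>t. hcomp t f \<in> ?S\<close>)
  ultimately show "f \<in> ?S" by metis
qed

end

subsection \<open>Order of vanishing\<close>

definition ord_ge :: "nat \<Rightarrow> ('i, 'k::zero) mpoly \<Rightarrow> bool" where
  "ord_ge k f \<longleftrightarrow> (\<forall>e\<in>keys f. k \<le> monom_degree e)"

lemma ord_ge_0 [simp]: "ord_ge k 0" "ord_ge 0 f"
  by (simp_all add: ord_ge_def)

lemma ord_ge_mono: "ord_ge k f \<Longrightarrow> k' \<le> k \<Longrightarrow> ord_ge k' f"
  by (auto simp: ord_ge_def)

lemma ord_ge_add: "ord_ge k f \<Longrightarrow> ord_ge k g \<Longrightarrow> ord_ge k (f + g)"
  unfolding ord_ge_def using keys_add[of f g] by blast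

lemma ord_ge_sum: "(\<And>i. i \<in> A \<Longrightarrow> ord_ge k (f i)) \<Longrightarrow> ord_ge k (sum f A)"
  by (induction A rule: infinite_finite_induct) (auto simp: ord_ge_add)

lemma ord_ge_mult:
  fixes f g :: "('i, 'k::comm_ring_1) mpoly"
  assumes "ord_ge a f" "ord_ge b g"
  shows "ord_ge (a + b) (f * g)"
  unfolding ord_ge_def
proof
  fix e assume "e \<in> keys (f * g)"
  then obtain x y where "x \<in> keys f" "y \<in> keys g" "e = x + y" using keys_mult[of f g] by blast
  then show "a + b \<le> monom_degree e"
    using assms by (auto simp: ord_ge_def monom_degree_add intro: add_mono)
qed

lemma ord_ge_power:
  fixes f :: "('i, 'k::comm_ring_1) mpoly"
  assumes "ord_ge a f"
  shows "ord_ge (k * a) (f ^ k)"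
  by (induction k) (auto intro: ord_ge_mult assms)

lemma ord_ge_mon_val:
  fixes g :: "'i \<Rightarrow> ('j, 'k::comm_ring_1) mpoly"
  assumes "\<And>i. ord_ge 1 (g i)"
  shows "ord_ge (monom_degree e) (mon_val g e)"
proof -
  have "ord_ge (\<Sum>i\<in>A. lookup e i) (\<Prod>i\<in>A. g i ^ lookup e i)" if "finite A" for A
    using that
  proof induction
    case (insert i A)
    then show ?case using ord_ge_mult[OF ord_ge_power[OF assms, of "lookup e i" i] insert.IH] by simp
  qed simp
  then show ?thesis by (simp add: mon_val_def monom_degree_def)
qed

lemma ord_ge_subst:
  fixes g :: "'i \<Rightarrow> ('j, 'k::comm_ring_1) mpoly"
  assumes "ord_ge k f" "\<And>i. ord_ge 1 (g i)"
  shows "ord_ge k (subst g f)"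
  unfolding subst_def ins_def
proof (rule ord_ge_sum)
  fix e assume "e \<in> keys f"
  then have "k \<le> monom_degree e" using assms(1) by (simp add: ord_ge_def)
  then show "ord_ge k (single 0 (lookup f e) * mon_val g e)"
    using ord_ge_mult[OF ord_ge_0(2) ord_ge_mon_val[OF assms(2)]] ord_ge_mono by fastforce
qed

lemma ord_ge_Suc_0_iff: "ord_ge 1 f \<longleftrightarrow> lookup f 0 = 0"
proof
  assume "lookup f 0 = 0"
  then show "ord_ge 1 f"
    unfolding ord_ge_def by (metis in_keys_iff monom_degree_eq_0_iff less_one not_le)
next
  assume "ord_ge 1 f"
  then show "lookup f 0 = 0"
    unfolding ord_ge_def by (metis in_keys_iff monom_degree_0 not_one_le_zero)
qed

lemma mpoly_eval_zero:
  fixes f :: "('i, 'k::comm_ring_1) mpoly"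
  shows "mpoly_eval f (\<lambda>_. 0) = lookup f 0"
proof (induction f rule: poly_mapping_induct)
  case (single e c)
  have "mon_val (\<lambda>_. 0 :: 'k) e = 0" if "e \<noteq> 0"
  proof -
    have "monom_degree e \<noteq> 0" using that by (simp add: monom_degree_eq_0_iff)
    then obtain i where i: "i \<in> keys e" by (auto simp: monom_degree_def)
    then have "\<exists>i\<in>keys e. 0 ^ lookup e i = (0 :: 'k)" by (intro bexI[of _ i]) (simp_all add: in_keys_iff power_0_left)
    then show ?thesis unfolding mon_val_def by (intro prod_zero) simp_all
  qed
  then show ?case by (auto simp: lookup_single when_def)
qed (simp add: eval_simps lookup_add)

section \<open>Multiplicity at a vector\<close>

definition shift :: "('i \<Rightarrow> 'k::comm_ring_1) \<Rightarrow> ('i, 'k) mpoly \<Rightarrow> ('i, 'k) mpoly" where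
  "shift p = subst (\<lambda>i. single 0 (p i) + mvar i)"

lemma is_hom_shift: "is_hom (shift p)"
  by (simp add: shift_def is_hom_subst)

lemmas shift_simps = is_homD[OF is_hom_shift]

lemma lookup_shift_0: "lookup (shift p f) 0 = mpoly_eval f p"
  by (subst mpoly_eval_zero[symmetric]) (simp add: shift_def eval_subst eval_simps)

text \<open>Multiplicity at least \<open>k\<close> at a vector of affine space, measured after
  translating it to the origin. For forms it depends only on the projective point
  (\<open>vanishes_scale\<close>).\<close>

definition vanishes :: "nat \<Rightarrow> ('i \<Rightarrow> 'k::comm_ring_1) \<Rightarrow> ('i, 'k) mpoly \<Rightarrow> bool" where
  "vanishes k p f \<longleftrightarrow> ord_ge k (shift p f)"

lemma vanishes_0 [simp]: "vanishes k p 0" "vanishes 0 p f"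
  by (simp_all add: vanishes_def shift_simps)

lemma vanishes_mono: "vanishes k p f \<Longrightarrow> k' \<le> k \<Longrightarrow> vanishes k' p f"
  by (simp add: vanishes_def ord_ge_mono)

lemma vanishes_add: "vanishes k p f \<Longrightarrow> vanishes k p g \<Longrightarrow> vanishes k p (f + g)"
  by (simp add: vanishes_def shift_simps ord_ge_add)

lemma vanishes_sum: "(\<And>i. i \<in> A \<Longrightarrow> vanishes k p (f i)) \<Longrightarrow> vanishes k p (sum f A)"
  by (simp add: vanishes_def shift_simps ord_ge_sum)

lemma vanishes_mult: "vanishes a p f \<Longrightarrow> vanishes b p g \<Longrightarrow> vanishes (a + b) p (f * g)"
  by (simp add: vanishes_def shift_simps ord_ge_mult)

lemma vanishes_mult1: "vanishes k p f \<Longrightarrow> vanishes k p (g * f)"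
  using vanishes_mult[of 0 p g k f] by simp

lemma vanishes_power: "vanishes a p f \<Longrightarrow> vanishes (k * a) p (f ^ k)"
  by (simp add: vanishes_def shift_simps ord_ge_power)

lemma vanishes_1_iff: "vanishes 1 p f \<longleftrightarrow> mpoly_eval f p = 0"
  unfolding vanishes_def ord_ge_Suc_0_iff lookup_shift_0 ..

text \<open>Once both points are moved to the origin, the substitution has no constant terms, and
  such a substitution cannot lower the order.\<close>

lemma vanishes_subst:
  fixes g :: "'i \<Rightarrow> ('j, 'k::comm_ring_1) mpoly"
  assumes "vanishes k (\<lambda>i. mpoly_eval (g i) p) f"
  shows "vanishes k p (subst g f)"
proof -
  define G where "G i = shift p (g i) - single 0 (mpoly_eval (g i) p)" for i
  have "ord_ge 1 (G i)" for i
    unfolding ord_ge_Suc_0_iff by (simp add: G_def lookup_minus lookup_shift_0)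
  then have "ord_ge k (subst G (shift (\<lambda>i. mpoly_eval (g i) p) f))"
    using assms by (intro ord_ge_subst) (auto simp: vanishes_def)
  also have "subst G (shift (\<lambda>i. mpoly_eval (g i) p) f) = shift p (subst g f)"
    unfolding shift_def subst_subst
    by (rule arg_cong[of _ _ "\<lambda>h. subst h f"]) (simp add: subst_simps G_def shift_def)
  finally show ?thesis by (simp add: vanishes_def)
qed

lemma subst_cong:
  assumes "f \<in> polys n" "\<And>i. i \<le> n \<Longrightarrow> g i = g' i"
  shows "subst g f = subst g' f"
  unfolding subst_def ins_def
proof (intro sum.cong refl arg_cong2[of _ _ _ _ "(*)"])
  fix e assume "e \<in> keys f"
  then show "mon_val g e = mon_val g' e"
    using assms by (intro mon_val_cong) (auto simp: polys_iff)
qed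

lemma vanishes_cong:
  assumes "f \<in> polys n" "\<And>i. i \<le> n \<Longrightarrow> p i = p' i" "vanishes k p f"
  shows "vanishes k p' f"
  using assms(3) subst_cong[OF assms(1), of "\<lambda>i. single 0 (p i) + mvar i" "\<lambda>i. single 0 (p' i) + mvar i"] assms(2)
  by (simp add: vanishes_def shift_def)

lemma subst_scale_forms:
  assumes "f \<in> forms n d"
  shows "subst (\<lambda>i. c * g i) f = c ^ d * subst g f"
proof -
  have m: "mon_val (\<lambda>i. c * g i) e = c ^ monom_degree e * mon_val g e" for e
    by (simp add: mon_val_def monom_degree_def power_mult_distrib prod.distrib power_sum)
  have "subst (\<lambda>i. c * g i) f = (\<Sum>e\<in>keys f. c ^ d * (single 0 (lookup f e) * mon_val g e))"
    unfolding subst_def ins_def m by (intro sum.cong) (auto simp: formsD(1)[OF assms] ac_simps)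
  then show ?thesis by (simp add: subst_def ins_def sum_distrib_left)
qed

lemma const_power: "single (0 :: 'i \<Rightarrow>\<^sub>0 nat) (c :: 'k::comm_ring_1) ^ k = single 0 (c ^ k)"
  by (simp add: is_homD(7)[OF is_hom_const])

text \<open>Rescaling the variables moves \<open>p\<close> to \<open>c p\<close> and changes a form
  only by a nonzero scalar.\<close>

lemma vanishes_scale:
  fixes f :: "(nat, 'k::field) mpoly"
  assumes "f \<in> forms n d" "vanishes k p f" "c \<noteq> 0"
  shows "vanishes k (\<lambda>i. c * p i) f"
proof -
  have "vanishes k (\<lambda>i. mpoly_eval (single 0 (1 / c) * mvar i) (\<lambda>i. c * p i)) f"
    using assms(2,3) by (simp add: eval_simps)
  then have "vanishes k (\<lambda>i. c * p i) (subst (\<lambda>i. single 0 (1 / c) * mvar i) f)"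
    by (rule vanishes_subst)
  then have "vanishes k (\<lambda>i. c * p i) (single 0 ((1 / c) ^ d) * f)"
    by (simp only: subst_scale_forms[OF assms(1)] subst_id const_power)
  then have "vanishes k (\<lambda>i. c * p i) (single 0 (c ^ d) * (single 0 ((1 / c) ^ d) * f))"
    by (rule vanishes_mult1)
  then show ?thesis
    using assms(3) by (simp add: mult_single power_divide flip: mult.assoc)
qed

lemma hcomp_mult_lowest:
  fixes g h :: "('i, 'k::comm_ring_1) mpoly"
  assumes g: "ord_ge a g" and h: "ord_ge b h"
  shows "hcomp (a + b) (g * h) = hcomp a g * hcomp b h"
proof -
  have c0: "hcomp d f = 0" if "ord_ge (Suc d) f" for d and f :: "('i, 'k) mpoly"
  proof (rule poly_mapping_eqI)
    fix e
    have "e \<notin> keys f" if "monom_degree e = d" using that \<open>ord_ge (Suc d) f\<close> by (auto simp: ord_ge_def)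
    then show "lookup (hcomp d f) e = lookup 0 e" by (simp add: lookup_hcomp in_keys_iff)
  qed
  have hi: "ord_ge (Suc d) (f - hcomp d f)" if "ord_ge d f" for d and f :: "('i, 'k) mpoly"
    unfolding ord_ge_def
  proof
    fix e assume "e \<in> keys (f - hcomp d f)"
    then have "monom_degree e \<noteq> d" "lookup f e \<noteq> 0"
      by (auto simp: in_keys_iff lookup_minus lookup_hcomp split: if_splits)
    then show "Suc d \<le> monom_degree e" using that by (auto simp: ord_ge_def in_keys_iff Suc_le_eq le_neq_implies_less)
  qed
  have lo: "ord_ge d (hcomp d f)" for d and f :: "('i, 'k) mpoly"
    by (simp add: ord_ge_def keys_hcomp)
  have "g * h = hcomp a g * hcomp b h + ((g - hcomp a g) * h + hcomp a g * (h - hcomp b h))"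
    by (simp add: algebra_simps)
  then have "hcomp (a + b) (g * h) = hcomp (a + b) (hcomp a g * hcomp b h)
      + (hcomp (a + b) ((g - hcomp a g) * h) + hcomp (a + b) (hcomp a g * (h - hcomp b h)))"
    by (metis hcomp_add)
  also have "hcomp (a + b) ((g - hcomp a g) * h) = 0"
    using ord_ge_mult[OF hi[OF g] h] by (intro c0) simp
  also have "hcomp (a + b) (hcomp a g * (h - hcomp b h)) = 0"
    using ord_ge_mult[OF lo hi[OF h]] by (intro c0) simp
  also have "hcomp (a + b) (hcomp a g * hcomp b h) = hcomp a g * hcomp b h"
  proof (rule poly_mapping_eqI)
    fix e
    have "monom_degree e = a + b" if "e \<in> keys (hcomp a g * hcomp b h)"
      using that keys_mult[of "hcomp a g" "hcomp b h"] by (auto simp: keys_hcomp monom_degree_add)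
    then show "lookup (hcomp (a + b) (hcomp a g * hcomp b h)) e = lookup (hcomp a g * hcomp b h) e"
      by (auto simp: lookup_hcomp in_keys_iff)
  qed
  finally show ?thesis by simp
qed

text \<open>Orders add in a domain: the lowest components of \<open>g\<close> and \<open>h\<close>
  have a nonzero product, which is the lowest component of \<open>g * h\<close>.\<close>

lemma ord_ge_div:
  fixes g h :: "(nat, 'k::idom) mpoly"
  assumes gh: "ord_ge (m + b) (g * h)" and h: "ord_ge b h" "hcomp b h \<noteq> 0"
  shows "ord_ge m g"
proof (rule ccontr)
  assume not: "\<not> ord_ge m g"
  define a where "a = (LEAST d. \<exists>e\<in>keys g. monom_degree e = d)"
  obtain e0 where e0: "e0 \<in> keys g" "monom_degree e0 < m" using not by (auto simp: ord_ge_def not_le)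
  then have "a < m" unfolding a_def by (metis (mono_tags, lifting) Least_le order_le_less_trans)
  have "\<exists>d. \<exists>e\<in>keys g. monom_degree e = d" using e0 by blast
  then have "\<exists>e\<in>keys g. monom_degree e = a" unfolding a_def by (rule LeastI_ex)
  then obtain e where e: "e \<in> keys g" "monom_degree e = a" by blast
  then have ca: "hcomp a g \<noteq> 0" by (metis in_keys_iff lookup_hcomp lookup_zero)
  have "ord_ge a g" unfolding ord_ge_def a_def by (blast intro: Least_le)
  then have "hcomp (a + b) (g * h) \<noteq> 0" using ca h by (simp add: hcomp_mult_lowest)
  then obtain e' where "lookup (hcomp (a + b) (g * h)) e' \<noteq> 0"
    by (metis lookup_zero poly_mapping_eqI)
  then have "e' \<in> keys (g * h)" "monom_degree e' = a + b"
    by (auto simp: lookup_hcomp in_keys_iff split: if_splits)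
  then show False using gh \<open>a < m\<close> by (auto simp: ord_ge_def)
qed

lemma vanishes_div_unit:
  fixes g h :: "(nat, 'k::idom) mpoly"
  assumes "vanishes m p (g * h)" "mpoly_eval h p \<noteq> 0"
  shows "vanishes m p g"
  unfolding vanishes_def
proof (rule ord_ge_div)
  show "ord_ge (m + 0) (shift p g * shift p h)" using assms(1) by (simp add: vanishes_def shift_simps)
  show "hcomp 0 (shift p h) \<noteq> 0"
    using assms(2) lookup_shift_0[of p h] by (metis lookup_hcomp lookup_zero monom_degree_0)
qed simp

lemma shift_linear:
  assumes "L \<in> forms n 1"
  shows "shift p L = single 0 (mpoly_eval L p) + L"
proof -
  have s: "shift p (single e c) = single 0 (mpoly_eval (single e c) p) + single e c" if e: "e \<in> expts n 1" for e c
  proof -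
    obtain i where i: "e = single i 1" using expts_1[OF e] by blast
    show ?thesis
      unfolding i by (simp add: shift_def subst_single mvar_def mult_single distrib_left eval_single)
  qed
  have "shift p (\<Sum>e\<in>keys L. single e (lookup L e)) =
      single 0 (mpoly_eval (\<Sum>e\<in>keys L. single e (lookup L e)) p) + (\<Sum>e\<in>keys L. single e (lookup L e))"
    unfolding shift_simps eval_simps is_homD(8)[OF is_hom_const] sum.distrib[symmetric]
    by (intro sum.cong) (use s assms in \<open>auto simp: forms_def\<close>)
  then show ?thesis by (simp flip: poly_mapping_expand)
qed

text \<open>A linear form vanishing at \<open>p\<close> is fixed by the translation, so its order
  there is exactly 1.\<close>

lemma vanishes_div_linear:
  fixes g L :: "(nat, 'k::idom) mpoly"
  assumes gL: "vanishes (Suc m) p (g * L)" and L: "L \<in> forms n 1" "L \<noteq> 0" "mpoly_eval L p = 0"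
  shows "vanishes m p g"
  unfolding vanishes_def
proof (rule ord_ge_div)
  have sL: "shift p L = L" using shift_linear[OF L(1)] L(3) by simp
  show "ord_ge (m + 1) (shift p g * L)" using gL sL by (simp add: vanishes_def shift_simps)
  show "ord_ge 1 L" using L(1) by (auto simp: ord_ge_def dest: formsD(1))
  show "hcomp 1 L \<noteq> 0" using hcomp_forms[OF L(1), of 1] L(2) by simp
qed

lemma hcomp_mult: "hcomp t (f * g) = (\<Sum>i\<le>t. hcomp i f * hcomp (t - i) g)"
  for f g :: "('i, 'k::comm_ring_1) mpoly"
proof (induction f rule: poly_mapping_induct)
  case (single e c)
  have "(\<Sum>i\<le>t. hcomp i (single e c) * hcomp (t - i) g) =
      (\<Sum>i\<le>t. if i = monom_degree e then single e c * hcomp (t - monom_degree e) g else 0)"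
    by (intro sum.cong) (auto simp: hcomp_single)
  also have "\<dots> = hcomp t (single e c * g)"
  proof (cases "monom_degree e \<le> t")
    case True
    then show ?thesis using hcomp_single_mult[of e "t - monom_degree e" c g] by simp
  next
    case False
    have "ord_ge (monom_degree e + 0) (single e c * g)"
      by (intro ord_ge_mult) (auto simp: ord_ge_def)
    then have "hcomp t (single e c * g) = 0"
      using False by (intro poly_mapping_eqI) (auto simp: lookup_hcomp ord_ge_def not_in_keys_iff_lookup_eq_zero[symmetric])
    then show ?thesis using False by simp
  qed
  finally show ?case by simp
next
  case (add f f')
  then show ?case by (simp add: hcomp_add distrib_right sum.distrib)
qed

text \<open>Treating all components at once makes the induction work: the components of a product
  are sums of products of components, and multiplicities add.\<close>

lemma vanishes_point_ideal_power:
  assumes p: "p \<in> P"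
  shows "f \<in> ipow n (point_ideal n P) m \<Longrightarrow> vanishes m p (hcomp t f)"
proof (induction m arbitrary: f t)
  case (Suc m)
  let ?H = "{f \<in> polys n. \<forall>t. vanishes 1 p (hcomp t f)}"
  have "point_ideal n P \<subseteq> ?H"
    unfolding point_ideal_def
  proof (rule PR.genideal_minimal)
    show "ideal ?H (poly_ring n)"
      by (rule poly_idealI)
         (auto simp: hcomp_add hcomp_mult polys_add polys_mult intro!: vanishes_add vanishes_sum intro: vanishes_mult1)
    show "{f. is_form n f \<and> (\<forall>v\<in>P. mpoly_eval f v = 0)} \<subseteq> ?H"
      using p by (auto simp: is_form_iff forms_polys hcomp_forms vanishes_1_iff[unfolded One_nat_def] eval_simps(1))
  qed
  then have 1: "vanishes 1 p (hcomp t f)" if "f \<in> point_ideal n P" for f t using that by blast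
  have "f \<in> {f. \<forall>t. vanishes (Suc m) p (hcomp t f)}"
    using Suc.prems[unfolded ipow_Suc]
  proof (rule ideal_prod_closed)
    fix a b assume ab: "a \<in> ipow n (point_ideal n P) m" "b \<in> point_ideal n P"
    have "vanishes (m + 1) p (hcomp t (a * b))" for t
      unfolding hcomp_mult by (intro vanishes_sum vanishes_mult Suc.IH[OF ab(1)] 1[OF ab(2)])
    then show "a * b \<in> {f. \<forall>t. vanishes (Suc m) p (hcomp t f)}" by simp
  qed (auto simp: hcomp_add vanishes_add)
  then show ?case by blast
qed simp

section \<open>Taylor coefficients\<close>

lemma lookup_monomial_mult:
  fixes f :: "('i, 'k::comm_ring_1) mpoly"
  shows "lookup (single (single a j) c * f) \<beta> =
    (if j \<le> lookup \<beta> a then c * lookup f (\<beta> - single a j) else 0)"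
proof (cases "j \<le> lookup \<beta> a")
  case True
  then have "single a j + (\<beta> - single a j) = \<beta>"
    by (intro poly_mapping_eqI) (auto simp: lookup_add lookup_minus lookup_single when_def)
  then show ?thesis using lookup_single_mult[of "single a j" c f "\<beta> - single a j"] True by simp
next
  case False
  have "\<beta> \<notin> keys (single (single a j) c * f)"
  proof
    assume "\<beta> \<in> keys (single (single a j) c * f)"
    then obtain y where "\<beta> = single a j + y"
      using keys_mult[of "single (single a j) c" f] by (auto split: if_splits)
    then show False using False by (simp add: lookup_add)
  qed
  then show ?thesis using False by (simp add: in_keys_iff)
qed

lemma lookup_prod_shifted:
  fixes p :: "'i \<Rightarrow> 'k::comm_ring_1" and k :: "'i \<Rightarrow> nat"
  assumes "finite A"
  shows "lookup (\<Prod>i\<in>A. (single 0 (p i) + mvar i) ^ k i) \<beta> =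
    (if keys \<beta> \<subseteq> A then \<Prod>i\<in>A. of_nat (k i choose lookup \<beta> i) * p i ^ (k i - lookup \<beta> i) else 0)"
  using assms
proof (induction A arbitrary: \<beta>)
  case empty
  then show ?case by (auto simp: lookup_one when_def)
next
  case (insert a A)
  let ?F = "\<Prod>i\<in>A. (single 0 (p i) + mvar i) ^ k i"
  let ?b = "lookup \<beta> a" and ?c = "\<lambda>j. of_nat (k a choose j) * p a ^ (k a - j)"
  have "(single 0 (p a) + mvar a) ^ k a = (\<Sum>j\<le>k a. single (single a j) (?c j))"
    unfolding add.commute[of "single 0 (p a)"] binomial_ring
    by (intro sum.cong) (auto simp: const_power mvar_power mult_single single_of_nat[symmetric] simp del: single_of_nat)
  then have "lookup (\<Prod>i\<in>insert a A. (single 0 (p i) + mvar i) ^ k i) \<beta> =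
      (\<Sum>j\<le>k a. lookup (single (single a j) (?c j) * ?F) \<beta>)"
    using insert.hyps by (simp add: sum_distrib_right lookup_sum)
  also have "\<dots> = (\<Sum>j\<le>k a. if j = ?b then ?c j * lookup ?F (\<beta> - single a ?b) else 0)"
  proof (intro sum.cong refl)
    fix j
    have "a \<in> keys (\<beta> - single a j)" if "j < ?b" using that by (simp add: in_keys_iff lookup_minus)
    then have "lookup ?F (\<beta> - single a j) = 0" if "j < ?b" using that insert by auto
    then show "lookup (single (single a j) (?c j) * ?F) \<beta> =
        (if j = ?b then ?c j * lookup ?F (\<beta> - single a ?b) else 0)"
      by (auto simp: lookup_monomial_mult)
  qed
  also have "\<dots> = ?c ?b * lookup ?F (\<beta> - single a ?b)"
    by (auto simp: binomial_eq_0)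
  also have "lookup ?F (\<beta> - single a ?b) =
      (if keys \<beta> \<subseteq> insert a A then \<Prod>i\<in>A. of_nat (k i choose lookup \<beta> i) * p i ^ (k i - lookup \<beta> i) else 0)"
  proof -
    have "keys (\<beta> - single a ?b) = keys \<beta> - {a}"
      by (auto simp: in_keys_iff lookup_minus lookup_single when_def split: if_splits)
    moreover have "lookup (\<beta> - single a ?b) i = lookup \<beta> i" if "i \<in> A" for i
      using that insert.hyps by (auto simp: lookup_minus lookup_single when_def)
    ultimately show ?thesis unfolding insert.IH by (auto intro!: prod.cong)
  qed
  finally show ?case using insert.hyps by auto
qed

text \<open>The Hasse derivative of order \<beta> of the monomial \<open>e\<close> at
  \<open>p\<close>, that is, the coefficient of \<beta> in (p + x)^e. As an integer times a monomial
  in \<open>p\<close> it can serve as a matrix entry in \<open>generic_no_forms\<close>.\<close>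

definition hasse :: "('i \<Rightarrow> 'k::comm_ring_1) \<Rightarrow> ('i \<Rightarrow>\<^sub>0 nat) \<Rightarrow> ('i \<Rightarrow>\<^sub>0 nat) \<Rightarrow> 'k" where
  "hasse p \<beta> e = (if \<forall>i. lookup \<beta> i \<le> lookup e i
     then of_nat (\<Prod>i\<in>keys e. lookup e i choose lookup \<beta> i) * mon_val p (e - \<beta>) else 0)"

lemma lookup_shift: "lookup (shift p f) \<beta> = (\<Sum>e\<in>keys f. lookup f e * hasse p \<beta> e)"
proof -
  have h: "lookup (mon_val (\<lambda>i. single 0 (p i) + mvar i) e) \<beta> = hasse p \<beta> e" for e
  proof (cases "\<forall>i. lookup \<beta> i \<le> lookup e i")
    case True
    have "keys \<beta> \<subseteq> keys e"
    proof
      fix i assume "i \<in> keys \<beta>"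
      then show "i \<in> keys e" using True[rule_format, of i] by (simp add: in_keys_iff)
    qed
    moreover have "mon_val p (e - \<beta>) = (\<Prod>i\<in>keys e. p i ^ (lookup e i - lookup \<beta> i))"
      by (subst mon_val_superset[of "keys e"]) (auto simp: in_keys_iff lookup_minus)
    ultimately show ?thesis
      using True by (simp add: mon_val_def[of "\<lambda>i. single 0 (p i) + mvar i"] lookup_prod_shifted hasse_def prod.distrib)
  next
    case False
    then obtain i where i: "lookup e i < lookup \<beta> i" by (auto simp: not_le)
    have "(\<Prod>i\<in>keys e. of_nat (lookup e i choose lookup \<beta> i) * p i ^ (lookup e i - lookup \<beta> i)) = 0"
      if "keys \<beta> \<subseteq> keys e"
    proof -
      have "i \<in> keys \<beta>" using i by (simp add: in_keys_iff)
      then have "i \<in> keys e" using that by blast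
      then show ?thesis using i by (intro prod_zero) (auto simp: binomial_eq_0 intro!: bexI[of _ i])
    qed
    then show ?thesis using False by (auto simp: mon_val_def lookup_prod_shifted hasse_def)
  qed
  show ?thesis
    by (simp add: shift_def subst_def ins_def lookup_sum lookup_const_mult h)
qed

subsection \<open>Generic tuples of points\<close>

text \<open>In contrast to \<open>is_multiform\<close> the multidegree is a parameter, which allows
  differences within one multidegree and keeps track of products.\<close>

definition mform :: "nat \<Rightarrow> nat \<Rightarrow> (nat \<Rightarrow> nat) \<Rightarrow> (nat \<times> nat, 'k::comm_ring_1) mpoly \<Rightarrow> bool" where
  "mform n s d f \<longleftrightarrow> (\<forall>e\<in>keys f. keys e \<subseteq> {..<s} \<times> {..n} \<and> (\<forall>i<s. (\<Sum>j\<le>n. lookup e (i, j)) = d i))"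

lemma mform_multiform: "mform n s d f \<Longrightarrow> is_multiform n s f"
  by (auto simp: mform_def is_multiform_def)

lemma mform_0 [simp]: "mform n s d 0"
  by (simp add: mform_def)

lemma mform_diff: "mform n s d f \<Longrightarrow> mform n s d g \<Longrightarrow> mform n s d (f - g)"
  unfolding mform_def using keys_diff[of f g] by blast

lemma mform_mult:
  assumes "mform n s d f" "mform n s d' g"
  shows "mform n s (\<lambda>i. d i + d' i) (f * g)"
  unfolding mform_def
proof
  fix e assume "e \<in> keys (f * g)"
  then obtain a b where "a \<in> keys f" "b \<in> keys g" "e = a + b" using keys_mult[of f g] by blast
  then show "keys e \<subseteq> {..<s} \<times> {..n} \<and> (\<forall>i<s. (\<Sum>j\<le>n. lookup e (i, j)) = d i + d' i)"
    using assms by (auto simp: mform_def keys_exponent_add lookup_add sum.distrib)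
qed

lemma mform_cong: "mform n s d f \<Longrightarrow> (\<And>i. i < s \<Longrightarrow> d i = d' i) \<Longrightarrow> mform n s d' f"
  by (simp add: mform_def)

abbreviation meval :: "(nat \<times> nat, 'k::comm_ring_1) mpoly \<Rightarrow> (nat \<Rightarrow> nat \<Rightarrow> 'k) \<Rightarrow> 'k" where
  "meval f v \<equiv> mpoly_eval f (\<lambda>(i, j). v i j)"

text \<open>Gaussian elimination on one column at a time produces the nonvanishing multiform directly,
  in place of a maximal minor of the matrix.\<close>

lemma generic_elimination:
  fixes A :: "'r \<Rightarrow> 'c \<Rightarrow> (nat \<times> nat, 'k::field) mpoly"
  assumes "finite C" "finite R"
    and "\<And>\<rho> c. \<rho> \<in> R \<Longrightarrow> c \<in> C \<Longrightarrow> mform n s (\<lambda>i. a \<rho> i + b c i) (A \<rho> c)"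
    and "\<And>w. (\<And>\<rho>. \<rho> \<in> R \<Longrightarrow> (\<Sum>c\<in>C. meval (A \<rho> c) v0 * w c) = 0) \<Longrightarrow> \<forall>c\<in>C. w c = 0"
  shows "\<exists>d G. mform n s d G \<and> meval G v0 \<noteq> 0 \<and>
    (\<forall>v. meval G v \<noteq> 0 \<longrightarrow> (\<forall>y. \<exists>l. \<forall>c\<in>C. (\<Sum>\<rho>\<in>R. l \<rho> * meval (A \<rho> c) v) = y c))"
  using assms(1,3,4)
proof (induction C arbitrary: A a)
  case empty
  have "mform n s (\<lambda>_. 0) 1" "meval 1 v0 \<noteq> 0"
    by (simp_all add: mform_def eval_simps)
  then show ?case by blast
next
  case (insert c0 C)
  have "\<exists>\<rho>\<in>R. meval (A \<rho> c0) v0 \<noteq> 0"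
  proof (rule ccontr)
    assume n: "\<not> ?thesis"
    have "\<forall>c\<in>insert c0 C. (if c = c0 then 1 else 0 :: 'k) = 0"
    proof (rule insert.prems(2))
      fix \<rho> assume "\<rho> \<in> R"
      have "(\<Sum>c\<in>insert c0 C. meval (A \<rho> c) v0 * (if c = c0 then 1 else 0)) = meval (A \<rho> c0) v0"
        using insert.hyps by (simp add: sum.neutral)
      then show "(\<Sum>c\<in>insert c0 C. meval (A \<rho> c) v0 * (if c = c0 then 1 else 0)) = 0"
        using n \<open>\<rho> \<in> R\<close> by simp
    qed
    then show False by simp
  qed
  then obtain \<rho>0 where \<rho>0: "\<rho>0 \<in> R" "meval (A \<rho>0 c0) v0 \<noteq> 0" by blast
  \<comment> \<open>Fraction-free elimination: the 2 by 2 minors with pivot row \<rho>0 and pivot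
    column \<open>c0\<close>. Because entry degrees are a row degree plus a column degree, both
    products in a minor have the same multidegree, and the pivot's share is absorbed into the row
    degrees.\<close>
  define B where "B \<sigma> c = A \<rho>0 c0 * A \<sigma> c - A \<sigma> c0 * A \<rho>0 c" for \<sigma> c
  have "\<exists>d G. mform n s d G \<and> meval G v0 \<noteq> 0 \<and>
    (\<forall>v. meval G v \<noteq> 0 \<longrightarrow> (\<forall>y. \<exists>l. \<forall>c\<in>C. (\<Sum>\<rho>\<in>R. l \<rho> * meval (B \<rho> c) v) = y c))"
  proof (rule insert.IH[where a = "\<lambda>\<sigma> i. a \<sigma> i + a \<rho>0 i + b c0 i"])
    fix \<sigma> c assume \<sigma>: "\<sigma> \<in> R" and c: "c \<in> C"
    show "mform n s (\<lambda>i. a \<sigma> i + a \<rho>0 i + b c0 i + b c i) (B \<sigma> c)"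
      unfolding B_def
    proof (rule mform_diff)
      show "mform n s (\<lambda>i. a \<sigma> i + a \<rho>0 i + b c0 i + b c i) (A \<rho>0 c0 * A \<sigma> c)"
        by (rule mform_cong[OF mform_mult[OF insert.prems(1) insert.prems(1)]]) (use \<sigma> c \<rho>0 in auto)
      show "mform n s (\<lambda>i. a \<sigma> i + a \<rho>0 i + b c0 i + b c i) (A \<sigma> c0 * A \<rho>0 c)"
        by (rule mform_cong[OF mform_mult[OF insert.prems(1) insert.prems(1)]]) (use \<sigma> c \<rho>0 in auto)
    qed
  next
    fix w assume w: "\<And>\<sigma>. \<sigma> \<in> R \<Longrightarrow> (\<Sum>c\<in>C. meval (B \<sigma> c) v0 * w c) = 0"
    let ?p = "meval (A \<rho>0 c0) v0"
    \<comment> \<open>A relation between the columns of \<open>B\<close> extends to one between the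
      columns of \<open>A\<close> by solving the pivot row for the entry at
      \<open>c0\<close>.\<close>
    define w' where "w' c = (if c = c0 then - (\<Sum>c\<in>C. meval (A \<rho>0 c) v0 * w c) / ?p else w c)" for c
    have "\<forall>c\<in>insert c0 C. w' c = 0"
    proof (rule insert.prems(2))
      fix \<sigma> assume \<sigma>: "\<sigma> \<in> R"
      let ?S = "\<Sum>c\<in>C. meval (A \<rho>0 c) v0 * w c" and ?T = "\<Sum>c\<in>C. meval (A \<sigma> c) v0 * w c"
      have "0 = ?p * ?T - meval (A \<sigma> c0) v0 * ?S"
        using w[OF \<sigma>] by (simp add: B_def eval_simps algebra_simps sum_subtractf sum_distrib_left)
      moreover have "(\<Sum>c\<in>insert c0 C. meval (A \<sigma> c) v0 * w' c) = meval (A \<sigma> c0) v0 * (- ?S / ?p) + ?T"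
      proof -
        have "(\<Sum>c\<in>C. meval (A \<sigma> c) v0 * w' c) = ?T"
          using insert.hyps by (intro sum.cong) (auto simp: w'_def)
        then show ?thesis using insert.hyps by (simp add: w'_def)
      qed
      ultimately show "(\<Sum>c\<in>insert c0 C. meval (A \<sigma> c) v0 * w' c) = 0"
        using \<rho>0(2) by (simp add: field_simps)
    qed
    then show "\<forall>c\<in>C. w c = 0" using insert.hyps by (auto simp: w'_def split: if_splits)
  qed
  then obtain d G where G: "mform n s d G" "meval G v0 \<noteq> 0"
    and span: "\<And>v y. meval G v \<noteq> 0 \<Longrightarrow> \<exists>l. \<forall>c\<in>C. (\<Sum>\<rho>\<in>R. l \<rho> * meval (B \<rho> c) v) = y c"
    by blast
  show ?case
  proof (rule exI[of _ "\<lambda>i. (a \<rho>0 i + b c0 i) + d i"], rule exI[of _ "A \<rho>0 c0 * G"], intro conjI allI impI)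
    show "mform n s (\<lambda>i. (a \<rho>0 i + b c0 i) + d i) (A \<rho>0 c0 * G)"
      by (intro mform_mult G insert.prems(1) \<rho>0) simp
    show "meval (A \<rho>0 c0 * G) v0 \<noteq> 0" using \<rho>0 G by (simp add: eval_simps)
  next
    fix v y assume "meval (A \<rho>0 c0 * G) v \<noteq> 0"
    then have p: "meval (A \<rho>0 c0) v \<noteq> 0" and Gv: "meval G v \<noteq> 0" by (simp_all add: eval_simps)
    let ?p = "meval (A \<rho>0 c0) v"
    \<comment> \<open>The pivot row is reserved for reaching \<open>y c0\<close>; the rows of
      \<open>B\<close> are 0 in column \<open>c0\<close> and supply what remains in the
      others.\<close>
    define y' where "y' c = y c - y c0 / ?p * meval (A \<rho>0 c) v" for c
    obtain l where l: "\<forall>c\<in>C. (\<Sum>\<rho>\<in>R. l \<rho> * meval (B \<rho> c) v) = y' c" using span[OF Gv] by blast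
    define t where "t = y c0 / ?p - (\<Sum>\<sigma>\<in>R. l \<sigma> * meval (A \<sigma> c0) v)"
    define l' where "l' \<rho> = ?p * l \<rho> + (if \<rho> = \<rho>0 then t else 0)" for \<rho>
    have comb: "(\<Sum>\<rho>\<in>R. l' \<rho> * meval (A \<rho> c) v) =
        (\<Sum>\<rho>\<in>R. l \<rho> * meval (B \<rho> c) v) + y c0 / ?p * meval (A \<rho>0 c) v" for c
    proof -
      have "(\<Sum>\<rho>\<in>R. l' \<rho> * meval (A \<rho> c) v) =
          (\<Sum>\<rho>\<in>R. ?p * l \<rho> * meval (A \<rho> c) v) + (\<Sum>\<rho>\<in>R. if \<rho> = \<rho>0 then t * meval (A \<rho>0 c) v else 0)"
        unfolding sum.distrib[symmetric] by (intro sum.cong) (auto simp: l'_def algebra_simps)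
      also have "(\<Sum>\<rho>\<in>R. if \<rho> = \<rho>0 then t * meval (A \<rho>0 c) v else 0) = t * meval (A \<rho>0 c) v"
        using \<rho>0(1) assms(2) by simp
      also have "(\<Sum>\<rho>\<in>R. l \<rho> * meval (B \<rho> c) v) = (\<Sum>\<rho>\<in>R. ?p * l \<rho> * meval (A \<rho> c) v)
          - (\<Sum>\<sigma>\<in>R. l \<sigma> * meval (A \<sigma> c0) v) * meval (A \<rho>0 c) v"
        unfolding sum_distrib_right sum_subtractf[symmetric]
        by (intro sum.cong) (auto simp: B_def eval_simps algebra_simps)
      then have "(\<Sum>\<rho>\<in>R. ?p * l \<rho> * meval (A \<rho> c) v) = (\<Sum>\<rho>\<in>R. l \<rho> * meval (B \<rho> c) v)
          + (\<Sum>\<sigma>\<in>R. l \<sigma> * meval (A \<sigma> c0) v) * meval (A \<rho>0 c) v" by simp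
      finally show ?thesis by (simp add: t_def algebra_simps)
    qed
    show "\<exists>l. \<forall>c\<in>insert c0 C. (\<Sum>\<rho>\<in>R. l \<rho> * meval (A \<rho> c) v) = y c"
    proof (intro exI ballI)
      fix c assume "c \<in> insert c0 C"
      moreover have "(\<Sum>\<rho>\<in>R. l \<rho> * meval (B \<rho> c0) v) = 0"
        by (intro sum.neutral) (simp add: B_def eval_simps)
      ultimately show "(\<Sum>\<rho>\<in>R. l' \<rho> * meval (A \<rho> c) v) = y c"
        using l p by (auto simp: comb y'_def)
    qed
  qed
qed

text \<open>Stated for tuples of vectors, where a single multiform can be evaluated;
  \<open>generic_closed\<close> transfers it to tuples of points.\<close>

definition generic :: "nat \<Rightarrow> nat \<Rightarrow> ((nat \<Rightarrow> nat \<Rightarrow> 'k::field) \<Rightarrow> bool) \<Rightarrow> bool" where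
  "generic n s Q \<longleftrightarrow> (\<exists>d G. mform n s d G \<and> (\<exists>v. meval G v \<noteq> 0) \<and> (\<forall>v. meval G v \<noteq> 0 \<longrightarrow> Q v))"

lemma generic_mono: "generic n s Q \<Longrightarrow> (\<And>v. Q v \<Longrightarrow> Q' v) \<Longrightarrow> generic n s Q'"
  unfolding generic_def by blast

text \<open>On the line joining a tuple where \<open>G\<close> is nonzero to one where
  \<open>G'\<close> is nonzero, both become nonzero univariate polynomials, and an infinite field
  contains an element that is a root of neither.\<close>

lemma generic_conj:
  fixes Q Q' :: "(nat \<Rightarrow> nat \<Rightarrow> 'k::field_char_0) \<Rightarrow> bool"
  assumes "generic n s Q" "generic n s Q'"
  shows "generic n s (\<lambda>v. Q v \<and> Q' v)"
proof -
  obtain d G p where G: "mform n s d G" "meval G p \<noteq> 0" "\<And>v. meval G v \<noteq> 0 \<Longrightarrow> Q v"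
    using assms(1) unfolding generic_def by blast
  obtain d' G' p' where G': "mform n s d' G'" "meval G' p' \<noteq> 0" "\<And>v. meval G' v \<noteq> 0 \<Longrightarrow> Q' v"
    using assms(2) unfolding generic_def by blast
  define line where "line = (\<lambda>(i, j). [:p i j, p' i j - p i j:])"
  define F where "F = ins (\<lambda>c. [:c:]) line"
  define q where "q t i j = p i j + t * (p' i j - p i j)" for t i j
  have F: "poly (F f) t = meval f (q t)" for f t
  proof (rule hom_eqI[of "\<lambda>f. poly (F f) t"])
    show "is_hom (\<lambda>f. poly (F f) t)"
      unfolding F_def by (rule is_hom_compose[OF _ is_hom_ins[OF is_hom_pCons]]) (simp add: is_hom_def)
  qed (auto simp: F_def is_hom_pCons is_hom_eval line_def q_def algebra_simps split: prod.splits)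
  have "q 0 = p" "q 1 = p'" by (simp_all add: q_def fun_eq_iff)
  then have "F G \<noteq> 0" "F G' \<noteq> 0" using F[of G 0] F[of G' 1] G G' by auto
  then have "finite {t. poly (F G * F G') t = 0}" by (intro poly_roots_finite) simp
  then obtain t where "poly (F G * F G') t \<noteq> 0"
    using infinite_UNIV_char_0[where 'a='k] by (metis (mono_tags, lifting) UNIV_eq_I mem_Collect_eq)
  then have "meval (G * G') (q t) \<noteq> 0" by (simp add: F eval_simps)
  moreover have "Q v \<and> Q' v" if "meval (G * G') v \<noteq> 0" for v
    using that G(3) G'(3) by (simp add: eval_simps)
  ultimately show ?thesis
    unfolding generic_def using mform_mult[OF G(1) G'(1)] by blast
qed

text \<open>For the closed set to be proper, a tuple with \<open>G\<close> nonzero must consist of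
  nonzero vectors; the assumption on the x_0-coordinates guarantees this.\<close>

lemma generic_closed:
  fixes Q :: "(nat \<Rightarrow> nat \<Rightarrow> 'k::field) \<Rightarrow> bool"
  assumes "generic n s Q" and Q: "\<And>v i. Q v \<Longrightarrow> i < s \<Longrightarrow> v i 0 \<noteq> 0"
  shows "\<exists>Z. zariski_closed n s Z \<and> Z \<noteq> proj_tuples n s \<and> Z \<subseteq> proj_tuples n s \<and>
    (\<forall>P\<in>proj_tuples n s - Z. \<exists>v. (\<forall>i<s. v i \<in> P i) \<and> Q v)"
proof -
  obtain d G p where G: "mform n s d G" "meval G p \<noteq> 0" "\<And>v. meval G v \<noteq> 0 \<Longrightarrow> Q v"
    using assms(1) unfolding generic_def by blast
  define Z where "Z = {P \<in> proj_tuples n s. multiform_vanishes s G P}"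
  have "zariski_closed n s Z"
    unfolding zariski_closed_def Z_def using mform_multiform[OF G(1)] by (intro exI[of _ "{G}"]) auto
  moreover have "\<exists>v. (\<forall>i<s. v i \<in> P i) \<and> Q v" if "P \<in> proj_tuples n s - Z" for P
    using that G(3) by (auto simp: Z_def multiform_vanishes_def)
  moreover have "Z \<noteq> proj_tuples n s"
  proof -
    \<comment> \<open>\<open>G\<close> involves only coordinates up to \<open>n\<close>, so clearing
      the others keeps its value and gives vectors of the shape that \<open>nonzero_vectors\<close>
      demands.\<close>
    define v where "v i j = (if j \<le> n then p i j else 0)" for i j
    have keys: "keys e \<subseteq> {..<s} \<times> {..n}" if "e \<in> keys G" for e
      using G(1) that by (simp add: mform_def)
    have "meval G v = meval G p"
      unfolding mpoly_eval_eq_ins ins_def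
      by (intro sum.cong refl arg_cong2[of _ _ _ _ "(*)"] mon_val_cong)
         (use keys in \<open>fastforce simp: v_def\<close>)
    then have v: "meval G v \<noteq> 0" using G by simp
    then have nz: "v i \<in> nonzero_vectors n" if "i < s" for i
      using Q[OF G(3)[OF v] that] by (auto simp: nonzero_vectors_def v_def)
    define P where "P = (\<lambda>i\<in>{..<s}. scaling_rel n `` {v i})"
    have "P \<in> proj_tuples n s"
      unfolding proj_tuples_def P_def proj_space_def using nz by (auto intro: quotientI)
    moreover have "v i \<in> P i" if "i < s" for i
      using nz[OF that] that by (auto simp: P_def scaling_rel_def intro: exI[of _ 1])
    ultimately show ?thesis using v by (auto simp: Z_def multiform_vanishes_def)
  qed
  ultimately show ?thesis unfolding Z_def by blast
qed

lemma zariski_open_compl: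
  "zariski_closed n s Z \<Longrightarrow> Z \<subseteq> proj_tuples n s \<Longrightarrow> zariski_open n s (proj_tuples n s - Z)"
  by (simp add: zariski_open_def double_diff)

section \<open>Open conditions from matrices of values and derivatives\<close>

definition embed :: "nat \<Rightarrow> (nat \<Rightarrow>\<^sub>0 nat) \<Rightarrow> (nat \<times> nat \<Rightarrow>\<^sub>0 nat)" where
  "embed i e = (\<Sum>j\<in>keys e. single (i, j) (lookup e j))"

lemma lookup_embed: "lookup (embed i e) (i', j) = (if i' = i then lookup e j else 0)"
proof -
  have "lookup (embed i e) (i', j) = (\<Sum>j'\<in>keys e. if j' = j then (if i' = i then lookup e j else 0) else 0)"
    unfolding embed_def lookup_sum by (intro sum.cong) (auto simp: lookup_single when_def)
  then show ?thesis by (auto simp: in_keys_iff)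
qed

lemma mon_val_embed: "mon_val (\<lambda>(i, j). v i j) (embed i e) = mon_val (v i) e"
proof -
  have m: "mon_val g (sum f A) = (\<Prod>a\<in>A. mon_val g (f a))" for g :: "nat \<times> nat \<Rightarrow> 'a" and f A
    by (induction A rule: infinite_finite_induct) (auto simp: mon_val_add)
  show ?thesis unfolding embed_def m by (simp add: mon_val_def[of "v i"])
qed

lemma mform_embed:
  assumes "i < s" "keys e \<subseteq> {..n}"
  shows "mform n s (\<lambda>i'. if i' = i then monom_degree e else 0) (single (embed i e) c)"
proof (cases "c = 0")
  case False
  have "keys (embed i e) \<subseteq> {..<s} \<times> {..n}"
  proof
    fix x assume "x \<in> keys (embed i e)"
    moreover obtain i' j where x: "x = (i', j)" by (cases x)
    ultimately have "i' = i" "j \<in> keys e" by (auto simp: in_keys_iff lookup_embed split: if_splits)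
    then show "x \<in> {..<s} \<times> {..n}" using assms x by auto
  qed
  moreover have "(\<Sum>j\<le>n. lookup (embed i e) (i', j)) = (if i' = i then monom_degree e else 0)" for i'
    using monom_degree_superset[of "{..n}" e] assms by (simp add: lookup_embed)
  ultimately show ?thesis using False by (simp add: mform_def)
qed simp

lemma generic_coord_nonzero: "generic n s (\<lambda>v :: nat \<Rightarrow> nat \<Rightarrow> 'k::field. \<forall>i<s. v i 0 \<noteq> 0)"
proof -
  define G :: "nat \<Rightarrow> (nat \<times> nat, 'k) mpoly" where "G t = (\<Prod>i<t. mvar (i, 0))" for t
  have "\<exists>d. mform n s d (G t)" if "t \<le> s" for t
    using that
  proof (induction t)
    case 0
    then show ?case by (auto simp: G_def mform_def)
  next
    case (Suc t)
    then obtain d where "mform n s d (G t)" by auto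
    moreover have "mform n s (\<lambda>i'. if i' = t then 1 else 0) (mvar (t, 0) :: (nat \<times> nat, 'k) mpoly)"
      using mform_embed[of t s "single 0 1" n "1 :: 'k"] Suc.prems by (simp add: embed_def mvar_def cong: if_cong)
    ultimately show ?case unfolding G_def lessThan_Suc using mform_mult by fastforce
  qed
  then obtain d where "mform n s d (G s)" by auto
  moreover have "meval (G s) v = (\<Prod>i<s. v i 0)" for v
    by (simp add: G_def eval_simps)
  ultimately show ?thesis
    unfolding generic_def by (intro exI[of _ d] exI[of _ "G s"]) (auto intro: exI[of _ "\<lambda>_ _. 1"])
qed

text \<open>Rows are the monomials of degree \<open>d\<close>, columns the points. Combining a
  relation between the columns at \<open>p\<close> with the coefficients of \<open>q i\<close>
  isolates its i-th entry, so the columns are independent there. Where \<open>G\<close> is nonzero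
  the rows span, that is, all prescribed values are attained by forms.\<close>

lemma generic_separators:
  fixes p :: "nat \<Rightarrow> nat \<Rightarrow> 'k::field" and q :: "nat \<Rightarrow> (nat, 'k) mpoly"
  assumes q: "\<And>i. i < s \<Longrightarrow> q i \<in> forms n d"
    and sep: "\<And>i j. i < s \<Longrightarrow> j < s \<Longrightarrow> mpoly_eval (q i) (p j) = 0 \<longleftrightarrow> i \<noteq> j"
  shows "generic n s (\<lambda>v :: nat \<Rightarrow> nat \<Rightarrow> 'k. \<exists>h. \<forall>i<s. h i \<in> forms n d \<and> (\<forall>j<s. mpoly_eval (h i) (v j) = (if i = j then 1 else 0)))"
proof -
  define A :: "(nat \<Rightarrow>\<^sub>0 nat) \<Rightarrow> nat \<Rightarrow> (nat \<times> nat, 'k) mpoly" where "A e i = single (embed i e) 1" for e i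
  have A: "meval (A e i) v = mon_val (v i) e" for e i and v :: "nat \<Rightarrow> nat \<Rightarrow> 'k"
    by (simp add: A_def mon_val_embed)
  have "\<exists>d' G. mform n s d' G \<and> meval G p \<noteq> 0 \<and>
    (\<forall>v. meval G v \<noteq> 0 \<longrightarrow> (\<forall>y. \<exists>l. \<forall>i\<in>{..<s}. (\<Sum>e\<in>expts n d. l e * meval (A e i) v) = y i))"
  proof (rule generic_elimination[where a = "\<lambda>_ _. 0" and b = "\<lambda>i i'. if i' = i then d else 0"])
    fix e i assume "e \<in> expts n d" "i \<in> {..<s}"
    then show "mform n s (\<lambda>i'. 0 + (if i' = i then d else 0)) (A e i)"
      using mform_embed[of i s e n 1] by (auto simp: A_def expts_def)
  next
    fix w assume w: "\<And>e. e \<in> expts n d \<Longrightarrow> (\<Sum>i<s. meval (A e i) p * w i) = 0"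
    have "w i = 0" if i: "i < s" for i
    proof -
      have "(\<Sum>e\<in>keys (q i). lookup (q i) e * (\<Sum>j<s. meval (A e j) p * w j)) = 0"
      proof (intro sum.neutral ballI)
        fix e assume "e \<in> keys (q i)"
        then have "e \<in> expts n d" using q[OF i] by (auto simp: forms_def)
        then show "lookup (q i) e * (\<Sum>j<s. meval (A e j) p * w j) = 0" by (simp add: w)
      qed
      then have "0 = (\<Sum>e\<in>keys (q i). lookup (q i) e * (\<Sum>j<s. meval (A e j) p * w j))" ..
      also have "\<dots> = (\<Sum>j<s. \<Sum>e\<in>keys (q i). lookup (q i) e * mon_val (p j) e * w j)"
        unfolding sum_distrib_left by (subst sum.swap) (simp add: A mult.assoc)
      also have "\<dots> = (\<Sum>j<s. mpoly_eval (q i) (p j) * w j)"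
        by (simp add: mpoly_eval_eq_ins ins_def sum_distrib_right)
      also have "\<dots> = (\<Sum>j<s. if j = i then mpoly_eval (q i) (p i) * w i else 0)"
        by (intro sum.cong) (use sep i in auto)
      also have "\<dots> = mpoly_eval (q i) (p i) * w i" using i by simp
      finally show ?thesis using sep i by auto
    qed
    then show "\<forall>i\<in>{..<s}. w i = 0" by simp
  qed simp_all
  then obtain d' G where G: "mform n s d' G" "meval G p \<noteq> 0"
    and span: "\<And>v y. meval G v \<noteq> 0 \<Longrightarrow> \<exists>l. \<forall>i\<in>{..<s}. (\<Sum>e\<in>expts n d. l e * meval (A e i) v) = y i"
    by blast
  show ?thesis
    unfolding generic_def
  proof (rule exI[of _ d'], rule exI[of _ G], intro conjI allI impI)
    show "\<exists>v. meval G v \<noteq> 0" using G(2) by blast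
    fix v assume v: "meval G v \<noteq> 0"
    have "\<exists>h. h \<in> forms n d \<and> (\<forall>j<s. mpoly_eval h (v j) = (if i = j then 1 else 0))" for i
    proof -
      obtain l where l: "\<forall>j\<in>{..<s}. (\<Sum>e\<in>expts n d. l e * meval (A e j) v) = (if i = j then 1 else 0)"
        using span[OF v, of "\<lambda>j. if i = j then 1 else 0"] by blast
      let ?h = "\<Sum>e\<in>expts n d. single e (l e)"
      have "mpoly_eval ?h (v j) = (\<Sum>e\<in>expts n d. l e * meval (A e j) v)" for j
        by (simp add: eval_simps A)
      then show ?thesis using l by (intro exI[of _ ?h]) (auto intro: forms_sum forms_single)
    qed
    then show "\<exists>h. \<forall>i<s. h i \<in> forms n d \<and> (\<forall>j<s. mpoly_eval (h i) (v j) = (if i = j then 1 else 0))"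
      by metis
  qed (fact G(1))
qed

text \<open>Rows are the Taylor conditions of order below \<open>k\<close> at the points, columns
  the monomials of degree \<open>d\<close>. The hypothesis is independence of the columns at
  \<open>p\<close>; where \<open>G\<close> is nonzero, each coefficient of a form is a combination
  of its Taylor conditions and vanishes with them.\<close>

lemma generic_no_forms:
  fixes p :: "nat \<Rightarrow> nat \<Rightarrow> 'k::field"
  assumes p: "\<And>f. f \<in> forms n d \<Longrightarrow> (\<And>i. i < s \<Longrightarrow> vanishes k (p i) f) \<Longrightarrow> f = 0"
  shows "generic n s (\<lambda>v :: nat \<Rightarrow> nat \<Rightarrow> 'k. \<forall>f\<in>forms n d. (\<forall>i<s. vanishes k (v i) f) \<longrightarrow> f = 0)"
proof -
  define A :: "nat \<times> (nat \<Rightarrow>\<^sub>0 nat) \<Rightarrow> (nat \<Rightarrow>\<^sub>0 nat) \<Rightarrow> (nat \<times> nat, 'k) mpoly" where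
    "A = (\<lambda>(i, \<beta>) e. if \<forall>j. lookup \<beta> j \<le> lookup e j
       then single (embed i (e - \<beta>)) (of_nat (\<Prod>j\<in>keys e. lookup e j choose lookup \<beta> j)) else 0)"
  have A: "meval (A (i, \<beta>) e) v = hasse (v i) \<beta> e" for i \<beta> e and v :: "nat \<Rightarrow> nat \<Rightarrow> 'k"
    by (simp add: A_def hasse_def mon_val_embed eval_simps)
  define R where "R = {..<s} \<times> (\<Union>b<k. expts n b)"
  have shift: "lookup (shift (v i) f) \<beta> = (\<Sum>e\<in>expts n d. meval (A (i, \<beta>) e) v * lookup f e)"
    if "f \<in> forms n d" for f i \<beta> and v :: "nat \<Rightarrow> nat \<Rightarrow> 'k"
    unfolding lookup_shift A
    by (rule sum.mono_neutral_cong_left) (use that in \<open>auto simp: forms_def in_keys_iff\<close>)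
  \<comment> \<open>Translation brings in no new variables, so the finite set \<open>R\<close>
    contains all conditions that can fail.\<close>
  have keys_shift: "keys \<beta> \<subseteq> {..n}" if "f \<in> forms n d" "\<beta> \<in> keys (shift q f)"
    for f :: "(nat, 'k) mpoly" and q \<beta>
  proof -
    have "(\<Sum>e\<in>keys f. lookup f e * hasse q \<beta> e) \<noteq> 0"
      using that(2) by (simp add: in_keys_iff lookup_shift)
    then obtain e where "e \<in> keys f" "lookup f e * hasse q \<beta> e \<noteq> 0"
      by (rule sum.not_neutral_contains_not_neutral)
    then have e: "keys e \<subseteq> {..n}" "\<forall>j. lookup \<beta> j \<le> lookup e j"
      using formsD(2)[OF that(1)] by (auto simp: hasse_def split: if_splits)
    show ?thesis
    proof
      fix j assume "j \<in> keys \<beta>"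
      then have "j \<in> keys e" using e(2)[rule_format, of j] by (simp add: in_keys_iff)
      then show "j \<in> {..n}" using e(1) by blast
    qed
  qed
  have vanishes: "vanishes k (v i) f" if f: "f \<in> forms n d" and i: "i < s"
    and z: "\<And>\<rho>. \<rho> \<in> R \<Longrightarrow> (\<Sum>e\<in>expts n d. meval (A \<rho> e) v * lookup f e) = 0"
    for f i and v :: "nat \<Rightarrow> nat \<Rightarrow> 'k"
    unfolding vanishes_def ord_ge_def
  proof (rule ballI, rule ccontr)
    fix \<beta> assume \<beta>: "\<beta> \<in> keys (shift (v i) f)" "\<not> k \<le> monom_degree \<beta>"
    then have "(i, \<beta>) \<in> R" using keys_shift[OF f \<beta>(1)] i by (auto simp: R_def expts_def)
    then show False using z shift[OF f] \<beta>(1) by (simp add: in_keys_iff)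
  qed
  have "\<exists>d' G. mform n s d' G \<and> meval G p \<noteq> 0 \<and>
    (\<forall>v. meval G v \<noteq> 0 \<longrightarrow> (\<forall>y. \<exists>l. \<forall>e\<in>expts n d. (\<Sum>\<rho>\<in>R. l \<rho> * meval (A \<rho> e) v) = y e))"
  proof (rule generic_elimination[where a = "\<lambda>(i, \<beta>) i'. if i' = i then d - monom_degree \<beta> else 0" and b = "\<lambda>_ _. 0"])
    show "finite R" unfolding R_def by simp
    fix \<rho> e assume \<rho>: "\<rho> \<in> R" and e: "e \<in> expts n d"
    obtain i \<beta> where i: "\<rho> = (i, \<beta>)" "i < s" using \<rho> by (auto simp: R_def)
    show "mform n s (\<lambda>i'. (case \<rho> of (i, \<beta>) \<Rightarrow> \<lambda>i'. if i' = i then d - monom_degree \<beta> else 0) i' + 0) (A \<rho> e)"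
    proof (cases "\<forall>j. lookup \<beta> j \<le> lookup e j")
      case True
      have eq: "e = \<beta> + (e - \<beta>)"
        by (rule poly_mapping_eqI) (use True in \<open>simp add: lookup_add lookup_minus\<close>)
      have "d - monom_degree \<beta> = monom_degree (e - \<beta>)"
        using e eq monom_degree_add[of \<beta> "e - \<beta>"] by (simp add: expts_def)
      moreover have "keys (e - \<beta>) \<subseteq> {..n}"
        using e eq keys_exponent_add[of \<beta> "e - \<beta>"] by (auto simp: expts_def)
      ultimately show ?thesis
        using True mform_embed[OF i(2), of "e - \<beta>" n "of_nat (\<Prod>j\<in>keys e. lookup e j choose lookup \<beta> j)"]
        by (simp add: A_def i cong: if_cong)
    qed (auto simp: A_def i)
  next
    fix w assume w: "\<And>\<rho>. \<rho> \<in> R \<Longrightarrow> (\<Sum>e\<in>expts n d. meval (A \<rho> e) p * w e) = 0"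
    let ?f = "\<Sum>e\<in>expts n d. single e (w e)"
    have lf: "lookup ?f e = w e" if "e \<in> expts n d" for e using that by (simp add: lookup_sum_single)
    have f: "?f \<in> forms n d" by (intro forms_sum forms_single)
    have "?f = 0"
    proof (rule p[OF f], rule vanishes[OF f])
      fix \<rho> assume "\<rho> \<in> R"
      then show "(\<Sum>e\<in>expts n d. meval (A \<rho> e) p * lookup ?f e) = 0" using w lf by simp
    qed
    then show "\<forall>e\<in>expts n d. w e = 0" using lf by simp
  qed simp
  then obtain d' G where G: "mform n s d' G" "meval G p \<noteq> 0"
    and span: "\<And>v y. meval G v \<noteq> 0 \<Longrightarrow> \<exists>l. \<forall>e\<in>expts n d. (\<Sum>\<rho>\<in>R. l \<rho> * meval (A \<rho> e) v) = y e"
    by blast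
  show ?thesis
    unfolding generic_def
  proof (rule exI[of _ d'], rule exI[of _ G], intro conjI allI impI ballI)
    show "\<exists>v. meval G v \<noteq> 0" using G(2) by blast
    fix v f assume v: "meval G v \<noteq> 0" and f: "f \<in> forms n d" and van: "\<forall>i<s. vanishes k (v i) f"
    have z: "(\<Sum>e\<in>expts n d. meval (A \<rho> e) v * lookup f e) = 0" if "\<rho> \<in> R" for \<rho>
    proof -
      obtain i \<beta> where i: "\<rho> = (i, \<beta>)" "i < s" "monom_degree \<beta> < k" using \<open>\<rho> \<in> R\<close> by (auto simp: R_def expts_def)
      then have "lookup (shift (v i) f) \<beta> = 0"
        using van by (metis in_keys_iff not_le ord_ge_def vanishes_def)
      then show ?thesis using shift[OF f] i by simp
    qed
    have "lookup f e0 = 0" for e0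
    proof (cases "e0 \<in> expts n d")
      case True
      obtain l where l: "\<forall>e\<in>expts n d. (\<Sum>\<rho>\<in>R. l \<rho> * meval (A \<rho> e) v) = (if e = e0 then 1 else 0)"
        using span[OF v, of "\<lambda>e. if e = e0 then 1 else 0"] by blast
      have "lookup f e0 = (\<Sum>e\<in>expts n d. (if e = e0 then lookup f e0 else 0))" using True by simp
      also have "\<dots> = (\<Sum>e\<in>expts n d. (\<Sum>\<rho>\<in>R. l \<rho> * meval (A \<rho> e) v) * lookup f e)"
        by (intro sum.cong) (use l in auto)
      also have "\<dots> = (\<Sum>\<rho>\<in>R. l \<rho> * (\<Sum>e\<in>expts n d. meval (A \<rho> e) v * lookup f e))"
        unfolding sum_distrib_left sum_distrib_right by (subst sum.swap) (simp add: mult.assoc)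
      also have "\<dots> = 0" by (intro sum.neutral) (simp add: z)
      finally show ?thesis .
    next
      case False
      then show ?thesis using f by (auto simp: forms_def in_keys_iff)
    qed
    then show "f = 0" by (intro poly_mapping_eqI) simp
  qed (fact G(1))
qed

subsection \<open>Special configurations of points\<close>

lemma forms_subst:
  assumes "f \<in> forms n d" "\<And>i. i \<le> n \<Longrightarrow> g i \<in> forms n' 1"
  shows "subst g f \<in> forms n' d"
  unfolding subst_def ins_def
proof (intro forms_sum forms_const_mult)
  fix e assume e: "e \<in> keys f"
  have "mon_val g e \<in> forms n' (\<Sum>i\<in>keys e. lookup e i * 1)"
    unfolding mon_val_def
    by (intro forms_prod forms_power assms) (use formsD(2)[OF assms(1) e] in auto)
  then show "mon_val g e \<in> forms n' d"
    using formsD(1)[OF assms(1) e] by (simp add: monom_degree_def)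
qed

text \<open>In effect \<open>c\<close> is a lower bound for the Waldschmidt constant of the points
  in \<open>C\<close>. The linear form \<open>l\<close> acts as hyperplane at infinity when copies
  of \<open>C\<close> are placed in one dimension more.\<close>

definition rigid :: "nat \<Rightarrow> (nat, 'k::field_char_0) mpoly \<Rightarrow> (nat \<Rightarrow> 'k) set \<Rightarrow> real \<Rightarrow> bool" where
  "rigid n l C c \<longleftrightarrow> finite C \<and> l \<in> forms n 1 \<and> (\<forall>p\<in>C. mpoly_eval l p \<noteq> 0) \<and>
     (\<forall>m d f. f \<in> forms n d \<longrightarrow> f \<noteq> 0 \<longrightarrow> (\<forall>p\<in>C. vanishes m p f) \<longrightarrow> c * real m \<le> real d)"

lemma rigidD: "rigid n l C c \<Longrightarrow> f \<in> forms n d \<Longrightarrow> f \<noteq> 0 \<Longrightarrow> (\<And>p. p \<in> C \<Longrightarrow> vanishes m p f) \<Longrightarrow> c * real m \<le> real d"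
  by (auto simp: rigid_def)

definition unit_vec :: "nat \<Rightarrow> nat \<Rightarrow> 'k::field_char_0" where
  "unit_vec j i = (if i = j then 1 else 0)"

text \<open>The start of all grids. A nonzero form in one variable is nonzero at the point, so m = 0
  and any \<open>c\<close> is allowed.\<close>

lemma rigid_point: "rigid 0 (mvar 0) {unit_vec 0} c"
  unfolding rigid_def
proof (intro conjI allI impI)
  fix m d and f :: "(nat, 'a) mpoly"
  assume f: "f \<in> forms 0 d" "f \<noteq> 0" and van: "\<forall>p\<in>{unit_vec 0}. vanishes m p f"
  have eq: "e = single 0 d" if "e \<in> expts 0 d" for e
  proof (rule poly_mapping_eqI)
    fix i
    have e: "keys e \<subseteq> {0}" "monom_degree e = d" using that by (auto simp: expts_def)
    then have "d = lookup e 0" using monom_degree_superset[of "{0}" e] by simp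
    moreover have "lookup e i = 0" if "i \<noteq> 0" using that e(1) by (auto simp: in_keys_iff subset_iff)
    ultimately show "lookup e i = lookup (single 0 d) i" by (auto simp: lookup_single when_def)
  qed
  have keys: "keys f \<subseteq> {single 0 d}" using f(1) eq by (auto simp: forms_def)
  obtain e where "e \<in> keys f" using ex_key[OF f(2)] by blast
  then have l: "lookup f (single 0 d) \<noteq> 0" using keys by (auto simp: in_keys_iff)
  have "mpoly_eval f (unit_vec 0) = lookup f (single 0 d)"
    unfolding mpoly_eval_eq_ins
    by (subst ins_superset[OF is_hom_id _ keys]) (auto simp: unit_vec_def)
  then have "\<not> vanishes 1 (unit_vec 0) f" using l by (simp add: vanishes_1_iff[unfolded One_nat_def])
  then have "m = 0" using van vanishes_mono[of m "unit_vec 0" f 1] by (cases m) auto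
  then show "c * real m \<le> real d" by simp
qed (auto simp: unit_vec_def forms_mvar[unfolded One_nat_def])

section \<open>Restriction to hyperplanes, and grids\<close>

abbreviation set_last :: "nat \<Rightarrow> (nat, 'k::comm_ring_1) mpoly \<Rightarrow> (nat, 'k) mpoly \<Rightarrow> (nat, 'k) mpoly" where
  "set_last n a \<equiv> subst (\<lambda>i. if i = Suc n then a else mvar i)"

lemma diff_set_last:
  assumes a: "a \<in> forms n 1" and f: "f \<in> forms (Suc n) (Suc d)"
  shows "\<exists>g\<in>forms (Suc n) d. f - set_last n a f = (mvar (Suc n) - a) * g"
proof -
  let ?x = "mvar (Suc n) :: (nat, 'a) mpoly"
  have x: "?x \<in> forms (Suc n) 1" by (rule forms_mvar) simp
  have a': "a \<in> forms (Suc n) 1" by (rule forms_mono[OF _ a]) simp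
  have "\<exists>g\<in>forms (Suc n) d. single e c - set_last n a (single e c) = (?x - a) * g"
    if e: "e \<in> expts (Suc n) (Suc d)" for e c
  proof -
    define k where "k = lookup e (Suc n)"
    define e' where "e' = e - single (Suc n) k"
    have split: "e = single (Suc n) k + e'"
      by (rule poly_mapping_eqI) (auto simp: e'_def k_def lookup_add lookup_minus lookup_single when_def)
    have e'0: "lookup e' (Suc n) = 0" by (simp add: e'_def k_def lookup_minus)
    have deg: "k + monom_degree e' = Suc d" and keys: "keys e' \<subseteq> {..Suc n}"
      using e by (auto simp: expts_def split monom_degree_add keys_exponent_add)
    have ee: "single e c = ?x ^ k * single e' c"
      by (simp add: split mvar_power mult_single)
    have "mon_val (\<lambda>i. if i = Suc n then a else mvar i) e' = mon_val mvar e'"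
      using e'0 by (intro mon_val_cong) (auto simp: in_keys_iff)
    then have se: "set_last n a (single e c) = a ^ k * single e' c"
      by (simp add: subst_single split mon_val_add mult.left_commute flip: single_eq_const_mult)
        (metis mult.left_commute single_eq_const_mult)
    let ?g = "(\<Sum>i<k. a ^ (k - Suc i) * ?x ^ i) * single e' c"
    have "single e c - set_last n a (single e c) = (?x - a) * ?g"
    proof -
      have "single e c - set_last n a (single e c) = (?x ^ k - a ^ k) * single e' c"
        unfolding se left_diff_distrib by (simp only: ee)
      then show ?thesis unfolding power_diff_sumr2 by (simp only: mult.assoc)
    qed
    moreover have "?g \<in> forms (Suc n) d"
    proof (cases "k = 0")
      case False
      have "(\<Sum>i<k. a ^ (k - Suc i) * ?x ^ i) \<in> forms (Suc n) (k - 1)"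
      proof (rule forms_sum)
        fix i assume "i \<in> {..<k}"
        then have "(k - Suc i) * 1 + i * 1 = k - 1" by auto
        then show "a ^ (k - Suc i) * ?x ^ i \<in> forms (Suc n) (k - 1)"
          using forms_mult[OF forms_power[OF a', of "k - Suc i"] forms_power[OF x, of i]] by simp
      qed
      moreover have "single e' c \<in> forms (Suc n) (monom_degree e')"
        using keys by (intro forms_single) (simp add: expts_def)
      moreover have "k - 1 + monom_degree e' = d" using deg False by simp
      ultimately show ?thesis using forms_mult by blast
    qed simp
    ultimately show ?thesis by blast
  qed
  then have "\<forall>e\<in>keys f. \<exists>g. g \<in> forms (Suc n) d \<and>
      single e (lookup f e) - set_last n a (single e (lookup f e)) = (?x - a) * g"
    using f unfolding forms_def by blast
  from bchoice[OF this] obtain g where g: "\<And>e. e \<in> keys f \<Longrightarrow> g e \<in> forms (Suc n) d \<and>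
      single e (lookup f e) - set_last n a (single e (lookup f e)) = (?x - a) * g e" by blast
  have "f - set_last n a f =
      (\<Sum>e\<in>keys f. single e (lookup f e)) - set_last n a (\<Sum>e\<in>keys f. single e (lookup f e))"
    by (simp flip: poly_mapping_expand)
  also have "\<dots> = (\<Sum>e\<in>keys f. single e (lookup f e) - set_last n a (single e (lookup f e)))"
    by (simp only: subst_simps(8) sum_subtractf)
  also have "\<dots> = (?x - a) * (\<Sum>e\<in>keys f. g e)"
    unfolding sum_distrib_left by (intro sum.cong) (use g in auto)
  finally show ?thesis
    using g by (intro bexI[of _ "\<Sum>e\<in>keys f. g e"]) (auto intro!: forms_sum)
qed

lemma set_last_eq_0_dvd:
  assumes a: "a \<in> forms n 1" and f: "f \<in> forms (Suc n) d" "f \<noteq> 0" and z: "set_last n a f = 0"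
  obtains g where "d \<ge> 1" "g \<in> forms (Suc n) (d - 1)" "f = (mvar (Suc n) - a) * g"
proof (cases d)
  case 0
  then have "f = single 0 (lookup f 0)" using f(1) forms_0_eq_const by blast
  then have "set_last n a f = f" by (metis subst_const)
  then show thesis using z f by simp
next
  case (Suc d')
  then show thesis using diff_set_last[OF a, of f d'] f z that by auto
qed

text \<open>The linear forms are split off one after another: on the next hyperplane the earlier
  factors become nonzero multiples of \<open>l\<close>, so the vanishing passes to the
  quotient.\<close>

lemma set_last_eq_0_prod_dvd:
  fixes l :: "(nat, 'k::field_char_0) mpoly"
  assumes l: "l \<in> forms n 1" "l \<noteq> 0" and f: "f \<in> forms (Suc n) d" "f \<noteq> 0" and "finite T"
    and z: "\<And>t. t \<in> T \<Longrightarrow> set_last n (single 0 t * l) f = 0"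
  shows "\<exists>g. card T \<le> d \<and> g \<in> forms (Suc n) (d - card T) \<and>
    f = (\<Prod>t\<in>T. mvar (Suc n) - single 0 t * l) * g"
  using \<open>finite T\<close> z
proof (induction T)
  case empty
  then show ?case using f by auto
next
  case (insert t T)
  let ?L = "\<lambda>t. mvar (Suc n) - single 0 t * l"
  obtain g where g: "card T \<le> d" "g \<in> forms (Suc n) (d - card T)" "f = (\<Prod>t\<in>T. ?L t) * g"
    using insert by auto
  have l': "set_last n (single 0 t * l) l = l"
    using subst_cong[OF forms_polys[OF l(1)], of "\<lambda>i. if i = Suc n then single 0 t * l else mvar i" mvar]
    by (simp add: subst_id)
  have "set_last n (single 0 t * l) (?L t') \<noteq> 0" if "t' \<in> T" for t'
  proof -
    have "set_last n (single 0 t * l) (?L t') = single 0 (t - t') * l"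
      by (simp add: subst_simps l' single_diff left_diff_distrib)
    moreover have "single 0 (t - t') \<noteq> (0 :: (nat, 'k) mpoly)"
      using that insert.hyps by (metis eq_iff_diff_eq_0 lookup_single_eq lookup_zero)
    ultimately show ?thesis using l(2) by simp
  qed
  then have "(\<Prod>t'\<in>T. set_last n (single 0 t * l) (?L t')) \<noteq> 0"
    using insert.hyps by (simp add: prod_zero_iff)
  moreover have "(\<Prod>t'\<in>T. set_last n (single 0 t * l) (?L t')) * set_last n (single 0 t * l) g = 0"
    using insert.prems[of t] unfolding g(3) by (simp only: subst_simps insertI1)
  ultimately have zg: "set_last n (single 0 t * l) g = 0" by simp
  have "g \<noteq> 0" using f(2) g(3) by auto
  obtain g' where g': "d - card T \<ge> 1" "g' \<in> forms (Suc n) (d - card T - 1)" "g = ?L t * g'"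
    by (rule set_last_eq_0_dvd[OF forms_const_mult[OF l(1)] g(2) \<open>g \<noteq> 0\<close> zg])
  have "f = (\<Prod>t\<in>insert t T. ?L t) * g'"
    using insert.hyps g(3) g'(3) by (simp add: ac_simps)
  then show ?case using g' insert.hyps by (intro exI[of _ g']) auto
qed

text \<open>Copies of \<open>C\<close> sit in the hyperplanes x_(n+1) = t l. If f is nonzero on one
  of them, its restriction has the same multiplicities on \<open>C\<close>. Otherwise all
  \<open>card T\<close> linear forms divide f; each point lies on exactly one of the hyperplanes, so
  the quotient loses one multiplicity and at least \<open>c\<close> degrees, and induction on m
  applies.\<close>

lemma rigid_product:
  fixes l :: "(nat, 'k::field_char_0) mpoly"
  assumes rigid: "rigid n l C c" and "finite T" "c \<le> real (card T)" "C \<noteq> {}"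
  shows "rigid (Suc n) l ((\<lambda>(p, t). p(Suc n := t * mpoly_eval l p)) ` (C \<times> T)) c" (is "rigid _ _ ?C _")
proof -
  have l: "l \<in> forms n 1" and lC: "\<And>p. p \<in> C \<Longrightarrow> mpoly_eval l p \<noteq> 0" and "finite C"
    using rigid by (auto simp: rigid_def)
  have l0: "l \<noteq> 0" using lC assms(4) by (auto simp: eval_simps)
  have lu: "mpoly_eval l (p(Suc n := x)) = mpoly_eval l p" for p x
    unfolding mpoly_eval_eq_ins ins_def
    by (intro sum.cong refl arg_cong2[of _ _ _ _ "(*)"] mon_val_cong) (use formsD(2)[OF l] in fastforce)
  let ?L = "\<lambda>t. mvar (Suc n) - single 0 t * l"
  have l': "l \<in> forms (Suc n) 1" by (rule forms_mono[OF _ l]) simp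
  have L: "?L t \<in> forms (Suc n) 1" for t
    by (intro forms_diff forms_mvar forms_const_mult l') simp
  have Lne: "?L t \<noteq> 0" for t
  proof
    assume "?L t = 0"
    then have "mpoly_eval (?L t) ((\<lambda>_. 0)(Suc n := 1)) = 0" by (simp add: eval_simps)
    moreover have "mpoly_eval l (\<lambda>_. 0) = 0"
      unfolding mpoly_eval_zero using formsD(1)[OF l, of 0] by (auto simp: in_keys_iff)
    ultimately show False by (simp add: eval_simps lu)
  qed
  have main: "c * real m \<le> real d"
    if "f \<in> forms (Suc n) d" "f \<noteq> 0" "\<And>p t. p \<in> C \<Longrightarrow> t \<in> T \<Longrightarrow> vanishes m (p(Suc n := t * mpoly_eval l p)) f"
    for m d f
    using that
  proof (induction m arbitrary: d f)
    case (Suc m)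
    show ?case
    proof (cases "\<exists>t\<in>T. set_last n (single 0 t * l) f \<noteq> 0")
      case True
      then obtain t where t: "t \<in> T" "set_last n (single 0 t * l) f \<noteq> 0" by blast
      show ?thesis
      proof (rule rigidD[OF rigid _ t(2)])
        show "set_last n (single 0 t * l) f \<in> forms n d"
          by (rule forms_subst[OF Suc.prems(1)]) (auto intro: forms_const_mult l[unfolded One_nat_def] forms_mvar[unfolded One_nat_def])
        fix p assume p: "p \<in> C"
        show "vanishes (Suc m) p (set_last n (single 0 t * l) f)"
        proof (rule vanishes_subst)
          have "(\<lambda>i. mpoly_eval (if i = Suc n then single 0 t * l else mvar i) p) = p(Suc n := t * mpoly_eval l p)"
            by (auto simp: eval_simps)
          then show "vanishes (Suc m) (\<lambda>i. mpoly_eval (if i = Suc n then single 0 t * l else mvar i) p) f"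
            using Suc.prems(3)[OF p t(1)] by (simp only:)
        qed
      qed
    next
      case False
      then obtain g where g: "card T \<le> d" "g \<in> forms (Suc n) (d - card T)" "f = (\<Prod>t\<in>T. ?L t) * g"
        using set_last_eq_0_prod_dvd[OF l l0 Suc.prems(1,2) assms(2)] by blast
      have "c * real m \<le> real (d - card T)"
      proof (rule Suc.IH[OF g(2)])
        show "g \<noteq> 0" using g(3) Suc.prems(2) by auto
        fix p t assume p: "p \<in> C" and t: "t \<in> T"
        let ?q = "p(Suc n := t * mpoly_eval l p)"
        have f: "f = (g * ?L t) * (\<Prod>t'\<in>T - {t}. ?L t')"
          unfolding g(3) prod.remove[OF assms(2) t] by (simp add: ac_simps)
        show "vanishes m ?q g"
        proof (rule vanishes_div_linear[OF vanishes_div_unit L Lne])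
          show "vanishes (Suc m) ?q ((g * ?L t) * (\<Prod>t'\<in>T - {t}. ?L t'))"
            using Suc.prems(3)[OF p t] unfolding f .
          show "mpoly_eval (\<Prod>t'\<in>T - {t}. ?L t') ?q \<noteq> 0"
            using assms(2) lC[OF p] by (simp add: eval_simps lu)
          show "mpoly_eval (?L t) ?q = 0" by (simp add: eval_simps lu)
        qed
      qed
      then have "c * real m + c \<le> real (d - card T) + real (card T)" using assms(3) by simp
      also have "\<dots> = real d" using g(1) by simp
      finally show ?thesis by (simp add: algebra_simps)
    qed
  qed simp
  show ?thesis
    unfolding rigid_def
  proof (intro conjI allI impI)
    show "finite ?C" using assms(2) \<open>finite C\<close> by simp
    show "\<forall>p\<in>?C. mpoly_eval l p \<noteq> 0" using lC by (auto simp: lu)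
    show "c * real m \<le> real d" if "f \<in> forms (Suc n) d" "f \<noteq> 0" "\<forall>p\<in>?C. vanishes m p f" for m d f
      by (rule main[OF that(1,2)]) (use that(3) in auto)
  qed (rule l')
qed

lemma rigid_power:
  fixes l :: "(nat, 'k::field_char_0) mpoly"
  assumes "rigid n l C c" "C \<noteq> {}" "c \<le> real k" "k \<ge> 1"
  shows "\<exists>C' :: (nat \<Rightarrow> 'k) set. rigid (n + j) l C' c \<and> C' \<noteq> {} \<and> card C' \<le> card C * k ^ j"
proof (induction j)
  case 0
  then show ?case using assms by auto
next
  case (Suc j)
  then obtain C' :: "(nat \<Rightarrow> 'k) set" where C': "rigid (n + j) l C' c" "C' \<noteq> {}" "card C' \<le> card C * k ^ j" by blast
  define T :: "'k set" where "T = of_nat ` {..<k}"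
  have "finite T" "card T = k" by (simp_all add: T_def card_image inj_on_def)
  moreover from this have "T \<noteq> {}" using assms(4) by auto
  ultimately have T: "finite T" "card T = k" "T \<noteq> {}" .
  let ?C = "(\<lambda>(p, t). p(Suc (n + j) := t * mpoly_eval l p)) ` (C' \<times> T)"
  have "finite C'" using C' by (simp add: rigid_def)
  have "card ?C \<le> card (C' \<times> T)" by (rule card_image_le) (use T \<open>finite C'\<close> in simp)
  also have "\<dots> = card C' * k" using T by (simp add: card_cartesian_product)
  also have "\<dots> \<le> card C * k ^ Suc j" using C'(3) by (simp add: mult.assoc[symmetric] mult.commute[of k])
  finally have "card ?C \<le> card C * k ^ Suc j" .
  moreover have "rigid (n + Suc j) l ?C c"
    using rigid_product[OF C'(1) T(1) _ C'(2)] T assms(3) by simp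
  moreover have "?C \<noteq> {}" using C' T by auto
  ultimately show ?case by blast
qed

text \<open>Setting x_j = 1 gives the local expansion at the j-th coordinate point. Terms of equal
  degree stay distinct under it, so no cancellation hides the monomial \<open>e\<close>, and its
  degree in the other variables is at least \<open>m\<close>.\<close>

lemma unit_vec_bound:
  fixes f :: "(nat, 'k::field_char_0) mpoly"
  assumes f: "f \<in> forms n d" and van: "vanishes m (unit_vec j) f" and e: "e \<in> keys f"
  shows "lookup e j + m \<le> d"
proof -
  define D where "D = subst (\<lambda>i. if i = j then 1 else mvar i :: (nat, 'k) mpoly)"
  define rest where "rest e = e - single j (lookup e j)" for e :: "nat \<Rightarrow>\<^sub>0 nat"
  have split: "e = single j (lookup e j) + rest e" for e
    by (rule poly_mapping_eqI) (auto simp: rest_def lookup_add lookup_minus lookup_single when_def)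
  have "D f = subst (\<lambda>i. if i = j then 0 else mvar i) (shift (unit_vec j) f)"
    unfolding D_def shift_def subst_subst
    by (rule arg_cong[of _ _ "\<lambda>h. subst h f"]) (auto simp: subst_simps unit_vec_def)
  also have "ord_ge m \<dots>"
    using van by (intro ord_ge_subst) (auto simp: vanishes_def ord_ge_def mvar_def)
  finally have ord: "ord_ge m (D f)" .
  have mon: "single 0 c * mon_val (\<lambda>i. if i = j then 1 else mvar i) e = single (rest e) c" for c :: 'k and e
  proof -
    have "mon_val (\<lambda>i. if i = j then 1 else mvar i) (rest e) = mon_val (mvar :: _ \<Rightarrow> (nat, 'k) mpoly) (rest e)"
      by (intro mon_val_cong) (auto simp: in_keys_iff rest_def lookup_minus)
    then have "mon_val (\<lambda>i. if i = j then 1 else mvar i) e = mon_val (mvar :: _ \<Rightarrow> (nat, 'k) mpoly) (rest e)"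
      by (subst split) (simp add: mon_val_add)
    then show ?thesis by (simp flip: single_eq_const_mult)
  qed
  have inj: "e' = e" if "e' \<in> keys f" "rest e' = rest e" for e'
  proof -
    have "lookup e' j + monom_degree (rest e') = d" "lookup e j + monom_degree (rest e) = d"
      using formsD(1)[OF f that(1)] formsD(1)[OF f e] split[of e'] split[of e]
      by (metis monom_degree_add monom_degree_single)+
    then have "lookup e' j = lookup e j" using that(2) by simp
    then have "single j (lookup e' j) + rest e' = single j (lookup e j) + rest e" using that(2) by simp
    then show ?thesis by (simp only: split[symmetric])
  qed
  have "lookup (D f) (rest e) = (\<Sum>e'\<in>keys f. if e' = e then lookup f e else 0)"
    unfolding D_def subst_def ins_def mon lookup_sum
    by (intro sum.cong) (use inj in \<open>auto simp: lookup_single when_def\<close>)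
  then have "rest e \<in> keys (D f)" using e by (simp add: in_keys_iff)
  then have "m \<le> monom_degree (rest e)" using ord by (auto simp: ord_ge_def)
  moreover have "lookup e j + monom_degree (rest e) = d"
    using formsD(1)[OF f e] split[of e] by (metis monom_degree_add monom_degree_single)
  ultimately show ?thesis by simp
qed

text \<open>The standard quadratic transformation takes forms of degree \<open>d\<close> with multiplicity \<open>m\<close> at the
  coordinate points and at \<open>(1 : \<plusminus>1 : \<plusminus>1)\<close> to forms of degree \<open>2d - 3m\<close> with multiplicity \<open>m\<close> at the
  latter four points, a \<open>2 \<times> 2\<close> grid. Hence \<open>2d - 3m \<ge> 2m\<close>.\<close>

lemma rigid_seven:
  "\<exists>l C. rigid 2 (l :: (nat, 'k::field_char_0) mpoly) C (5 / 2) \<and> C \<noteq> {} \<and> card C \<le> 7"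
proof -
  define C1 :: "(nat \<Rightarrow> 'k) set" where
    "C1 = (\<lambda>(p, t). p(Suc 0 := t * mpoly_eval (mvar 0) p)) ` ({unit_vec 0} \<times> {1, - 1})"
  define C4 :: "(nat \<Rightarrow> 'k) set" where
    "C4 = (\<lambda>(p, t). p(Suc (Suc 0) := t * mpoly_eval (mvar 0) p)) ` (C1 \<times> {1, - 1})"
  have two: "card {1, - 1 :: 'k} = 2" by simp
  have "rigid (Suc 0) (mvar 0) C1 2"
    unfolding C1_def by (rule rigid_product[OF rigid_point]) (simp_all add: two del: card_insert_disjoint)
  then have "rigid (Suc (Suc 0)) (mvar 0) C4 2"
    unfolding C4_def by (rule rigid_product) (simp_all add: two C1_def del: card_insert_disjoint)
  then have C4: "rigid 2 (mvar 0) C4 2" by (simp add: numeral_2_eq_2)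
  have C4_val: "p 0 = 1 \<and> (p 1 = 1 \<or> p 1 = - 1) \<and> (p 2 = 1 \<or> p 2 = - 1)" if "p \<in> C4" for p
    using that by (auto simp: C4_def C1_def unit_vec_def numeral_2_eq_2)
  define U :: "(nat \<Rightarrow> 'k) set" where "U = unit_vec ` {..2}"
  define C where "C = C4 \<union> U"
  \<comment> \<open>The values of \<open>l\<close> are 1, 3, 5 at the coordinate points and 9, -1,
    3, -7 on the grid, all nonzero in characteristic 0.\<close>
  define l :: "(nat, 'k) mpoly" where "l = mvar 0 + single 0 3 * mvar 1 + single 0 5 * mvar 2"
  have l: "l \<in> forms 2 1" unfolding l_def by (intro forms_add forms_const_mult forms_mvar) simp_all
  have fin: "finite C4" using C4 by (simp add: rigid_def)
  have "card C4 \<le> 4"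
  proof -
    have "card C1 \<le> card ({unit_vec 0 :: nat \<Rightarrow> 'k} \<times> {1, - 1 :: 'k})" unfolding C1_def by (rule card_image_le) simp
    then have "card C1 \<le> 2" by (simp add: two card_cartesian_product)
    have "card C4 \<le> card (C1 \<times> {1, - 1 :: 'k})" unfolding C4_def by (rule card_image_le) (simp add: C1_def)
    then show ?thesis using \<open>card C1 \<le> 2\<close> by (simp only: two card_cartesian_product)
  qed
  moreover have "card U \<le> 3" unfolding U_def using card_image_le[of "{..2::nat}" unit_vec] by simp
  ultimately have card: "card C \<le> 7" unfolding C_def using card_Un_le[of C4 U] by simp
  have l_eval: "mpoly_eval l p = p 0 + 3 * p 1 + 5 * p 2" for p
    by (simp only: l_def eval_simps eval_mvar eval_single mon_val_0 mult_1_right)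
  have l_val: "mpoly_eval l p \<noteq> 0" if pC: "p \<in> C" for p
  proof (cases "p \<in> C4")
    case True
    show ?thesis using C4_val[OF True] by (auto simp: l_eval)
  next
    case False
    then obtain j where j: "p = unit_vec j" "j \<le> 2" using pC by (auto simp: C_def U_def)
    then have "j = 0 \<or> j = 1 \<or> j = 2" by auto
    then show ?thesis by (auto simp: l_eval unit_vec_def j)
  qed
  define \<kappa> :: "nat \<Rightarrow> (nat, 'k) mpoly" where
    "\<kappa> i = (if i = 0 then mvar 1 * mvar 2 else if i = 1 then mvar 0 * mvar 2 else mvar 0 * mvar 1)" for i
  define X :: "(nat, 'k) mpoly" where "X = mvar 0 * mvar 1 * mvar 2"
  have ge: "5 / 2 * real m \<le> real d"
    if f: "f \<in> forms 2 d" "f \<noteq> 0" and van: "\<forall>p\<in>C. vanishes m p f" for m d and f :: "(nat, 'k) mpoly"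
  proof -
    have bound: "lookup e j + m \<le> d" if "e \<in> keys f" "j \<le> 2" for e j
      using unit_vec_bound[OF f(1) _ that(1)] van that(2) by (auto simp: C_def U_def)
    have deg: "lookup e 0 + lookup e 1 + lookup e 2 = d" if "e \<in> keys f" for e
    proof -
      have "monom_degree e = (\<Sum>i\<le>2. lookup e i)"
        using formsD(2)[OF f(1) that] by (intro monom_degree_superset) auto
      then show ?thesis using formsD(1)[OF f(1) that] by (simp add: numeral_2_eq_2)
    qed
    let ?m = "\<lambda>e. (mvar 0 :: (nat, 'k) mpoly) ^ (d - m - lookup e 0) * mvar 1 ^ (d - m - lookup e 1) * mvar 2 ^ (d - m - lookup e 2)"
    define g where "g = (\<Sum>e\<in>keys f. single 0 (lookup f e) * ?m e)"
    obtain e0 where e0: "e0 \<in> keys f" using ex_key[OF f(2)] by blast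
    have dm: "3 * m \<le> 2 * d" using bound[OF e0, of 0] bound[OF e0, of 1] bound[OF e0, of 2] deg[OF e0] by simp
    have g: "g \<in> forms 2 (2 * d - 3 * m)"
      unfolding g_def
    proof (intro forms_sum forms_const_mult)
      fix e assume e: "e \<in> keys f"
      have "(d - m - lookup e 0) * 1 + (d - m - lookup e 1) * 1 + (d - m - lookup e 2) * 1 = 2 * d - 3 * m"
        using bound[OF e, of 0] bound[OF e, of 1] bound[OF e, of 2] deg[OF e] by simp
      moreover have "?m e \<in> forms 2 ((d - m - lookup e 0) * 1 + (d - m - lookup e 1) * 1 + (d - m - lookup e 2) * 1)"
        by (intro forms_mult forms_power forms_mvar) simp_all
      ultimately show "?m e \<in> forms 2 (2 * d - 3 * m)" by simp
    qed
    \<comment> \<open>The image of a monomial contains x_j with exponent d - e_j, which is at least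
      m by \<open>bound\<close>. Thus X^m splits off.\<close>
    have \<kappa>f: "subst \<kappa> f = X ^ m * g"
      unfolding subst_def ins_def g_def sum_distrib_left
    proof (intro sum.cong refl)
      fix e assume e: "e \<in> keys f"
      have "mon_val \<kappa> e = (\<Prod>i\<le>2. \<kappa> i ^ lookup e i)"
        using formsD(2)[OF f(1) e] by (intro mon_val_superset) auto
      also have "\<dots> = mvar 0 ^ (lookup e 1 + lookup e 2) * mvar 1 ^ (lookup e 0 + lookup e 2) * mvar 2 ^ (lookup e 0 + lookup e 1)"
        by (simp add: numeral_2_eq_2 \<kappa>_def power_mult_distrib power_add ac_simps)
      also have "lookup e 1 + lookup e 2 = m + (d - m - lookup e 0)"
        using bound[OF e, of 0] deg[OF e] by simp
      also have "lookup e 0 + lookup e 2 = m + (d - m - lookup e 1)"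
        using bound[OF e, of 1] deg[OF e] by simp
      also have "lookup e 0 + lookup e 1 = m + (d - m - lookup e 2)"
        using bound[OF e, of 2] deg[OF e] by simp
      finally have "mon_val \<kappa> e = X ^ m * ?m e"
        by (simp only: power_add X_def power_mult_distrib ac_simps)
      then show "single 0 (lookup f e) * mon_val \<kappa> e = X ^ m * (single 0 (lookup f e) * ?m e)"
        by (simp add: mult.left_commute)
    qed
    have X0: "X \<noteq> 0"
    proof
      assume "X = 0"
      then have "mpoly_eval X (\<lambda>_. 1) = 0" by (simp add: eval_simps)
      then show False by (simp add: X_def eval_simps)
    qed
    \<comment> \<open>The transformation is an involution up to the factor X, so it cannot kill
      f.\<close>
    have "subst \<kappa> (subst \<kappa> f) = subst (\<lambda>i. X * mvar i) f"
      unfolding subst_subst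
      by (rule subst_cong[OF forms_polys[OF f(1)]])
         (auto simp: \<kappa>_def subst_simps X_def ac_simps le_Suc_eq numeral_2_eq_2)
    also have "\<dots> = X ^ d * f" by (simp add: subst_scale_forms[OF f(1)] subst_id)
    finally have "g \<noteq> 0" using X0 f(2) \<kappa>f by (auto simp: subst_simps)
    have "2 * real m \<le> real (2 * d - 3 * m)"
    proof (rule rigidD[OF C4 g \<open>g \<noteq> 0\<close>])
      fix p assume p: "p \<in> C4"
      have v: "p 0 = 1" "p 1 = 1 \<or> p 1 = - 1" "p 2 = 1 \<or> p 2 = - 1" using C4_val[OF p] by auto
      \<comment> \<open>With coordinates \<plusminus>1 the point is fixed projectively: the
        transformation multiplies the vector \<open>p\<close> by p_1 p_2.\<close>
      have "vanishes m (\<lambda>i. (p 1 * p 2) * p i) f"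
        by (rule vanishes_scale[OF f(1)]) (use van p v in \<open>auto simp: C_def\<close>)
      then have "vanishes m (\<lambda>i. mpoly_eval (\<kappa> i) p) f"
        by (rule vanishes_cong[OF forms_polys[OF f(1)], rotated])
           (use v in \<open>auto simp: \<kappa>_def eval_simps le_Suc_eq numeral_2_eq_2\<close>)
      then have "vanishes m p (subst \<kappa> f)" by (rule vanishes_subst)
      then have "vanishes m p (g * X ^ m)" by (simp add: \<kappa>f mult.commute)
      then show "vanishes m p g"
        by (rule vanishes_div_unit) (use v in \<open>auto simp: X_def eval_simps\<close>)
    qed
    then show ?thesis using dm by (simp add: of_nat_diff)
  qed
  have "rigid 2 l C (5 / 2)"
    unfolding rigid_def using l l_val ge fin by (auto simp: C_def U_def)
  moreover have "C \<noteq> {}" by (auto simp: C_def U_def)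
  ultimately show ?thesis using card by blast
qed

subsection \<open>Counting\<close>

text \<open>By Pascal's rule each step adds \<open>(a + j choose n - 1)\<close>, and absorption
  bounds this below by \<open>n * (a choose n)\<close> divided by \<open>a + J - n\<close>, a slope
  independent of \<open>j\<close>.\<close>

lemma binomial_linear_growth:
  assumes "j \<le> J" "n \<le> a" "n \<ge> 1"
  shows "(a + J - n + j * n) * (a choose n) \<le> (a + J - n) * (a + j choose n)"
  using assms(1)
proof (induction j)
  case (Suc j)
  obtain n' where n': "n = Suc n'" using assms(3) by (cases n) auto
  have "n * (a choose n) \<le> n * (a + j choose n)" by (simp add: binomial_right_mono)
  also have "\<dots> = (a + j - n') * (a + j choose n')"
    using binomial_absorption[of n' "a + j"] binomial_absorb_comp[of "a + j" n'] by (simp add: n')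
  also have "\<dots> \<le> (a + J - n) * (a + j choose n')"
    using Suc.prems assms(2) by (intro mult_right_mono) (auto simp: n')
  finally have "n * (a choose n) \<le> (a + J - n) * (a + j choose n')" .
  moreover have "(a + J - n + j * n) * (a choose n) \<le> (a + J - n) * (a + j choose n)"
    using Suc by simp
  moreover have "(a + Suc j choose n) = (a + j choose n') + (a + j choose n)" by (simp add: n')
  ultimately show ?case by (simp add: algebra_simps)
qed simp

text \<open>By absorption the right side is k times \<open>(n * k + k - 1 choose n)\<close>. Linear
  growth over k - 1 steps makes this binomial at least (2n + 1)/(n + 1) times
  \<open>(n * k choose n)\<close>, and k (2n + 1) \<ge> (k + 1) (n + 1).\<close>

lemma binomial_multiple_step:
  assumes k: "k \<ge> 2" and n: "n \<ge> 1"
  shows "(k + 1) * (n * k choose n) \<le> (Suc n * k choose Suc n)"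
proof -
  obtain k' where k': "k = Suc k'" "k' \<ge> 1" using k by (cases k) auto
  let ?C = "n * k choose n" and ?C' = "n * k + k' choose n"
  have "n * k + k' - n = Suc n * k'" by (simp add: k')
  moreover have "(n * k + k' - n + k' * n) * ?C \<le> (n * k + k' - n) * ?C'"
    by (rule binomial_linear_growth) (use k' n in auto)
  ultimately have "k' * ((2 * n + 1) * ?C) \<le> k' * (Suc n * ?C')" by (simp add: algebra_simps)
  then have C': "(2 * n + 1) * ?C \<le> Suc n * ?C'"
    by (subst (asm) nat_mult_le_cancel1) (use k'(2) in auto)
  have "(k + 1) * Suc n \<le> k * (2 * n + 1)"
  proof -
    obtain j where "k = 2 + j" using k by (metis le_iff_add)
    then show ?thesis using n by (simp add: algebra_simps)
  qed
  then have "((k + 1) * Suc n) * ?C \<le> (k * (2 * n + 1)) * ?C" by (rule mult_le_mono1)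
  moreover have "((k + 1) * Suc n) * ?C = Suc n * ((k + 1) * ?C)" by (simp only: mult.commute[of "k + 1"] mult.assoc)
  ultimately have "Suc n * ((k + 1) * ?C) \<le> k * ((2 * n + 1) * ?C)" by (simp only: mult.assoc)
  also have "\<dots> \<le> k * (Suc n * ?C')" using C' by (rule mult_left_mono) simp
  also have "\<dots> = Suc (n * k + k') * ?C'" by (simp add: k' algebra_simps)
  also have "\<dots> = Suc n * (Suc (n * k + k') choose Suc n)" by (rule Suc_times_binomial[symmetric])
  also have "Suc (n * k + k') = Suc n * k" by (simp add: k')
  finally show ?thesis by (simp only: Suc_mult_le_cancel1)
qed

lemma power_le_binomial_multiple:
  assumes "k \<ge> 2" "n0 \<ge> 1" "(k + 1) ^ n0 \<le> (n0 * k choose n0)" "n0 \<le> n"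
  shows "(k + 1) ^ n \<le> (n * k choose n)"
  using assms(4)
proof (induction rule: dec_induct)
  case (step n)
  have "(k + 1) ^ Suc n \<le> (k + 1) * (n * k choose n)"
    unfolding power_Suc by (rule mult_le_mono2[OF step.IH])
  also have "\<dots> \<le> (Suc n * k choose Suc n)"
    by (rule binomial_multiple_step) (use assms step in auto)
  finally show ?case .
qed (use assms in simp)

text \<open>The summand 1 matters, with equality for n = 1 and for k = 3, n = 2; it is affordable
  because only s < (k + 1)^n has to be covered. The other cases grow by
  \<open>power_le_binomial_multiple\<close> from n = 5 for k = 2, from n = 3 for k = 3 and from n =
  2 for k \<ge> 4.\<close>

lemma power_le_Suc_binomial:
  assumes k: "k \<ge> 2" and n: "n \<ge> 1" and ex: "k = 2 \<Longrightarrow> n \<notin> {2, 3, 4}"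
  shows "(k + 1) ^ n \<le> (n * k choose n) + 1"
proof -
  have two: "(2 * k choose 2) = k * (2 * k - 1)" by (simp add: choose_two)
  consider "n = 1" | "k = 2" "n \<ge> 5" | "k = 3" "n = 2" | "k = 3" "n \<ge> 3" | "k \<ge> 4" "n \<ge> 2"
    using assms by fastforce
  then show ?thesis
  proof cases
    case 2
    have "(2 + 1) ^ 5 \<le> (5 * 2 choose 5 :: nat)" by (simp add: eval_nat_numeral)
    from power_le_binomial_multiple[OF _ _ this, of n] show ?thesis using 2 by simp
  next
    case 3
    then show ?thesis by (simp add: choose_two)
  next
    case 4
    have "(3 + 1) ^ 3 \<le> (3 * 3 choose 3 :: nat)" by (simp add: eval_nat_numeral)
    from power_le_binomial_multiple[OF _ _ this, of n] show ?thesis using 4 by simp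
  next
    case 5
    then obtain j where j: "k = 4 + j" by (metis le_iff_add)
    have "(k + 1) ^ 2 \<le> (2 * k choose 2)"
      unfolding two by (simp add: j power2_eq_square algebra_simps)
    from power_le_binomial_multiple[OF _ _ this, of n] show ?thesis using 5 by simp
  qed simp
qed

lemma exists_rigid:
  assumes n: "n \<ge> 1" and s: "s \<ge> 2 ^ n"
  shows "\<exists>r c l. \<exists>C :: (nat \<Rightarrow> 'k::field_char_0) set. r \<ge> 1 \<and> s \<le> (n + (r - 1) choose n) \<and>
    rigid n l C c \<and> C \<noteq> {} \<and> card C \<le> s \<and> real (r + n - 1) \<le> real n * c"
proof -
  \<comment> \<open>The integer part of the n-th root of s.\<close>
  define k where "k = (LEAST k. s < (k + 1) ^ n)"
  have "s < (s + 1) ^ n" using n by (metis Suc_eq_plus1 lessI less_le_trans self_le_power zero_less_Suc One_nat_def Suc_leI)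
  then have k1: "s < (k + 1) ^ n" unfolding k_def by (rule LeastI)
  have "k \<noteq> 0" using k1 s by (cases k) auto
  moreover have "k \<noteq> 1" using k1 s by (auto simp: numeral_2_eq_2)
  ultimately have k2: "k \<ge> 2" by auto
  have "\<not> s < ((k - 1) + 1) ^ n"
    using k2 not_less_Least[of "k - 1" "\<lambda>k. s < (k + 1) ^ n"] by (simp add: k_def)
  then have ks: "k ^ n \<le> s" using k2 by simp
  show ?thesis
  proof (cases "s \<le> (n * k choose n)")
    case True
    obtain C :: "(nat \<Rightarrow> 'k) set" where C: "rigid (0 + n) (mvar 0) C (real k)" "C \<noteq> {}" "card C \<le> card {unit_vec 0 :: nat \<Rightarrow> 'k} * k ^ n"
      using rigid_power[OF rigid_point, of "real k" k n] k2 by auto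
    have "n + (n * (k - 1) + 1 - 1) = n * k" using k2 by (cases k) auto
    then have "s \<le> (n + (n * (k - 1) + 1 - 1) choose n)" using True by simp
    moreover have r: "n * (k - 1) + 1 + n - 1 = n * k" using k2 by (cases k) auto
    have "real (n * (k - 1) + 1 + n - 1) \<le> real n * real k" by (simp only: r of_nat_mult)
    ultimately show ?thesis
      by (intro exI[of _ "n * (k - 1) + 1"] exI[of _ "real k"] exI[of _ "mvar 0"] exI[of _ C] conjI)
         (use C ks in auto)
  next
    case False
    then have "k = 2 \<and> n \<in> {2, 3, 4}" using power_le_Suc_binomial[OF k2 n] k1 by linarith
    then have k: "k = 2" and n': "n = 2 \<or> n = 3 \<or> n = 4" by auto
    obtain l :: "(nat, 'k) mpoly" and C7 where C7: "rigid 2 l C7 (5 / 2)" "C7 \<noteq> {}" "card C7 \<le> 7"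
      using rigid_seven by blast
    obtain C :: "(nat \<Rightarrow> 'k) set" where C: "rigid (2 + (n - 2)) l C (5 / 2)" "C \<noteq> {}" "card C \<le> card C7 * 3 ^ (n - 2)"
      using rigid_power[OF C7(1,2), of 3 "n - 2"] by auto
    have "card C \<le> 7 * 3 ^ (n - 2)" using C(3) C7(3) by (meson le_trans mult_le_mono1)
    \<comment> \<open>For n = 2, 3, 4 this compares 7, 21, 63 points with 7, 21, 71, the least s
      that the binomial (2n choose n) fails to cover.\<close>
    moreover have "7 * 3 ^ (n - 2) \<le> (n * 2 choose n) + 1" using n' by (auto simp: eval_nat_numeral)
    ultimately have "card C \<le> s" using False k by simp
    \<comment> \<open>For n = 2, 3, 4 this compares 9, 27, 81 with (2n + 1 choose n) = 10, 35,
      126.\<close>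
    moreover have "3 ^ n \<le> (n + (n + 2 - 1) choose n)" using n' by (auto simp: eval_nat_numeral)
    then have "s \<le> (n + (n + 2 - 1) choose n)" using k1 k by simp
    moreover have "real (n + 2 + n - 1) \<le> real n * (5 / 2)" using n' by auto
    moreover have "2 + (n - 2) = n" using n' by auto
    ultimately show ?thesis
      using C by (intro exI[of _ "n + 2"] exI[of _ "5 / 2"] exI[of _ l] exI[of _ C]) auto
  qed
qed

text \<open>The points are taken from the vectors of n + 1 natural numbers with sum d, of which
  there are (n + d choose n). Of two different ones each is smaller than the other in some
  coordinate, and \<open>q i\<close> has a factor for every value below a coordinate of the i-th
  point.\<close>

lemma simplex_separators:
  assumes "s \<le> (n + d choose n)"
  shows "\<exists>p :: nat \<Rightarrow> nat \<Rightarrow> 'k::field_char_0. \<exists>q. \<forall>i<s. q i \<in> forms n d \<and>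
    (\<forall>j<s. mpoly_eval (q i) (p j) = 0 \<longleftrightarrow> i \<noteq> j)"
proof -
  define L where "L = {l :: nat list. length l = Suc n \<and> sum_list l = d}"
  have "card L = (d + Suc n - 1 choose d)" unfolding L_def by (rule card_length_sum_list)
  also have "\<dots> = (n + d choose n)" using binomial_symmetric[of n "n + d"] by (simp add: add.commute)
  finally have "s \<le> card L" using assms by simp
  moreover have "finite L"
  proof (rule finite_subset)
    show "L \<subseteq> {l. set l \<subseteq> {..d} \<and> length l = Suc n}"
      by (auto simp: L_def intro: member_le_sum_list)
    show "finite {l. set l \<subseteq> {..d} \<and> length l = Suc n}" by (rule finite_lists_length_eq) simp
  qed
  ultimately obtain a where a: "a ` {..<s} \<subseteq> L" "inj_on a {..<s}"
    using card_le_inj[of "{..<s}" L] by auto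
  define p :: "nat \<Rightarrow> nat \<Rightarrow> 'k" where "p i j = of_nat (a i ! j)" for i j
  define S :: "(nat, 'k) mpoly" where "S = (\<Sum>j\<le>n. mvar j)"
  \<comment> \<open>The homogeneous form of d (x_j - b): on the points the coordinate sum
    \<open>S\<close> equals d.\<close>
  define F :: "nat \<Rightarrow> nat \<Rightarrow> (nat, 'k) mpoly" where "F j b = single 0 (of_nat d) * mvar j - single 0 (of_nat b) * S" for j b
  define q where "q i = (\<Prod>j\<le>n. \<Prod>b<a i ! j. F j b)" for i
  have len: "length (a i) = Suc n" and sum: "(\<Sum>j\<le>n. a i ! j) = d" if "i < s" for i
  proof -
    have "a i \<in> L" using a(1) that by auto
    then show "length (a i) = Suc n" "(\<Sum>j\<le>n. a i ! j) = d"
      by (auto simp: L_def sum_list_sum_nth atLeast0LessThan lessThan_Suc_atMost)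
  qed
  have F1: "F j b \<in> forms n 1" if "j \<le> n" for j b
    unfolding F_def S_def by (intro forms_diff forms_const_mult forms_sum forms_mvar) (use that in auto)
  have q: "q i \<in> forms n d" if "i < s" for i
  proof -
    have "q i \<in> forms n (\<Sum>j\<le>n. \<Sum>b<a i ! j. 1)"
      unfolding q_def by (intro forms_prod F1) auto
    then show ?thesis using sum[OF that] by simp
  qed
  have Fp: "mpoly_eval (F j b) (p i) = of_nat d * (of_nat (a i ! j) - of_nat b)" if "i < s" for i j b
  proof -
    have "mpoly_eval S (p i) = of_nat d"
      unfolding S_def eval_simps by (simp add: p_def sum[OF that] flip: of_nat_sum)
    then show ?thesis by (simp add: F_def eval_simps p_def algebra_simps del: single_of_nat)
  qed
  have eval_q: "mpoly_eval (q i) (p j) = (\<Prod>k\<le>n. \<Prod>b<a i ! k. of_nat d * (of_nat (a j ! k) - of_nat b))" if "j < s" for i j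
    unfolding q_def eval_simps Fp[OF that] ..
  have "mpoly_eval (q i) (p j) = 0 \<longleftrightarrow> i \<noteq> j" if i: "i < s" and j: "j < s" for i j
  proof
    assume "i \<noteq> j"
    have "\<exists>k\<le>n. a j ! k < a i ! k"
    proof (rule ccontr)
      assume "\<not> ?thesis"
      then have le: "\<And>k. k \<in> {..n} \<Longrightarrow> a i ! k \<le> a j ! k" by (auto simp: not_less)
      have "\<forall>k\<in>{..n}. a i ! k = a j ! k"
      proof (rule ccontr)
        assume "\<not> ?thesis"
        then obtain k where "k \<in> {..n}" "a i ! k < a j ! k" using le by (metis le_neq_implies_less)
        then have "(\<Sum>k\<le>n. a i ! k) < (\<Sum>k\<le>n. a j ! k)" by (intro sum_strict_mono_ex1) (use le in auto)
        then show False using sum[OF i] sum[OF j] by simp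
      qed
      then have "a i = a j" by (intro nth_equalityI) (auto simp: len i j)
      then show False using a(2) i j \<open>i \<noteq> j\<close> by (auto dest: inj_onD)
    qed
    then obtain k where k: "k \<le> n" "a j ! k < a i ! k" by blast
    then have "(\<Prod>b<a i ! k. of_nat d * (of_nat (a j ! k) - of_nat b)) = (0 :: 'k)"
      by (intro prod_zero) (auto intro!: bexI[of _ "a j ! k"])
    then show "mpoly_eval (q i) (p j) = 0"
      unfolding eval_q[OF j] using k(1) by (intro prod_zero) auto
  next
    assume z: "mpoly_eval (q i) (p j) = 0"
    show "i \<noteq> j"
    proof
      assume ij: "i = j"
      obtain k b where kb: "k \<le> n" "b < a i ! k" "of_nat d * (of_nat (a i ! k) - of_nat b) = (0 :: 'k)"
        using z unfolding eval_q[OF j] ij by (auto simp: prod_zero_iff)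
      \<comment> \<open>A factor is present only if some coordinate is positive, and then the scalar
        d is nonzero too.\<close>
      have "a i ! k \<le> (\<Sum>k\<le>n. a i ! k)" using kb(1) by (intro member_le_sum) auto
      then have "d > 0" using kb(2) sum[OF i] by simp
      then show False using kb by simp
    qed
  qed
  then show ?thesis using q by blast
qed

subsection \<open>Subadditive sequences\<close>

text \<open>Fekete's lemma, with the infimum over m \<ge> 1 as limit: divide k by a nearly optimal
  m; remainder and \<open>a 0\<close> together contribute at most the constant
  \<open>B\<close>.\<close>

lemma subadditive_convergent:
  fixes a :: "nat \<Rightarrow> real"
  assumes pos: "\<And>m. 0 \<le> a m" and sub: "\<And>m k. a (m + k) \<le> a m + a k"
  shows "convergent (\<lambda>m. a m / real m)"
proof -
  define S where "S = (\<lambda>m. a m / real m) ` {1..}"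
  have bdd: "bdd_below S" unfolding S_def by (rule bdd_belowI[of _ 0]) (use pos in auto)
  have "S \<noteq> {}" by (auto simp: S_def)
  have mul: "a (q * m) \<le> real q * a m + a 0" for q m
  proof (induction q)
    case (Suc q)
    then show ?case using sub[of m "q * m"] by (simp add: algebra_simps)
  qed simp
  have "(\<lambda>m. a m / real m) \<longlonglongrightarrow> Inf S"
  proof (rule LIMSEQ_I)
    fix e :: real assume e: "e > 0"
    obtain x where "x \<in> S" "x < Inf S + e / 2"
      using cInf_lessD[OF \<open>S \<noteq> {}\<close>, of "Inf S + e / 2"] e by auto
    then obtain m where m: "m \<ge> 1" "a m / real m < Inf S + e / 2" by (auto simp: S_def)
    define B where "B = a 0 + (\<Sum>t\<le>m. a t)"
    obtain N where N: "real N > 2 * B / e" using reals_Archimedean2 by blast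
    show "\<exists>N. \<forall>k\<ge>N. norm (a k / real k - Inf S) < e"
    proof (intro exI[of _ "Suc N"] allI impI)
      fix k assume k: "k \<ge> Suc N"
      have "Inf S \<le> a k / real k" by (rule cInf_lower[OF _ bdd]) (use k in \<open>auto simp: S_def\<close>)
      have "a k \<le> a (k div m * m) + a (k mod m)" using sub[of "k div m * m" "k mod m"] by simp
      also have "\<dots> \<le> real (k div m) * a m + B"
      proof -
        have "a (k mod m) \<le> (\<Sum>t\<le>m. a t)"
          using m(1) pos by (intro member_le_sum) (auto intro: less_imp_le)
        then show ?thesis using mul[of "k div m" m] by (simp add: B_def)
      qed
      also have "real (k div m) * a m \<le> real k / real m * a m"
        by (intro mult_right_mono pos) (simp add: of_nat_div_le_of_nat)
      finally have "a k / real k \<le> (real k / real m * a m + B) / real k" by (simp add: divide_right_mono)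
      also have "\<dots> = a m / real m + B / real k" using k m by (simp add: field_simps)
      also have "B / real k < e / 2"
      proof -
        have "2 * B < real N * e" using N e by (simp add: field_simps)
        also have "\<dots> \<le> real k * e" using k e by (intro mult_right_mono) auto
        finally show ?thesis using k by (simp add: field_simps)
      qed
      finally show "norm (a k / real k - Inf S) < e"
        using m(2) \<open>Inf S \<le> a k / real k\<close> by simp
    qed
  qed
  then show ?thesis by (auto simp: convergent_def)
qed

subsection \<open>General points\<close>

lemma proj_tuples_class:
  assumes P: "P \<in> proj_tuples n s" and i: "i < s" and v: "v \<in> P i"
  shows "P i = scaling_rel n `` {v}" and "v \<in> nonzero_vectors n"
proof -
  have "P i \<in> nonzero_vectors n // scaling_rel n"
    using P i by (auto simp: proj_tuples_def proj_space_def)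
  then obtain u where u: "P i = scaling_rel n `` {u}" by (auto elim: quotientE)
  then obtain c where c: "c \<noteq> 0" "v = (\<lambda>j. c * u j)" and uv: "u \<in> nonzero_vectors n" "v \<in> nonzero_vectors n"
    using v by (auto simp: scaling_rel_def)
  show "v \<in> nonzero_vectors n" by fact
  have iff: "x \<in> scaling_rel n `` {y} \<longleftrightarrow>
      y \<in> nonzero_vectors n \<and> x \<in> nonzero_vectors n \<and> (\<exists>c. c \<noteq> 0 \<and> x = (\<lambda>j. c * y j))" for x y :: "nat \<Rightarrow> 'a"
    by (auto simp: scaling_rel_def)
  have "w \<in> scaling_rel n `` {u} \<longleftrightarrow> w \<in> scaling_rel n `` {v}" for w
  proof
    assume "w \<in> scaling_rel n `` {u}"
    then obtain b where b: "b \<noteq> 0" "w = (\<lambda>j. b * u j)" "w \<in> nonzero_vectors n" by (auto simp: scaling_rel_def)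
    then have "b / c \<noteq> 0" "w = (\<lambda>j. (b / c) * v j)" using c by auto
    then show "w \<in> scaling_rel n `` {v}" using uv b(3) unfolding iff by blast
  next
    assume "w \<in> scaling_rel n `` {v}"
    then obtain b where b: "b \<noteq> 0" "w = (\<lambda>j. b * v j)" "w \<in> nonzero_vectors n" by (auto simp: scaling_rel_def)
    then have "b * c \<noteq> 0" "w = (\<lambda>j. (b * c) * u j)" using c by auto
    then show "w \<in> scaling_rel n `` {u}" using uv b(3) unfolding iff by blast
  qed
  then show "P i = scaling_rel n `` {v}" using u by blast
qed

definition separated :: "nat \<Rightarrow> nat \<Rightarrow> nat \<Rightarrow> (nat \<Rightarrow> nat \<Rightarrow> 'k::field) \<Rightarrow> bool" where
  "separated n s d v \<longleftrightarrow> (\<forall>i<s. v i 0 \<noteq> 0) \<and>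
     (\<exists>h. \<forall>i<s. h i \<in> forms n d \<and> (\<forall>j<s. mpoly_eval (h i) (v j) = (if i = j then 1 else 0)))"

definition no_forms :: "nat \<Rightarrow> nat \<Rightarrow> nat \<Rightarrow> nat \<Rightarrow> (nat \<Rightarrow> nat \<Rightarrow> 'k::field) \<Rightarrow> bool" where
  "no_forms n s k d v \<longleftrightarrow> (\<forall>f\<in>forms n d. (\<forall>i<s. vanishes k (v i) f) \<longrightarrow> f = 0)"

text \<open>Multiplication by a power of x_0 raises the degree without losing multiplicity, so one
  degree controls all lower ones.\<close>

lemma no_forms_below:
  assumes nf: "no_forms n s k d v" and d': "d' \<le> d" and f: "f \<in> forms n d'"
    and van: "\<And>i. i < s \<Longrightarrow> vanishes k (v i) f"
  shows "f = (0 :: (nat, 'k::field) mpoly)"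
proof -
  let ?x = "mvar 0 :: (nat, 'k) mpoly"
  have "?x ^ (d - d') * f \<in> forms n ((d - d') * 1 + d')"
    by (intro forms_mult forms_power forms_mvar f) simp
  then have "?x ^ (d - d') * f \<in> forms n d" using d' by simp
  moreover have "vanishes k (v i) (?x ^ (d - d') * f)" if "i < s" for i
    by (rule vanishes_mult1[OF van[OF that]])
  ultimately have "?x ^ (d - d') * f = 0" using nf unfolding no_forms_def by blast
  then show ?thesis by (simp add: mvar_nonzero)
qed

lemma generic_separated:
  assumes "s \<le> (n + d choose n)"
  shows "generic n s (separated n s d :: (nat \<Rightarrow> nat \<Rightarrow> 'k::field_char_0) \<Rightarrow> bool)"
proof -
  obtain p :: "nat \<Rightarrow> nat \<Rightarrow> 'k" and q where "\<forall>i<s. q i \<in> forms n d \<and> (\<forall>j<s. mpoly_eval (q i) (p j) = 0 \<longleftrightarrow> i \<noteq> j)"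
    using simplex_separators[OF assms] by blast
  then have "generic n s (\<lambda>v :: nat \<Rightarrow> nat \<Rightarrow> 'k. \<exists>h. \<forall>i<s. h i \<in> forms n d \<and> (\<forall>j<s. mpoly_eval (h i) (v j) = (if i = j then 1 else 0)))"
    by (intro generic_separators[of s q n d p]) auto
  from generic_conj[OF generic_coord_nonzero this] show ?thesis
    by (rule generic_mono) (simp add: separated_def)
qed

text \<open>The first \<open>card C\<close> entries of the special tuple enumerate \<open>C\<close>;
  the rest may be arbitrary, as further points only add conditions.\<close>

lemma generic_no_forms_below:
  fixes C :: "(nat \<Rightarrow> 'k::field_char_0) set"
  assumes C: "rigid n l C c" "C \<noteq> {}" "card C \<le> s" and d: "real d < c * real k"
  shows "generic n s (no_forms n s k d :: (nat \<Rightarrow> nat \<Rightarrow> 'k) \<Rightarrow> bool)"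
proof -
  have "finite C" using C by (simp add: rigid_def)
  then obtain h where h: "bij_betw h {0..<card C} C" using ex_bij_betw_nat_finite by blast
  show ?thesis
    unfolding no_forms_def
  proof (rule generic_no_forms[of _ _ _ _ h])
    fix f assume f: "f \<in> forms n d" and van: "\<And>i. i < s \<Longrightarrow> vanishes k (h i) f"
    have "vanishes k p f" if "p \<in> C" for p
    proof -
      have "p \<in> h ` {0..<card C}" using h \<open>p \<in> C\<close> by (simp add: bij_betw_def)
      then show ?thesis using van C(3) by auto
    qed
    then show "f = 0" using rigidD[OF C(1) f] d by force
  qed
qed

locale general_points =
  fixes n s r :: nat and v :: "nat \<Rightarrow> nat \<Rightarrow> 'k::field_char_0" and P :: "nat \<Rightarrow> (nat \<Rightarrow> 'k) set"
  assumes n: "n \<ge> 1" and r: "r \<ge> 1" and P: "P \<in> proj_tuples n s"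
    and v: "i < s \<Longrightarrow> v i \<in> P i" and separated: "separated n s (r - 1) v"
begin

lemma obtain_sep:
  obtains sep where "separated_classes n s r v sep P"
proof -
  obtain h where h: "\<forall>i<s. h i \<in> forms n (r - 1) \<and> (\<forall>j<s. mpoly_eval (h i) (v j) = (if i = j then 1 else 0))"
    and v0: "\<forall>i<s. v i 0 \<noteq> 0" using separated by (auto simp: separated_def)
  have "separated_classes n s r v h P"
  proof
    fix i assume i: "i < s"
    show "v i 0 \<noteq> 0" "h i \<in> forms n (r - 1)" "v i \<in> P i" using i v0 h v by auto
    show "mpoly_eval (h i) (v j) = (if i = j then 1 else 0)" if "j < s" for j using h i that by auto
    show "\<exists>c. w = (\<lambda>j. c * v i j)" if "w \<in> P i" for w
      using that proj_tuples_class(1)[OF P i v[OF i]] by (auto simp: scaling_rel_def)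
  qed (rule r)
  then show thesis by (rule that)
qed

text \<open>If P_i = P_j with i and j different, then \<open>h i\<close> would be 0 on all multiples
  of \<open>v j\<close>, one of which is \<open>v i\<close>, where it is 1.\<close>

lemma distinct: "inj_on P {..<s}"
proof (rule inj_onI)
  fix i j assume ij: "i \<in> {..<s}" "j \<in> {..<s}" "P i = P j"
  obtain h where h: "h i \<in> forms n (r - 1)" "mpoly_eval (h i) (v i) = 1"
    "mpoly_eval (h i) (v j) = (if i = j then 1 else 0)"
    using separated ij by (auto simp: separated_def)
  have "v i \<in> P j" using v ij by auto
  then obtain c where "c \<noteq> 0" "v i = (\<lambda>k. c * v j k)"
    using proj_tuples_class(1)[OF P, of j "v j"] v ij by (auto simp: scaling_rel_def)
  then have "mpoly_eval (h i) (v i) = c ^ (r - 1) * mpoly_eval (h i) (v j)"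
    using eval_forms_scale[OF h(1)] by simp
  then show "i = j" using h by (auto split: if_splits)
qed

lemma symbolic_power_degree:
  assumes nf: "no_forms n s (n * m) (m * (r + n - 1) - 1) v" and m: "m \<ge> 1"
    and f: "f \<in> forms n t" "f \<noteq> 0" and van: "\<And>i. i < s \<Longrightarrow> vanishes (n * m) (v i) f"
  shows "m * (r + n - 1) \<le> t"
proof (rule ccontr)
  assume "\<not> ?thesis"
  then have "t \<le> m * (r + n - 1) - 1" by simp
  from no_forms_below[OF nf this f(1) van] show False using f(2) by simp
qed

lemma symbolic_power_vanishes:
  "f \<in> symbolic_power n s P m \<Longrightarrow> i < s \<Longrightarrow> vanishes m (v i) (hcomp t f)"
  using vanishes_point_ideal_power[OF v] by (auto simp: symbolic_power_def)

lemma symbolic_containment: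
  assumes "m \<ge> 1 \<Longrightarrow> no_forms n s (n * m) (m * (r + n - 1) - 1) v"
  shows "symbolic_power n s P (n * m) \<subseteq>
    ideal_prod (poly_ring n) (ipow n (irrelevant_ideal n) ((n - 1) * m)) (ipow n (radical_ideal n s P) m)"
proof -
  obtain sep where "separated_classes n s r v sep P" by (rule obtain_sep)
  then interpret separated_classes n s r v sep P .
  show ?thesis
  proof (rule containment[OF n])
    fix f t assume f: "f \<in> symbolic_power n s P (n * m)" "hcomp t f \<noteq> 0"
    show "m * (r + n - 1) \<le> t"
    proof (cases "m = 0")
      case False
      have "f \<in> polys n" using f by (simp add: symbolic_power_def)
      then show ?thesis
        using symbolic_power_degree[OF assms _ hcomp_in_forms f(2)] symbolic_power_vanishes[OF f(1)] False by simp
    qed simp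
  qed
qed

text \<open>The lift of x_1^r to I_r is congruent to x_1^r modulo x_0, hence nonzero. This gives
  \<alpha>(I) \<le> r.\<close>

lemma radical_ideal_form:
  obtains q where "q \<in> radical_ideal n s P" "q \<in> forms n r" "q \<noteq> 0"
proof -
  obtain sep where "separated_classes n s r v sep P" by (rule obtain_sep)
  then interpret separated_classes n s r v sep P .
  have \<mu>: "single 1 r \<in> pexpts n r" using n by (auto simp: pexpts_def expts_def lookup_single)
  obtain q where q: "q \<in> van r" "x0div (q - single (single 1 r) 1)" using van_lift[OF \<mu>] by blast
  have "lookup (q - single (single 1 r) 1) (single 1 r) = 0"
    using q(2) by (simp add: x0div_iff lookup_single)
  then have "q \<noteq> 0" by (auto simp: lookup_minus)
  then show thesis using that van_radical_ideal[OF q(1)] van_forms[OF q(1)] by blast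
qed

lemma total_degree_forms: "f \<in> forms n' d \<Longrightarrow> f \<noteq> 0 \<Longrightarrow> total_degree f = d"
proof -
  assume f: "f \<in> forms n' d" "f \<noteq> 0"
  obtain e where "e \<in> keys f" using ex_key[OF f(2)] by blast
  then have "monom_degree ` keys f = {d}" using formsD(1)[OF f(1)] by auto
  then show ?thesis by (simp add: total_degree_def)
qed

lemma radical_symbolic: "radical_ideal n s P \<subseteq> symbolic_power n s P 1"
proof -
  have "ipow n (point_ideal n p) (Suc 0) = point_ideal n p" for p :: "(nat \<Rightarrow> 'k) set"
  proof -
    have "ipow n (point_ideal n p) (Suc 0) = ideal_prod (poly_ring n) (point_ideal n p) (polys n)"
      unfolding ipow_Suc ipow_0 by (rule PR.ideal_prod_commute[OF PR.oneideal ideal_point_ideal])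
    then show ?thesis using PR.ideal_prod_one[OF ideal_point_ideal] by simp
  qed
  then show ?thesis by (auto simp: radical_ideal_def symbolic_power_def)
qed

text \<open>\<open>initial_degree\<close> is a least number, meaningful only once a nonzero element
  exists; powers of the form in I_r supply one.\<close>

lemma symbolic_power_nonzero: "\<exists>f\<in>symbolic_power n s P m. f \<noteq> 0"
proof -
  obtain q where q: "q \<in> radical_ideal n s P" "q \<noteq> 0" by (rule radical_ideal_form)
  have "q ^ m \<in> symbolic_power n s P m"
  proof (induction m)
    case 0
    then show ?case by (simp add: symbolic_power_def)
  next
    case (Suc m)
    then show ?case using symbolic_power_mult[OF _ Suc, of q 1] radical_symbolic q(1) by auto
  qed
  then show ?thesis using q(2) by (intro bexI[of _ "q ^ m"]) auto
qed

lemma initial_degree_le: "f \<in> J \<Longrightarrow> f \<noteq> 0 \<Longrightarrow> initial_degree J \<le> total_degree f"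
  unfolding initial_degree_def by (rule Least_le) blast

lemma initial_degree_attained:
  "\<exists>f\<in>J. f \<noteq> 0 \<Longrightarrow> \<exists>f\<in>J. f \<noteq> 0 \<and> total_degree f = initial_degree J"
  unfolding initial_degree_def by (rule LeastI_ex) blast

lemma initial_degree_radical: "initial_degree (radical_ideal n s P) \<le> r"
proof -
  obtain q where "q \<in> radical_ideal n s P" "q \<in> forms n r" "q \<noteq> 0" by (rule radical_ideal_form)
  then show ?thesis using initial_degree_le total_degree_forms by metis
qed

lemma le_total_degree: "e \<in> keys f \<Longrightarrow> monom_degree e \<le> total_degree f"
  unfolding total_degree_def by (intro Max_ge) auto

lemma total_degree_mult: "total_degree (f * g) \<le> total_degree f + total_degree g"
  for f g :: "(nat, 'k) mpoly"
  unfolding total_degree_def[of "f * g"]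
proof (intro Max.boundedI)
  fix t assume "t \<in> insert 0 (monom_degree ` keys (f * g))"
  then show "t \<le> total_degree f + total_degree g"
    using keys_mult[of f g] le_total_degree[of _ f] le_total_degree[of _ g]
    by (fastforce simp: monom_degree_add intro: add_mono)
qed auto

text \<open>The n-th power of a nonzero component of multiplicity m has multiplicity n m, so the
  degree bound at multiplicity n m applies to it.\<close>

lemma initial_degree_symbolic_power:
  assumes nf: "no_forms n s (n * m) (m * (r + n - 1) - 1) v" and m: "m \<ge> 1"
  shows "m * (r + n - 1) \<le> n * initial_degree (symbolic_power n s P m)"
proof -
  obtain f where f: "f \<in> symbolic_power n s P m" "f \<noteq> 0"
    "total_degree f = initial_degree (symbolic_power n s P m)"
    using initial_degree_attained[OF symbolic_power_nonzero] by blast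
  obtain e where e: "e \<in> keys f" using ex_key[OF f(2)] by blast
  let ?t = "monom_degree e"
  have "f \<in> polys n" using f by (simp add: symbolic_power_def)
  then have g: "hcomp ?t f \<in> forms n ?t" by (rule hcomp_in_forms)
  have "lookup (hcomp ?t f) e \<noteq> 0" using e by (simp add: lookup_hcomp in_keys_iff)
  then have "hcomp ?t f \<noteq> 0" by auto
  then have "hcomp ?t f ^ n \<noteq> 0" by simp
  then have "m * (r + n - 1) \<le> n * ?t"
    using symbolic_power_degree[OF nf m forms_power[OF g]] vanishes_power[OF symbolic_power_vanishes[OF f(1)]]
    by blast
  also have "\<dots> \<le> n * total_degree f" using le_total_degree[OF e] by simp
  finally show ?thesis using f(3) by simp
qed

lemma chudnovsky:
  assumes nf: "\<And>m. m \<ge> 1 \<Longrightarrow> no_forms n s (n * m) (m * (r + n - 1) - 1) v"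
  defines "\<beta> \<equiv> (real (initial_degree (radical_ideal n s P)) + real n - 1) / real n"
  shows "\<And>m. m \<ge> 1 \<Longrightarrow> real (initial_degree (symbolic_power n s P m)) / real m \<ge> \<beta>"
    and "waldschmidt_constant n s P \<ge> \<beta>"
proof -
  let ?a = "\<lambda>m. real (initial_degree (symbolic_power n s P m))"
  show ge: "?a m / real m \<ge> \<beta>" if m: "m \<ge> 1" for m
  proof -
    have "real (m * (r + n - 1)) \<le> real (n * initial_degree (symbolic_power n s P m))"
      using initial_degree_symbolic_power[OF nf[OF m] m] by (simp only: of_nat_le_iff)
    moreover have "real (r + n - 1) = real r + real n - 1" using n by (simp add: of_nat_diff)
    ultimately have "real m * (real r + real n - 1) \<le> real n * ?a m" by simp
    moreover have "real m * (real (initial_degree (radical_ideal n s P)) + real n - 1) \<le> real m * (real r + real n - 1)"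
      using initial_degree_radical by (intro mult_left_mono) auto
    ultimately have "real m * (real (initial_degree (radical_ideal n s P)) + real n - 1) \<le> real n * ?a m"
      by (rule order_trans[rotated])
    then show ?thesis using n m by (simp add: \<beta>_def field_simps)
  qed
  have "convergent (\<lambda>m. ?a m / real m)"
  proof (rule subadditive_convergent)
    fix a b
    obtain f g where f: "f \<in> symbolic_power n s P a" "f \<noteq> 0" "total_degree f = initial_degree (symbolic_power n s P a)"
      and g: "g \<in> symbolic_power n s P b" "g \<noteq> 0" "total_degree g = initial_degree (symbolic_power n s P b)"
      using initial_degree_attained[OF symbolic_power_nonzero] by metis
    have "initial_degree (symbolic_power n s P (a + b)) \<le> total_degree (f * g)"
      by (rule initial_degree_le[OF symbolic_power_mult[OF f(1) g(1)]]) (use f g in simp)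
    then show "?a (a + b) \<le> ?a a + ?a b" using total_degree_mult[of f g] f(3) g(3) by simp
  qed simp
  then have "(\<lambda>m. ?a m / real m) \<longlonglongrightarrow> waldschmidt_constant n s P"
    unfolding waldschmidt_constant_def convergent_LIMSEQ_iff .
  then show "waldschmidt_constant n s P \<ge> \<beta>"
    by (rule LIMSEQ_le_const) (use ge in blast)
qed

end

theorem theorem1:
  fixes n s :: nat
  assumes "n \<ge> 1" and "s \<ge> 2 ^ n"
  shows "(\<forall>m :: nat. holds_general n s (\<lambda>P :: nat \<Rightarrow> (nat \<Rightarrow> 'k::field_char_0) set.
            inj_on P {..<s} \<and>
            symbolic_power n s P (n * m) \<subseteq>
              (irrelevant_ideal n [^]\<^bsub>ideals_set (poly_ring n)\<^esub> ((n - 1) * m))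
              \<cdot>\<^bsub>poly_ring n\<^esub> (radical_ideal n s P [^]\<^bsub>ideals_set (poly_ring n)\<^esub> m))) \<and>
         holds_very_general n s (\<lambda>P :: nat \<Rightarrow> (nat \<Rightarrow> 'k::field_char_0) set.
            inj_on P {..<s} \<and>
            (\<forall>m \<ge> 1. real (initial_degree (symbolic_power n s P m)) / real m
               \<ge> (real (initial_degree (radical_ideal n s P)) + real n - 1) / real n) \<and>
            waldschmidt_constant n s P
               \<ge> (real (initial_degree (radical_ideal n s P)) + real n - 1) / real n)"
    (is "(\<forall>m. holds_general n s (?G m)) \<and> holds_very_general n s ?V")
proof -
  obtain r c l and C :: "(nat \<Rightarrow> 'k) set" where r: "r \<ge> 1" "s \<le> (n + (r - 1) choose n)"
    and C: "rigid n l C c" "C \<noteq> {}" "card C \<le> s" and c: "real (r + n - 1) \<le> real n * c"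
    using exists_rigid[OF assms, where 'k='k] by blast
  \<comment> \<open>The guard m \<ge> 1 is essential: for m = 0 truncated subtraction gives degree
    0, and nonzero constants satisfy the empty vanishing condition.\<close>
  define Q :: "nat \<Rightarrow> (nat \<Rightarrow> nat \<Rightarrow> 'k) \<Rightarrow> bool" where
    "Q m v \<longleftrightarrow> separated n s (r - 1) v \<and> (m \<ge> 1 \<longrightarrow> no_forms n s (n * m) (m * (r + n - 1) - 1) v)" for m v
  have "generic n s (Q m)" for m
  proof (cases "m = 0")
    case True
    then show ?thesis using generic_separated[OF r(2), where 'k='k] by (auto simp: Q_def elim: generic_mono)
  next
    case False
    \<comment> \<open>Staying one degree below the target makes the inequality strict even when r +
      n - 1 = n c, as it is for grids.\<close>
    have "real (m * (r + n - 1) - 1) < real (m * (r + n - 1))" using False r(1) assms(1) by simp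
    also have "\<dots> \<le> c * real (n * m)" using mult_left_mono[OF c, of "real m"] by (simp add: ac_simps)
    finally have "generic n s (no_forms n s (n * m) (m * (r + n - 1) - 1) :: (nat \<Rightarrow> nat \<Rightarrow> 'k) \<Rightarrow> bool)"
      by (rule generic_no_forms_below[OF C])
    from generic_conj[OF generic_separated[OF r(2)] this] show ?thesis
      by (rule generic_mono) (simp add: Q_def)
  qed
  then have "\<exists>Z. zariski_closed n s Z \<and> Z \<noteq> proj_tuples n s \<and> Z \<subseteq> proj_tuples n s \<and>
      (\<forall>P\<in>proj_tuples n s - Z. \<exists>v. (\<forall>i<s. v i \<in> P i) \<and> Q m v)" for m
    by (rule generic_closed) (simp add: Q_def separated_def)
  then obtain Z where Z: "\<And>m. zariski_closed n s (Z m)" "\<And>m. Z m \<noteq> proj_tuples n s" "\<And>m. Z m \<subseteq> proj_tuples n s"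
    and ZQ: "\<And>m P. P \<in> proj_tuples n s - Z m \<Longrightarrow> \<exists>v. (\<forall>i<s. v i \<in> P i) \<and> Q m v"
    by metis
  show ?thesis
  proof (intro conjI allI)
    fix m
    show "holds_general n s (?G m)"
      unfolding holds_general_def
    proof (rule exI[of _ "proj_tuples n s - Z m"], rule conjI[OF _ conjI[OF _ ballI]])
      show "zariski_open n s (proj_tuples n s - Z m)" by (rule zariski_open_compl) (rule Z)+
      show "proj_tuples n s - Z m \<noteq> {}" using Z(2,3)[of m] by blast
      fix P assume P: "P \<in> proj_tuples n s - Z m"
      then obtain v where vQ: "\<forall>i<s. v i \<in> P i" "Q m v" using ZQ by blast
      interpret general_points n s r v P
        by standard (use assms r P vQ in \<open>auto simp: Q_def\<close>)
      show "?G m P" using distinct symbolic_containment[of m] vQ by (simp add: Q_def)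
    qed
  next
    show "holds_very_general n s ?V"
      unfolding holds_very_general_def
    proof (rule exI[of _ "range Z"], rule conjI[OF _ conjI[OF _ ballI]])
      show "countable (range Z)" by simp
    next
      show "\<forall>Y\<in>range Z. zariski_closed n s Y \<and> Y \<noteq> proj_tuples n s" using Z by blast
    next
      fix P assume P: "P \<in> proj_tuples n s - \<Union> (range Z)"
      have "\<exists>v. (\<forall>i<s. v i \<in> P i) \<and> Q m v" for m by (rule ZQ) (use P in blast)
      then obtain v where v: "\<And>m i. i < s \<Longrightarrow> v m i \<in> P i" "\<And>m. Q m (v m)" by metis
      \<comment> \<open>The representatives depend on \<open>m\<close>; rescaling them to those chosen for \<open>m = 0\<close> keeps all conditions.\<close>
      have nf: "no_forms n s (n * m) (m * (r + n - 1) - 1) (v 0)" if m: "m \<ge> 1" for m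
        unfolding no_forms_def
      proof (intro ballI impI)
        fix f :: "(nat, 'k) mpoly"
        assume f: "f \<in> forms n (m * (r + n - 1) - 1)" and van: "\<forall>i<s. vanishes (n * m) (v 0 i) f"
        have "vanishes (n * m) (v m i) f" if i: "i < s" for i
        proof -
          have "v m i \<in> scaling_rel n `` {v 0 i}"
            using proj_tuples_class(1)[of P n s i "v 0 i"] v(1) P i by auto
          then obtain b where "b \<noteq> 0" "v m i = (\<lambda>j. b * v 0 i j)" by (auto simp: scaling_rel_def)
          then show ?thesis using vanishes_scale[OF f] van i by auto
        qed
        then show "f = 0" using v(2)[of m] m f by (auto simp: Q_def no_forms_def)
      qed
      interpret general_points n s r "v 0" P
        by standard (use assms r P v(1) v(2)[of 0] in \<open>auto simp: Q_def\<close>)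
      show "?V P"
        using distinct chudnovsky[OF nf] by blast
    qed
  qed
qed

end
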